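(* Let $T>0$ and suppose that $\vec x:[0,1]\times[0,T]\to\mathbb{R}_{\ge 0}\times\mathbb{R}$ satisfies the Smoothness Assumption (see context). Then there exist $h_0>0$, $\gamma>0$ and a constant $C>0$, with $C$ independent of $h$ and $\Delta t$, such that for all integers $J\ge 2$, $M\ge 1$ with $h=\frac1J$ and $\Delta t=\frac TM$ satisfying $0<h\le h_0$ and $\Delta t\le\gamma h$, the discrete solution $(\vec X^m)_{m=1,\ldots,M}$ of the Scheme (see context) exists, and the error $$\vec E^m_j:=\vec x(q_j,t_m)-\vec X^m_j,\qquad j=0,\ldots,J,\ m=0,\ldots,M,$$ satisfies $$\max_{1\le m\le M}\Bigl[\|\vec E^m\|_{1,h}^2+\max_{0\le j\le J}|\vec E^m_j|^2\Bigr]\le C\bigl(h^4+(\Delta t)^2\bigr),$$ $$\Delta t\sum_{m=1}^M\Bigl[|\vec E^m|_{2,h}^2+\Bigl|\frac{\vec E^m-\vec E^{m-1}}{\Delta t}\Bigr|_{0,h}^2\Bigr]\le C\bigl(h^4+(\Delta t)^2\bigr).$$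
   Context: Notation: $\vec e_1,\vec e_2$ is the standard basis of $\mathbb{R}^2$; $\cdot^\perp$ denotes clockwise rotation by $\frac\pi2$, i.e. $(a,b)^\perp=(b,-a)$. Smoothness Assumption: $\vec x:[0,1]\times[0,T]\to\mathbb{R}_{\ge0}\times\mathbb{R}$ solves $$\vec x_t=\frac{\vec x_{\rho\rho}}{|\vec x_\rho|^2}-\frac1{|\vec x_\rho|^2}\,\frac{\vec x_\rho\cdot\vec e_2}{\vec x\cdot\vec e_1}\,\vec x_\rho^\perp\quad\text{in }(0,1)\times(0,T],$$ $$\vec x\cdot\vec e_1=0,\quad \vec x_\rho\cdot\vec e_2=0\quad\text{on }\{0,1\}\times[0,T];$$ the derivatives $\partial_t^i\partial_\rho^j\vec x$ exist and are continuous on $[0,1]\times[0,T]$ for all $i,j\in\mathbb{N}_0$ with $2i+j\le4$; $\vec x_\rho(\rho,t)\ne0$ for all $(\rho,t)\in[0,1]\times[0,T]$; and $\vec x\cdot\vec e_1>0$ in $(0,1)\times[0,T]$. Grid: $h=\frac1J$, $q_j=jh$ ($j=0,\ldots,J$), $\mathcal G_h=\{q_0,\ldots,q_J\}$; $\Delta t=\frac TM$, $t_m=m\Delta t$ ($m=0,\ldots,M$). For $\vec v:\mathcal G_h\to\mathbb{R}^2$ write $\vec v_j=\vec v(q_j)$ and $\delta^-\vec v_j=\frac{\vec v_j-\vec v_{j-1}}h$ ($1\le j\le J$), $\delta^+\vec v_j=\frac{\vec v_{j+1}-\vec v_j}h$ ($0\le j\le J-1$), $\delta^1\vec v_j=\frac{\vec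 v_{j+1}-\vec v_{j-1}}{2h}$ and $\delta^2\vec v_j=\frac{\vec v_{j+1}-2\vec v_j+\vec v_{j-1}}{h^2}$ ($1\le j\le J-1$). Discrete norms: $|\vec v|_{0,h}^2=\frac12h|\vec v_0|^2+h\sum_{j=1}^{J-1}|\vec v_j|^2+\frac12h|\vec v_J|^2$, $|\vec v|_{1,h}^2=h\sum_{j=1}^J|\delta^-\vec v_j|^2$, $\|\vec v\|_{1,h}^2=|\vec v|_{0,h}^2+|\vec v|_{1,h}^2$, $|\vec v|_{2,h}^2=h\sum_{j=1}^{J-1}|\delta^2\vec v_j|^2$. Scheme: $\vec X^0_j=\vec x(q_j,0)$, $j=0,\ldots,J$. For $m=0,\ldots,M-1$ find $\vec X^{m+1}:\mathcal G_h\to\mathbb{R}^2$ such that for $j=1,\ldots,J-1$ $$\frac{\vec X^{m+1}_j-\vec X^m_j}{\Delta t}=\frac{\delta^2\vec X^{m+1}_j}{|\delta^1\vec X^m_j|^2}-\frac1{|\delta^1\vec X^m_j|^2}\,\frac{\delta^1\vec X^{m+1}_j\cdot\vec e_2}{\vec X^m_j\cdot\vec e_1}\,(\delta^1\vec X^m_j)^\perp,$$ together with $$\vec X^{m+1}_0\cdot\vec e_1=0,\quad \delta^+\vec X^{m+1}_0\cdot\vec e_2=\tfrac14h|\delta^+\vec X^m_0|^2\,\frac{\vec X^{m+1}_0-\vec X^m_0}{\Delta t}\cdot\vec e_2,$$ $$\vec X^{m+1}_J\cdot\vec e_1=0,\quad \delta^-\vec X^{m+1}_J\cdot\vec e_2=-\tfrac14h|\delta^-\vec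 X^m_J|^2\,\frac{\vec X^{m+1}_J-\vec X^m_J}{\Delta t}\cdot\vec e_2.$$ Existence of the discrete solution means that in each step the denominators do not vanish and the linear system for $\vec X^{m+1}$ is solvable. *)

theory Defs
  imports "HOL-Analysis.Analysis"
begin

abbreviation e1 :: "real^2" where "e1 \<equiv> axis 1 1"
abbreviation e2 :: "real^2" where "e2 \<equiv> axis 2 1"

text \<open>Clockwise rotation by \<open>pi/2\<close>.\<close>
definition perp :: "real^2 \<Rightarrow> real^2" where
  "perp v = vector [v $ 2, - (v $ 1)]"


text \<open>A parametrised evolving curve is a curried function of \<open>\<rho> \<in> {0..1}\<close> and \<open>t \<in> {0..T}\<close>.
  Partial derivatives are taken relative to these intervals, hence one-sided at the end points.\<close>

definition d_rho :: "(real \<Rightarrow> real \<Rightarrow> real^2) \<Rightarrow> real \<Rightarrow> real \<Rightarrow> real^2" where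
  "d_rho f \<rho> t = vector_derivative (\<lambda>r. f r t) (at \<rho> within {0..1})"

definition d_t :: "real \<Rightarrow> (real \<Rightarrow> real \<Rightarrow> real^2) \<Rightarrow> real \<Rightarrow> real \<Rightarrow> real^2" where
  "d_t T f \<rho> t = vector_derivative (\<lambda>s. f \<rho> s) (at t within {0..T})"

definition d_mixed :: "real \<Rightarrow> nat \<Rightarrow> nat \<Rightarrow> (real \<Rightarrow> real \<Rightarrow> real^2) \<Rightarrow> real \<Rightarrow> real \<Rightarrow> real^2" where
  "d_mixed T i j f = (d_t T ^^ i) ((d_rho ^^ j) f)"

text \<open>The first two conjuncts say that the derivatives exist (\<open>vector_derivative\<close> is total):
  differentiating first \<open>j\<close> times in \<open>\<rho>\<close>, then \<open>i\<close> times in \<open>t\<close>.\<close>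
definition parabolic_C4 :: "real \<Rightarrow> (real \<Rightarrow> real \<Rightarrow> real^2) \<Rightarrow> bool" where
  "parabolic_C4 T x \<longleftrightarrow>
     (\<forall>j. Suc j \<le> 4 \<longrightarrow> (\<forall>\<rho>\<in>{0..1}. \<forall>t\<in>{0..T}.
        (\<lambda>r. d_mixed T 0 j x r t) differentiable (at \<rho> within {0..1}))) \<and>
     (\<forall>i j. 2 * Suc i + j \<le> 4 \<longrightarrow> (\<forall>\<rho>\<in>{0..1}. \<forall>t\<in>{0..T}.
        (\<lambda>s. d_mixed T i j x \<rho> s) differentiable (at t within {0..T}))) \<and>
     (\<forall>i j. 2 * i + j \<le> 4 \<longrightarrow>
        continuous_on ({0..1} \<times> {0..T}) (\<lambda>(\<rho>, t). d_mixed T i j x \<rho> t))"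

definition smoothness_assumption :: "real \<Rightarrow> (real \<Rightarrow> real \<Rightarrow> real^2) \<Rightarrow> bool" where
  "smoothness_assumption T x \<longleftrightarrow>
     (\<forall>\<rho>\<in>{0..1}. \<forall>t\<in>{0..T}. x \<rho> t \<bullet> e1 \<ge> 0) \<and>
     parabolic_C4 T x \<and>
     (\<forall>\<rho>\<in>{0<..<1}. \<forall>t\<in>{0<..T}.
        d_t T x \<rho> t =
          (1 / (norm (d_rho x \<rho> t))\<^sup>2) *\<^sub>R d_rho (d_rho x) \<rho> t
          - (1 / (norm (d_rho x \<rho> t))\<^sup>2 * ((d_rho x \<rho> t \<bullet> e2) / (x \<rho> t \<bullet> e1)))
              *\<^sub>R perp (d_rho x \<rho> t)) \<and>
     (\<forall>\<rho>\<in>{0, 1}. \<forall>t\<in>{0..T}. x \<rho> t \<bullet> e1 = 0 \<and> d_rho x \<rho> t \<bullet> e2 = 0) \<and>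
     (\<forall>\<rho>\<in>{0..1}. \<forall>t\<in>{0..T}. d_rho x \<rho> t \<noteq> 0) \<and>
     (\<forall>\<rho>\<in>{0<..<1}. \<forall>t\<in>{0..T}. x \<rho> t \<bullet> e1 > 0)"


text \<open>A grid function \<open>v\<close> with values \<open>v\<^sub>0, \<dots>, v\<^sub>J\<close> is a function on \<open>nat\<close>; only its values at
  indices \<open>j \<le> J\<close> are ever used.\<close>

definition mesh :: "nat \<Rightarrow> real" where
  "mesh J = 1 / real J"

definition node :: "nat \<Rightarrow> nat \<Rightarrow> real" where
  "node J j = real j * mesh J"

definition delta_minus :: "nat \<Rightarrow> (nat \<Rightarrow> real^2) \<Rightarrow> nat \<Rightarrow> real^2" where
  "delta_minus J v j = (v j - v (j - 1)) /\<^sub>R mesh J"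

definition delta_plus :: "nat \<Rightarrow> (nat \<Rightarrow> real^2) \<Rightarrow> nat \<Rightarrow> real^2" where
  "delta_plus J v j = (v (j + 1) - v j) /\<^sub>R mesh J"

definition delta1 :: "nat \<Rightarrow> (nat \<Rightarrow> real^2) \<Rightarrow> nat \<Rightarrow> real^2" where
  "delta1 J v j = (v (j + 1) - v (j - 1)) /\<^sub>R (2 * mesh J)"

definition delta2 :: "nat \<Rightarrow> (nat \<Rightarrow> real^2) \<Rightarrow> nat \<Rightarrow> real^2" where
  "delta2 J v j = (v (j + 1) - 2 *\<^sub>R v j + v (j - 1)) /\<^sub>R (mesh J)\<^sup>2"

text \<open>Squares of the discrete norms and seminorms.\<close>

definition norm0_sq :: "nat \<Rightarrow> (nat \<Rightarrow> real^2) \<Rightarrow> real" where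
  "norm0_sq J v = 1/2 * mesh J * (norm (v 0))\<^sup>2 + mesh J * (\<Sum>j=1..J-1. (norm (v j))\<^sup>2)
     + 1/2 * mesh J * (norm (v J))\<^sup>2"

definition seminorm1_sq :: "nat \<Rightarrow> (nat \<Rightarrow> real^2) \<Rightarrow> real" where
  "seminorm1_sq J v = mesh J * (\<Sum>j=1..J. (norm (delta_minus J v j))\<^sup>2)"

definition norm1_sq :: "nat \<Rightarrow> (nat \<Rightarrow> real^2) \<Rightarrow> real" where
  "norm1_sq J v = norm0_sq J v + seminorm1_sq J v"

definition seminorm2_sq :: "nat \<Rightarrow> (nat \<Rightarrow> real^2) \<Rightarrow> real" where
  "seminorm2_sq J v = mesh J * (\<Sum>j=1..J-1. (norm (delta2 J v j))\<^sup>2)"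


text \<open>One time step, from \<open>U\<close> at the old to \<open>V\<close> at the new time level, with step size \<open>\<tau>\<close>.\<close>
definition scheme_step :: "nat \<Rightarrow> real \<Rightarrow> (nat \<Rightarrow> real^2) \<Rightarrow> (nat \<Rightarrow> real^2) \<Rightarrow> bool" where
  "scheme_step J \<tau> U V \<longleftrightarrow>
     (\<forall>j\<in>{1..J-1}.
        (V j - U j) /\<^sub>R \<tau> =
          (1 / (norm (delta1 J U j))\<^sup>2) *\<^sub>R delta2 J V j
          - (1 / (norm (delta1 J U j))\<^sup>2 * ((delta1 J V j \<bullet> e2) / (U j \<bullet> e1)))
              *\<^sub>R perp (delta1 J U j)) \<and>
     V 0 \<bullet> e1 = 0 \<and>
     delta_plus J V 0 \<bullet> e2
       = 1/4 * mesh J * (norm (delta_plus J U 0))\<^sup>2 * (((V 0 - U 0) /\<^sub>R \<tau>) \<bullet> e2) \<and>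
     V J \<bullet> e1 = 0 \<and>
     delta_minus J V J \<bullet> e2
       = - (1/4 * mesh J * (norm (delta_minus J U J))\<^sup>2 * (((V J - U J) /\<^sub>R \<tau>) \<bullet> e2))"

definition nonvanishing_denominators :: "nat \<Rightarrow> (nat \<Rightarrow> real^2) \<Rightarrow> bool" where
  "nonvanishing_denominators J U \<longleftrightarrow>
     (\<forall>j\<in>{1..J-1}. (norm (delta1 J U j))\<^sup>2 \<noteq> 0 \<and> U j \<bullet> e1 \<noteq> 0)"

text \<open>\<open>X m j\<close> is the value at time level \<open>m \<le> M\<close> and node \<open>j \<le> J\<close>.\<close>
definition discrete_solution ::
  "(real \<Rightarrow> real \<Rightarrow> real^2) \<Rightarrow> real \<Rightarrow> nat \<Rightarrow> nat \<Rightarrow> (nat \<Rightarrow> nat \<Rightarrow> real^2) \<Rightarrow> bool" where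
  "discrete_solution x T J M X \<longleftrightarrow>
     (\<forall>j\<in>{0..J}. X 0 j = x (node J j) 0) \<and>
     (\<forall>m<M. nonvanishing_denominators J (X m) \<and>
             scheme_step J (T / real M) (X m) (X (m + 1)))"

definition err ::
  "(real \<Rightarrow> real \<Rightarrow> real^2) \<Rightarrow> real \<Rightarrow> nat \<Rightarrow> nat \<Rightarrow> (nat \<Rightarrow> nat \<Rightarrow> real^2) \<Rightarrow> nat \<Rightarrow> nat \<Rightarrow> real^2" where
  "err x T J M X m j = x (node J j) (real m * (T / real M)) - X m j"

end

theory Submission
  imports Defs
begin

text \<open>
  Write the curve as \<open>(a, b)\<close> and the error as \<open>(\<alpha>, \<beta>)\<close>. Testing the error equations with the negative second
  differences of the new error gives control of the discrete \<open>H\<^sup>1\<close> seminorm. The singular term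
  \<open>(a\<^sub>\<rho> / a) \<beta>\<^sub>\<rho>\<close> is not a perturbation but has a good sign: \<open>a\<^sub>\<rho> / a\<close> behaves like \<open>1 / \<rho>\<close> at the
  left end (and symmetrically at the right one), and \<open>\<integral> \<beta>\<^sub>\<rho>\<^sub>\<rho> \<beta>\<^sub>\<rho> / \<rho>\<close> dominates a multiple of
  \<open>\<integral> (\<beta>\<^sub>\<rho> / \<rho>)\<^sup>2\<close>. The boundary terms of the discrete version are absorbed by the time derivative that the
  scheme puts into the boundary condition.
  All nonlinear coefficients are evaluated at the old time level, where by induction and
  \<open>|\<delta>\<^sup>- E|\<^sup>2 \<le> |E|\<^sub>1\<^sub>,\<^sub>h\<^sup>2 / h = O(h)\<close> (this uses \<open>\<Delta>t \<le> \<gamma> h\<close>) they are uniformly close to those of the exact solution;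
  hence a discrete Gronwall argument closes. Second-order consistency up to the axis rests on \<open>a\<^sub>\<rho>\<^sub>\<rho> = 0\<close>,
  \<open>b\<^sub>\<rho>\<^sub>\<rho>\<^sub>\<rho> = 0\<close> and \<open>2 b\<^sub>\<rho>\<^sub>\<rho> = |x\<^sub>\<rho>|\<^sup>2 b\<^sub>t\<close> there, which follow from the singular equation itself.
  The linear systems are solvable because the second component decouples and both components then
  satisfy tridiagonal systems with a maximum principle.
\<close>

section \<open>A discrete energy estimate for the linearised error equations\<close>

text \<open>The obstacle is the weight \<open>1 / om\<close>, unbounded at the axis. If \<epsilon>
  bounds the slopes of the old error, a coefficient of the scheme is off by a multiple of \<epsilon>
  / \<open>om\<close>. This is no bounded perturbation for Gronwall; it has to be absorbed by the
  weighted term \<open>Z\<close> that the singular operator yields. So \<epsilon> must stay below a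
  threshold fixed by the curve, and coefficient bounds have the shape
  \<open>L + \<eta> / om j\<close> with small \<eta>. The old error itself may be divided by
  \<open>om\<close>, by Hardy's inequality, as its first component vanishes at both ends. The
  coupling is one-sided: both equations contain only the centred difference of the new second
  component, so \<open>Z\<close> of that component serves both energies. The 1/4 in the boundary
  condition stems from a Taylor expansion and also yields a boundary gain \<open>4 D g^2 / h\<close>
  (slope \<open>g\<close>, inverse squared speed \<open>D\<close>). It beats the loss
  \<open>l g^2 / h\<close> of the singular term because the pole strength \<open>l\<close> is at
  most \<open>2 D\<close>. Space and time derivatives are never interchanged: time increments are
  differentiated in space. One \<open>K\<close> bounds all data and the reciprocals of the lower
  bounds.\<close>

definition bdiff :: "real \<Rightarrow> (nat \<Rightarrow> real) \<Rightarrow> nat \<Rightarrow> real" where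
  "bdiff h u j = (u j - u (j - 1)) / h"

definition cdiff :: "real \<Rightarrow> (nat \<Rightarrow> real) \<Rightarrow> nat \<Rightarrow> real" where
  "cdiff h u j = (u (j + 1) - u (j - 1)) / (2 * h)"

definition sdiff :: "real \<Rightarrow> (nat \<Rightarrow> real) \<Rightarrow> nat \<Rightarrow> real" where
  "sdiff h u j = (u (j + 1) - 2 * u j + u (j - 1)) / h\<^sup>2"

lemma bdiff_diff: "bdiff h (\<lambda>j. u j - v j) j = bdiff h u j - bdiff h v j"
  by (simp add: bdiff_def diff_divide_distrib)

lemma cdiff_diff: "cdiff h (\<lambda>j. u j - v j) j = cdiff h u j - cdiff h v j"
  by (simp add: cdiff_def diff_divide_distrib)

lemma sdiff_diff: "sdiff h (\<lambda>j. u j - v j) j = sdiff h u j - sdiff h v j"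
  by (simp add: sdiff_def diff_divide_distrib[symmetric] algebra_simps)

lemma cdiff_bdiff: "h \<noteq> 0 \<Longrightarrow> cdiff h u j = (bdiff h u (Suc j) + bdiff h u j) / 2"
  by (simp add: cdiff_def bdiff_def field_simps)

lemma sdiff_bdiff: "h \<noteq> 0 \<Longrightarrow> sdiff h u j = (bdiff h u (Suc j) - bdiff h u j) / h"
  by (simp add: sdiff_def bdiff_def field_simps power2_eq_square)

lemma power2_mean_le: "((x + y) / 2)\<^sup>2 \<le> (x\<^sup>2 + y\<^sup>2) / 2" for x y :: real
  using sum_squares_bound[of x y] by (simp add: power2_eq_square field_simps)

lemma young_inequality: "0 < (c::real) \<Longrightarrow> x * y \<le> c * x\<^sup>2 + y\<^sup>2 / (4 * c)"
proof -
  assume c: "0 < c"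
  have "0 \<le> (2 * c * x - y)\<^sup>2 / (4 * c)" using c by simp
  also have "\<dots> = c * x\<^sup>2 + y\<^sup>2 / (4 * c) - x * y"
    using c by (simp add: power2_eq_square field_simps)
  finally show ?thesis by simp
qed

section \<open>Summation by parts and Hardy-type inequalities on the integers\<close>

lemma summation_by_parts:
  fixes v w :: "nat \<Rightarrow> real"
  shows "(\<Sum>j=1..n. v j * (w (j + 1) - 2 * w j + w (j - 1)))
    = v (Suc n) * (w (Suc n) - w n) - v 0 * (w 1 - w 0)
      - (\<Sum>j=1..Suc n. (v j - v (j - 1)) * (w j - w (j - 1)))"
  by (induction n) (simp_all add: algebra_simps)

lemma discrete_hardy:
  fixes u :: "nat \<Rightarrow> real"
  assumes "u 0 = 0"
  shows "(\<Sum>j=1..n. (u j / real j)\<^sup>2) \<le> 4 * (\<Sum>j=1..n. (u j - u (j - 1))\<^sup>2)"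
proof -
  \<comment> \<open>The subtracted term strengthens the induction hypothesis so that the step
    becomes a sum of two squares.\<close>
  have "(\<Sum>j=1..n. (u j / real j)\<^sup>2)
      \<le> 4 * (\<Sum>j=1..n. (u j - u (j - 1))\<^sup>2) - 2 * real n * (u n / real n)\<^sup>2"
  proof (induction n)
    case 0
    show ?case by simp
  next
    case (Suc n)
    define s where "s = u (Suc n) / real (Suc n)"
    define r where "r = u n / real n"
    define d where "d = u (Suc n) - u n"
    have d: "d = real (Suc n) * s - real n * r"
      using assms by (cases "n = 0") (simp_all add: d_def s_def r_def)
    have "4 * d\<^sup>2 - 2 * real (Suc n) * s\<^sup>2 + 2 * real n * r\<^sup>2 - s\<^sup>2
        = (2 * d - s)\<^sup>2 + 2 * real n * (r - s)\<^sup>2"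
      unfolding d by (simp add: power2_eq_square algebra_simps)
    moreover have "\<dots> \<ge> 0" by simp
    ultimately have "s\<^sup>2 \<le> 4 * d\<^sup>2 - 2 * real (Suc n) * s\<^sup>2 + 2 * real n * r\<^sup>2" by linarith
    with Suc show ?case
      by (simp add: s_def[symmetric] r_def[symmetric] d_def[symmetric] algebra_simps
          del: of_nat_Suc)
  qed
  moreover have "0 \<le> 2 * real n * (u n / real n)\<^sup>2" by simp
  ultimately show ?thesis by linarith
qed

text \<open>The discrete form of \<open>\<integral> w'' w' / \<rho> = (1/2) \<integral> (w' / \<rho>)\<^sup>2\<close> plus a boundary term, with \<open>G = (w')\<^sup>2\<close>.\<close>

lemma singular_summation:
  fixes G :: "nat \<Rightarrow> real"
  assumes "\<And>j. 0 \<le> G j"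
  shows "(\<Sum>j=1..n. (G (j + 1) - G j) / real j)
    \<ge> (\<Sum>j=1..n. (G j + G (j + 1)) / (real j)\<^sup>2) / 3 - 4 / 3 * G 1"
proof (cases "n = 0")
  case True
  then show ?thesis using assms[of 1] by simp
next
  case False
  then have "n \<ge> 1" by simp
  \<comment> \<open>The extra term keeps the top value \<open>G (n + 1)\<close> for the induction.
    For \<open>n = 1\<close> the claim is an equality, which fixes 4/3; the step amounts to
    \<open>r^2 + r - 1 >= 0\<close>. Any factor up to 2/5 in place of 1/3 would survive the step
    from \<open>r = 1\<close>.\<close>
  then have "(\<Sum>j=1..n. (G (j + 1) - G j) / real j)
    \<ge> (\<Sum>j=1..n. (G j + G (j + 1)) / (real j)\<^sup>2) / 3 - 4 / 3 * G 1
      + (1 / real n - 1 / (3 * (real n)\<^sup>2)) * G (n + 1)"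
  proof (induction n rule: nat_induct_at_least)
    case base
    show ?case by (simp add: field_simps)
  next
    case (Suc n)
    define r where "r = real n"
    have r: "r \<ge> 1" using Suc.hyps by (simp add: r_def)
    have "1 / r - 1 / (3 * r\<^sup>2) - 1 / (r + 1) - 1 / (3 * (r + 1)\<^sup>2)
        = (r\<^sup>2 + r - 1) / (3 * r\<^sup>2 * (r + 1)\<^sup>2)"
      using r by (simp add: divide_simps power2_eq_square) (simp add: algebra_simps)
    moreover have "r\<^sup>2 + r - 1 \<ge> 0" using r self_le_power[of r 2] by simp
    ultimately have "0 \<le> 1 / r - 1 / (3 * r\<^sup>2) - 1 / (r + 1) - 1 / (3 * (r + 1)\<^sup>2)"
      by simp
    then have "0 \<le> (1 / r - 1 / (3 * r\<^sup>2) - 1 / (r + 1) - 1 / (3 * (r + 1)\<^sup>2)) * G (n + 1)"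
      using assms by (intro mult_nonneg_nonneg) auto
    then have *: "(1 / r - 1 / (3 * r\<^sup>2)) * G (n + 1)
        \<ge> G (n + 1) / (r + 1) + G (n + 1) / (r + 1)\<^sup>2 / 3"
      by (simp add: left_diff_distrib)
    have s: "real (Suc n) = r + 1" by (simp add: r_def)
    have "(\<Sum>j=1..Suc n. (G (j + 1) - G j) / real j)
        = (\<Sum>j=1..n. (G (j + 1) - G j) / real j) + (G (n + 2) - G (n + 1)) / (r + 1)"
      by (simp add: r_def)
    moreover have "(\<Sum>j=1..Suc n. (G j + G (j + 1)) / (real j)\<^sup>2)
        = (\<Sum>j=1..n. (G j + G (j + 1)) / (real j)\<^sup>2) + (G (n + 1) + G (n + 2)) / (r + 1)\<^sup>2"
      by (simp add: r_def)
    ultimately show ?case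
      using Suc.IH * unfolding s r_def[symmetric]
      by (simp add: diff_divide_distrib add_divide_distrib left_diff_distrib)
  qed
  moreover have "(1 / real n - 1 / (3 * (real n)\<^sup>2)) * G (n + 1) \<ge> 0"
  proof (intro mult_nonneg_nonneg)
    show "0 \<le> 1 / real n - 1 / (3 * (real n)\<^sup>2)"
      using \<open>n \<ge> 1\<close> by (simp add: divide_simps power2_eq_square)
  qed (use assms in auto)
  ultimately show ?thesis by linarith
qed

section \<open>The uniform grid, its weight and the discrete seminorms\<close>

locale grid =
  fixes J :: nat and h :: real
  assumes J_ge_2: "J \<ge> 2" and h_def: "h = 1 / real J"
begin

definition q :: "nat \<Rightarrow> real" where "q j = real j * h"

text \<open>Up to a factor 2 this is the distance to the nearer end. The product treats both ends at
  once and splits into their poles by partial fractions, see \<open>inverse_om\<close>.\<close>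

definition om :: "nat \<Rightarrow> real" where "om j = q j * (1 - q j)"

definition S1 :: "(nat \<Rightarrow> real) \<Rightarrow> real" where
  "S1 u = h * (\<Sum>j=1..J. (bdiff h u j)\<^sup>2)"

definition S2 :: "(nat \<Rightarrow> real) \<Rightarrow> real" where
  "S2 u = h * (\<Sum>j=1..J-1. (sdiff h u j)\<^sup>2)"

definition Z :: "(nat \<Rightarrow> real) \<Rightarrow> real" where
  "Z u = h * (\<Sum>j=1..J-1. (cdiff h u j / om j)\<^sup>2)"

text \<open>The boundary condition makes the slopes at the ends of order \<open>h\<close> times a
  velocity, so after division by \<open>h\<close> they weigh as much as a boundary velocity in the
  squared discrete norm.\<close>

definition G :: "(nat \<Rightarrow> real) \<Rightarrow> real" where
  "G u = ((bdiff h u 1)\<^sup>2 + (bdiff h u J)\<^sup>2) / h"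

lemma h_pos: "0 < h" and h_neq: "h \<noteq> 0" and h_le: "h \<le> 1/2" and Jh: "real J * h = 1"
  using J_ge_2 by (auto simp: h_def field_simps)

lemma q_bounds: "j \<in> {1..J-1} \<Longrightarrow> h \<le> q j" "j \<in> {1..J-1} \<Longrightarrow> h \<le> 1 - q j"
proof -
  assume j: "j \<in> {1..J-1}"
  have "1 * h \<le> real j * h" using j h_pos by (intro mult_right_mono) auto
  then show "h \<le> q j" by (simp add: q_def)
  have "real (j + 1) * h \<le> real J * h" using j h_pos by (intro mult_right_mono) auto
  then show "h \<le> 1 - q j" unfolding Jh by (simp add: q_def algebra_simps)
qed

lemma q_pos: "j \<in> {1..J-1} \<Longrightarrow> 0 < q j" "j \<in> {1..J-1} \<Longrightarrow> q j < 1"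
  using q_bounds[of j] h_pos by auto

lemma om_pos: "j \<in> {1..J-1} \<Longrightarrow> 0 < om j"
  using q_pos[of j] by (auto simp: om_def)

lemma om_le_1: "j \<in> {1..J-1} \<Longrightarrow> om j \<le> 1"
  using q_pos[of j] by (simp add: om_def mult_le_one)

lemma h_le_om: "j \<in> {1..J-1} \<Longrightarrow> h \<le> 2 * om j"
proof -
  assume j: "j \<in> {1..J-1}"
  have "0 \<le> (q j - h) * (1 - q j - h)" using q_bounds[OF j] by simp
  then have "h * (1 - h) \<le> om j" by (simp add: om_def algebra_simps)
  moreover have "h * (1/2) \<le> h * (1 - h)" using h_le h_pos by (intro mult_left_mono) auto
  ultimately show ?thesis by simp
qed

lemma q_reflect: "j \<le> J \<Longrightarrow> q (J - j) = 1 - q j"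
  using Jh by (simp add: q_def of_nat_diff left_diff_distrib)

lemma sum_reflect: "(\<Sum>j=1..J-1. f j) = (\<Sum>j=1..J-1. f (J - j))" for f :: "nat \<Rightarrow> real"
  using sum.atLeastAtMost_rev[of f 1 "J-1"] J_ge_2 by simp

lemma inverse_om: "j \<in> {1..J-1} \<Longrightarrow> 1 / om j = 1 / q j + 1 / (1 - q j)"
  using q_pos[of j] by (simp add: om_def field_simps)

lemma inverse_om_sq: "j \<in> {1..J-1} \<Longrightarrow> (x / om j)\<^sup>2 \<le> 2 * ((x / q j)\<^sup>2 + (x / (1 - q j))\<^sup>2)"
proof -
  assume j: "j \<in> {1..J-1}"
  have "x / om j = x * (1 / om j)" by simp
  also have "\<dots> = x / q j + x / (1 - q j)"
    unfolding inverse_om[OF j] by (simp add: distrib_left)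
  finally show ?thesis
    using power2_mean_le[of "x / q j" "x / (1 - q j)"] by (simp add: power_divide mult.commute)
qed

lemma S1_nonneg: "0 \<le> S1 u" and S2_nonneg: "0 \<le> S2 u" and Z_nonneg: "0 \<le> Z u" and G_nonneg: "0 \<le> G u"
  using h_pos by (auto simp: S1_def S2_def Z_def G_def intro!: mult_nonneg_nonneg sum_nonneg)

lemma sum_bdiff_split:
  "(\<Sum>j=1..J. f j) = (\<Sum>j=1..J-1. f j) + f J"
  "(\<Sum>j=1..J. f j) = f 1 + (\<Sum>j=1..J-1. f (Suc j))" for f :: "nat \<Rightarrow> real"
proof -
  obtain n where n: "J = Suc n" using J_ge_2 by (cases J) auto
  show "(\<Sum>j=1..J. f j) = (\<Sum>j=1..J-1. f j) + f J" by (simp add: n)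
  have "(\<Sum>j=1..Suc n. f j) = f 1 + (\<Sum>j=Suc 1..Suc n. f j)"
    by (subst sum.atLeast_Suc_atMost) auto
  also have "(\<Sum>j=Suc 1..Suc n. f j) = (\<Sum>j=1..n. f (Suc j))"
    by (rule sum.shift_bounds_cl_Suc_ivl)
  finally show "(\<Sum>j=1..J. f j) = f 1 + (\<Sum>j=1..J-1. f (Suc j))" by (simp add: n)
qed

lemma sum_cdiff_le: "h * (\<Sum>j=1..J-1. (cdiff h u j)\<^sup>2) \<le> S1 u"
proof -
  have "(\<Sum>j=1..J-1. (cdiff h u j)\<^sup>2)
      \<le> (\<Sum>j=1..J-1. ((bdiff h u (Suc j))\<^sup>2 + (bdiff h u j)\<^sup>2) / 2)"
    by (intro sum_mono) (simp only: cdiff_bdiff[OF h_neq] power2_mean_le)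
  also have "\<dots> = ((\<Sum>j=1..J-1. (bdiff h u (Suc j))\<^sup>2) + (\<Sum>j=1..J-1. (bdiff h u j)\<^sup>2)) / 2"
    by (simp only: sum.distrib sum_divide_distrib add_divide_distrib)
  also have "\<dots> \<le> (\<Sum>j=1..J. (bdiff h u j)\<^sup>2)"
  proof -
    have "(\<Sum>j=1..J-1. (bdiff h u (Suc j))\<^sup>2) \<le> (\<Sum>j=1..J. (bdiff h u j)\<^sup>2)"
      using sum_bdiff_split(2)[of "\<lambda>j. (bdiff h u j)\<^sup>2"] by simp
    moreover have "(\<Sum>j=1..J-1. (bdiff h u j)\<^sup>2) \<le> (\<Sum>j=1..J. (bdiff h u j)\<^sup>2)"
      using sum_bdiff_split(1)[of "\<lambda>j. (bdiff h u j)\<^sup>2"] by simp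
    ultimately show ?thesis by argo
  qed
  finally show ?thesis using h_pos by (simp add: S1_def)
qed

text \<open>Hardy from the left end and, for the reflected function, from the right end;
  \<open>inverse_om_sq\<close> joins them, so 16 = 2 * (4 + 4).\<close>

lemma hardy_om:
  assumes "u 0 = 0" "u J = 0"
  shows "h * (\<Sum>j=1..J-1. (u j / om j)\<^sup>2) \<le> 16 * S1 u"
proof -
  have left: "h * (\<Sum>j=1..J-1. (v j / q j)\<^sup>2) \<le> 4 * S1 v" if "v 0 = 0" for v
  proof -
    have "(\<Sum>j=1..J-1. (v j / q j)\<^sup>2) = (\<Sum>j=1..J-1. (v j / real j)\<^sup>2) / h\<^sup>2"
      unfolding sum_divide_distrib by (intro sum.cong) (auto simp: q_def power_divide power_mult_distrib)
    also have "\<dots> \<le> 4 * (\<Sum>j=1..J-1. (v j - v (j - 1))\<^sup>2) / h\<^sup>2"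
      using discrete_hardy[of v "J-1", OF that] by (intro divide_right_mono) auto
    also have "\<dots> = 4 * (\<Sum>j=1..J-1. (bdiff h v j)\<^sup>2)"
      by (simp add: bdiff_def power_divide sum_divide_distrib sum_distrib_left)
    also have "\<dots> \<le> 4 * (\<Sum>j=1..J. (bdiff h v j)\<^sup>2)"
      using sum_bdiff_split(1)[of "\<lambda>j. (bdiff h v j)\<^sup>2"] zero_le_power2[of "bdiff h v J"] by linarith
    finally show ?thesis using h_pos by (simp add: S1_def)
  qed
  define v where "v j = u (J - j)" for j
  have "S1 v = S1 u"
  proof -
    have "(\<Sum>j=1..J. (bdiff h v j)\<^sup>2) = (\<Sum>j=1..J. (bdiff h v (J + 1 - j))\<^sup>2)"
      using sum.atLeastAtMost_rev[of "\<lambda>j. (bdiff h v j)\<^sup>2" 1 J] by simp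
    also have "\<dots> = (\<Sum>j=1..J. (bdiff h u j)\<^sup>2)"
    proof (intro sum.cong refl)
      fix j assume j: "j \<in> {1..J}"
      have "J - (J + 1 - j) = j - 1" "J - (J + 1 - j - 1) = j" using j by auto
      then show "(bdiff h v (J + 1 - j))\<^sup>2 = (bdiff h u j)\<^sup>2"
        by (simp add: bdiff_def v_def power_divide power2_commute)
    qed
    finally show ?thesis by (simp add: S1_def)
  qed
  moreover have "(\<Sum>j=1..J-1. (v j / q j)\<^sup>2) = (\<Sum>j=1..J-1. (u j / (1 - q j))\<^sup>2)"
    by (subst sum_reflect, intro sum.cong) (auto simp: v_def q_reflect)
  ultimately have right: "h * (\<Sum>j=1..J-1. (u j / (1 - q j))\<^sup>2) \<le> 4 * S1 u"
    using left[of v] assms by (simp add: v_def)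
  have "(\<Sum>j=1..J-1. (u j / om j)\<^sup>2) \<le> (\<Sum>j=1..J-1. 2 * ((u j / q j)\<^sup>2 + (u j / (1 - q j))\<^sup>2))"
    by (intro sum_mono inverse_om_sq)
  also have "\<dots> = 2 * ((\<Sum>j=1..J-1. (u j / q j)\<^sup>2) + (\<Sum>j=1..J-1. (u j / (1 - q j))\<^sup>2))"
    by (simp add: sum.distrib sum_distrib_left)
  finally have "h * (\<Sum>j=1..J-1. (u j / om j)\<^sup>2)
      \<le> h * (2 * ((\<Sum>j=1..J-1. (u j / q j)\<^sup>2) + (\<Sum>j=1..J-1. (u j / (1 - q j))\<^sup>2)))"
    using h_pos by (intro mult_left_mono) auto
  also have "\<dots> = 2 * (h * (\<Sum>j=1..J-1. (u j / q j)\<^sup>2) + h * (\<Sum>j=1..J-1. (u j / (1 - q j))\<^sup>2))" by (simp add: algebra_simps)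
  finally show ?thesis using left[of u, OF assms(1)] right by argo
qed

text \<open>Exact discrete form of \<open>w' w'' = ((w')^2)' / 2\<close>: the centred and the second
  difference are the mean and the difference quotient of the same two backward differences. So the
  sign of the singular term survives discretisation without a remainder.\<close>

lemma cdiff_sdiff:
  "cdiff h u j * sdiff h u j = ((bdiff h u (Suc j))\<^sup>2 - (bdiff h u j)\<^sup>2) / (2 * h)"
  unfolding cdiff_bdiff[OF h_neq] sdiff_bdiff[OF h_neq]
  using h_neq by (simp add: field_simps power2_eq_square)

lemma singular_coercive_left:
  "h * (\<Sum>j=1..J-1. cdiff h u j * sdiff h u j / q j)
    \<ge> (h * (\<Sum>j=1..J-1. (cdiff h u j / q j)\<^sup>2)) / 3 - 2 / 3 * ((bdiff h u 1)\<^sup>2 / h)"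
proof -
  define Q where "Q j = (bdiff h u j)\<^sup>2" for j
  have Q: "0 \<le> Q j" for j by (simp add: Q_def)
  have 1: "h * (\<Sum>j=1..J-1. cdiff h u j * sdiff h u j / q j)
      = (\<Sum>j=1..J-1. (Q (j + 1) - Q j) / real j) / (2 * h)"
    unfolding cdiff_sdiff sum_distrib_left sum_divide_distrib
    using h_neq by (intro sum.cong) (auto simp: Q_def q_def)
  have "h * (\<Sum>j=1..J-1. (cdiff h u j / q j)\<^sup>2)
      \<le> h * (\<Sum>j=1..J-1. ((Q j + Q (j + 1)) / 2) / (q j)\<^sup>2)"
  proof (intro mult_left_mono sum_mono)
    fix j assume "j \<in> {1..J-1}"
    have "(cdiff h u j)\<^sup>2 \<le> (Q j + Q (j + 1)) / 2"
      unfolding cdiff_bdiff[OF h_neq] Q_def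
      using power2_mean_le[of "bdiff h u (Suc j)" "bdiff h u j"] by (simp add: add.commute)
    then show "(cdiff h u j / q j)\<^sup>2 \<le> ((Q j + Q (j + 1)) / 2) / (q j)\<^sup>2"
      unfolding power_divide by (intro divide_right_mono) auto
  qed (use h_pos in auto)
  also have "\<dots> = (\<Sum>j=1..J-1. (Q j + Q (j + 1)) / (real j)\<^sup>2) / (2 * h)"
    unfolding sum_distrib_left sum_divide_distrib
    using h_neq by (intro sum.cong) (auto simp: q_def power2_eq_square)
  finally have 2: "h * (\<Sum>j=1..J-1. (cdiff h u j / q j)\<^sup>2)
      \<le> (\<Sum>j=1..J-1. (Q j + Q (j + 1)) / (real j)\<^sup>2) / (2 * h)" .
  have "(\<Sum>j=1..J-1. (Q (j + 1) - Q j) / real j) / (2 * h) \<ge>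
     ((\<Sum>j=1..J-1. (Q j + Q (j + 1)) / (real j)\<^sup>2) / 3 - 4 / 3 * Q 1) / (2 * h)"
    using singular_summation[of Q, OF Q] h_pos by (intro divide_right_mono) auto
  with 1 2 show ?thesis by (simp add: diff_divide_distrib Q_def)
qed

text \<open>Reflection of the grid reduces this to the left end. It preserves second differences and
  reverses centred ones, hence the minus sign.\<close>

lemma singular_coercive_right:
  "h * (\<Sum>j=1..J-1. - (cdiff h u j * sdiff h u j) / (1 - q j))
    \<ge> (h * (\<Sum>j=1..J-1. (cdiff h u j / (1 - q j))\<^sup>2)) / 3 - 2 / 3 * ((bdiff h u J)\<^sup>2 / h)"
proof -
  define v where "v j = u (J - j)" for j
  have c: "cdiff h v (J - j) = - cdiff h u j" "sdiff h v (J - j) = sdiff h u j" if "j \<in> {1..J-1}" for j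
  proof -
    have "J - (J - j + 1) = j - 1" "J - (J - j - 1) = j + 1" "J - (J - j) = j" using that by auto
    then show "cdiff h v (J - j) = - cdiff h u j" "sdiff h v (J - j) = sdiff h u j"
      by (simp_all add: cdiff_def sdiff_def v_def algebra_simps flip: minus_divide_left)
       (simp add: diff_divide_distrib)
  qed
  have b: "(bdiff h v 1)\<^sup>2 = (bdiff h u J)\<^sup>2"
    by (simp add: bdiff_def v_def power_divide power2_commute)
  have "(\<Sum>j=1..J-1. cdiff h v j * sdiff h v j / q j)
      = (\<Sum>j=1..J-1. - (cdiff h u j * sdiff h u j) / (1 - q j))"
    by (subst sum_reflect, intro sum.cong refl) (auto simp: c q_reflect)
  moreover have "(\<Sum>j=1..J-1. (cdiff h v j / q j)\<^sup>2) = (\<Sum>j=1..J-1. (cdiff h u j / (1 - q j))\<^sup>2)"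
    by (subst sum_reflect, intro sum.cong refl) (auto simp: c q_reflect)
  ultimately show ?thesis using singular_coercive_left[of v] b by simp
qed

text \<open>The one-sided estimates carry 1/3 and \<open>inverse_om_sq\<close> costs a factor 2,
  hence \<mu> / 6. The boundary loss 2/3 is rounded up to 1.\<close>

lemma singular_coercive:
  assumes "0 < \<mu>" "\<mu> \<le> l0" "\<mu> \<le> l1"
  shows "h * (\<Sum>j=1..J-1. (l0 / q j - l1 / (1 - q j)) * cdiff h u j * sdiff h u j)
    \<ge> \<mu> / 6 * Z u - (l0 * (bdiff h u 1)\<^sup>2 + l1 * (bdiff h u J)\<^sup>2) / h"
proof -
  define ZL where "ZL = h * (\<Sum>j=1..J-1. (cdiff h u j / q j)\<^sup>2)"
  define ZR where "ZR = h * (\<Sum>j=1..J-1. (cdiff h u j / (1 - q j))\<^sup>2)"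
  define PL where "PL = h * (\<Sum>j=1..J-1. cdiff h u j * sdiff h u j / q j)"
  define PR where "PR = h * (\<Sum>j=1..J-1. - (cdiff h u j * sdiff h u j) / (1 - q j))"
  define gL where "gL = (bdiff h u 1)\<^sup>2 / h"
  define gR where "gR = (bdiff h u J)\<^sup>2 / h"
  have nn: "0 \<le> ZL" "0 \<le> ZR" "0 \<le> gL" "0 \<le> gR"
    using h_pos by (auto simp: ZL_def ZR_def gL_def gR_def intro!: mult_nonneg_nonneg sum_nonneg)
  have eq: "h * (\<Sum>j=1..J-1. (l0 / q j - l1 / (1 - q j)) * cdiff h u j * sdiff h u j) = l0 * PL + l1 * PR"
    unfolding PL_def PR_def sum_distrib_left sum.distrib[symmetric]
    by (intro sum.cong refl) (simp add: algebra_simps)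
  have "Z u \<le> h * (\<Sum>j=1..J-1. 2 * ((cdiff h u j / q j)\<^sup>2 + (cdiff h u j / (1 - q j))\<^sup>2))"
    unfolding Z_def using h_pos by (intro mult_left_mono sum_mono inverse_om_sq) auto
  also have "\<dots> = 2 * (ZL + ZR)"
    by (simp add: ZL_def ZR_def sum.distrib sum_distrib_left distrib_left algebra_simps)
  finally have Z: "Z u \<le> 2 * (ZL + ZR)" .
  have L: "l0 * PL \<ge> l0 * (ZL / 3 - 2 / 3 * gL)"
    using singular_coercive_left[of u] assms
    by (intro mult_left_mono) (auto simp: PL_def ZL_def gL_def)
  have R: "l1 * PR \<ge> l1 * (ZR / 3 - 2 / 3 * gR)"
    using singular_coercive_right[of u] assms
    by (intro mult_left_mono) (auto simp: PR_def ZR_def gR_def)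
  have "\<mu> * ZL \<le> l0 * ZL" "\<mu> * ZR \<le> l1 * ZR" "0 \<le> l0 * gL" "0 \<le> l1 * gR"
    using nn assms by (auto intro: mult_right_mono mult_nonneg_nonneg)
  moreover have "\<mu> * Z u \<le> \<mu> * (2 * (ZL + ZR))" using Z assms by (intro mult_left_mono) auto
  ultimately have "l0 * PL + l1 * PR \<ge> \<mu> / 6 * Z u - (l0 * gL + l1 * gR)"
    using L R by (simp add: algebra_simps)
  then show ?thesis unfolding eq by (simp add: gL_def gR_def add_divide_distrib)
qed

text \<open>Summation by parts puts one difference on the velocity, and
  \<open>2 (x - y) x >= x^2 - y^2\<close> turns the product into an increment of \<open>S1\<close>.
  The boundary products stay because the second component need not vanish at the ends.\<close>

lemma energy_identity:
  assumes "0 < \<tau>"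
  shows "h * (\<Sum>j=1..J-1. ((w j - u j) / \<tau>) * sdiff h w j)
    \<le> ((w J - u J) / \<tau>) * bdiff h w J - ((w 0 - u 0) / \<tau>) * bdiff h w 1 - (S1 w - S1 u) / (2 * \<tau>)"
proof -
  define v where "v j = (w j - u j) / \<tau>" for j
  obtain n where n: "J = Suc n" using J_ge_2 by (cases J) auto
  have bJ: "bdiff h w J = (w (Suc n) - w n) / h" "bdiff h w 1 = (w 1 - w 0) / h"
    by (simp_all add: bdiff_def n)
  have "h * (\<Sum>j=1..J-1. v j * sdiff h w j)
     = (\<Sum>j=1..n. v j * (w (j + 1) - 2 * w j + w (j - 1))) / h"
    unfolding sum_distrib_left sum_divide_distrib
    using h_neq by (intro sum.cong) (auto simp: n sdiff_def power2_eq_square)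
  also have "\<dots> = v J * bdiff h w J - v 0 * bdiff h w 1
      - (\<Sum>j=1..J. (v j - v (j - 1)) * (w j - w (j - 1))) / h"
    unfolding summation_by_parts bJ by (simp add: n diff_divide_distrib right_diff_distrib)
  also have "(\<Sum>j=1..J. (v j - v (j - 1)) * (w j - w (j - 1))) / h
      = h * (\<Sum>j=1..J. (bdiff h w j - bdiff h u j) / \<tau> * bdiff h w j)"
    unfolding sum_distrib_left sum_divide_distrib
  proof (intro sum.cong refl)
    fix j
    have "(v j - v (j - 1)) = h * ((bdiff h w j - bdiff h u j) / \<tau>)"
      using h_neq assms by (simp add: v_def bdiff_def field_simps)
    moreover have "w j - w (j - 1) = h * bdiff h w j" using h_neq by (simp add: bdiff_def)
    ultimately show "(v j - v (j - 1)) * (w j - w (j - 1)) / h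
        = h * ((bdiff h w j - bdiff h u j) / \<tau> * bdiff h w j)"
      using h_neq by simp
  qed
  also have "\<dots> \<ge> h * (\<Sum>j=1..J. ((bdiff h w j)\<^sup>2 - (bdiff h u j)\<^sup>2) / (2 * \<tau>))"
  proof (intro mult_left_mono sum_mono)
    fix j
    have "((bdiff h w j)\<^sup>2 - (bdiff h u j)\<^sup>2) / 2 \<le> (bdiff h w j - bdiff h u j) * bdiff h w j"
      using sum_squares_bound[of "bdiff h w j" "bdiff h u j"]
      by (simp add: power2_eq_square left_diff_distrib) argo
    then have "((bdiff h w j)\<^sup>2 - (bdiff h u j)\<^sup>2) / 2 / \<tau>
        \<le> (bdiff h w j - bdiff h u j) * bdiff h w j / \<tau>"
      using assms by (intro divide_right_mono) auto
    then show "((bdiff h w j)\<^sup>2 - (bdiff h u j)\<^sup>2) / (2 * \<tau>)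
        \<le> (bdiff h w j - bdiff h u j) / \<tau> * bdiff h w j" by simp
  qed (use h_pos in auto)
  moreover have "h * (\<Sum>j=1..J. ((bdiff h w j)\<^sup>2 - (bdiff h u j)\<^sup>2) / (2 * \<tau>)) = (S1 w - S1 u) / (2 * \<tau>)"
    by (simp add: S1_def sum_subtractf sum_divide_distrib[symmetric] right_diff_distrib diff_divide_distrib)
  ultimately show ?thesis unfolding v_def by linarith
qed

text \<open>Young's inequality within half of the dissipation: the bounded part \<open>L\<close> of
  the coefficient and the residual each cost \<mu> / 8 in \<open>y^2\<close>, the singular part
  \<eta> / 2. The rest of the singular part is charged to \<open>(z / om j)^2\<close>, which sums to
  \<open>Z\<close>, with the small factor \<eta>.\<close>

lemma dissipation_estimate:
  assumes "0 < \<mu>" "0 < L" "0 \<le> \<eta>" "\<eta> \<le> \<mu> / 4" "j \<in> {1..J-1}"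
    and "\<mu> \<le> D" "\<bar>s\<bar> \<le> L + \<eta> / om j"
  shows "- (D * y\<^sup>2 + s * z * y + r * y)
    \<le> - (\<mu> / 2) * y\<^sup>2 + 2 * L\<^sup>2 / \<mu> * z\<^sup>2 + \<eta> / 2 * (z / om j)\<^sup>2 + 2 / \<mu> * r\<^sup>2"
proof -
  have "- (s * z * y) \<le> \<bar>s\<bar> * (\<bar>z\<bar> * \<bar>y\<bar>)"
    using abs_ge_minus_self[of "s * z * y"] by (simp add: abs_mult)
  also have "\<dots> \<le> (L + \<eta> / om j) * (\<bar>z\<bar> * \<bar>y\<bar>)"
    using assms by (intro mult_right_mono) auto
  also have "\<dots> = \<bar>y\<bar> * (L * \<bar>z\<bar>) + \<eta> * (\<bar>y\<bar> * (\<bar>z\<bar> / om j))"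
    by (simp add: algebra_simps)
  also have "\<bar>y\<bar> * (L * \<bar>z\<bar>) \<le> \<mu> / 8 * \<bar>y\<bar>\<^sup>2 + (L * \<bar>z\<bar>)\<^sup>2 / (4 * (\<mu> / 8))"
    using assms by (intro young_inequality) auto
  also have "\<eta> * (\<bar>y\<bar> * (\<bar>z\<bar> / om j)) \<le> \<eta> * (1 / 2 * \<bar>y\<bar>\<^sup>2 + (\<bar>z\<bar> / om j)\<^sup>2 / (4 * (1 / 2)))"
    using assms by (intro mult_left_mono young_inequality) auto
  finally have 1: "- (s * z * y) \<le> \<mu> / 8 * y\<^sup>2 + 2 * L\<^sup>2 / \<mu> * z\<^sup>2 + \<eta> / 2 * y\<^sup>2 + \<eta> / 2 * (z / om j)\<^sup>2"
    by (simp add: power_mult_distrib power_divide distrib_left mult.commute mult.left_commute)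
  have "- (r * y) \<le> \<bar>y\<bar> * \<bar>r\<bar>" using abs_ge_minus_self[of "r * y"] by (simp add: abs_mult mult.commute)
  also have "\<dots> \<le> \<mu> / 8 * \<bar>y\<bar>\<^sup>2 + \<bar>r\<bar>\<^sup>2 / (4 * (\<mu> / 8))"
    using assms by (intro young_inequality) auto
  finally have 2: "- (r * y) \<le> \<mu> / 8 * y\<^sup>2 + 2 / \<mu> * r\<^sup>2" by simp
  have "\<mu> * y\<^sup>2 \<le> D * y\<^sup>2" "\<eta> * y\<^sup>2 \<le> \<mu> / 4 * y\<^sup>2" using assms by (intro mult_right_mono; simp)+
  moreover have "0 \<le> \<mu> * y\<^sup>2" using assms by simp
  ultimately show ?thesis using 1 2 by (simp add: algebra_simps)
qed

text \<open>Two grid functions occur because the first error equation is tested with its own second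
  difference (\<open>w\<close>) but driven by the centred difference of the second error
  (\<open>u\<close>).\<close>

lemma sum_dissipation:
  assumes "0 < \<mu>" "0 < L" "0 \<le> \<eta>" "\<eta> \<le> \<mu> / 4"
    and "\<And>j. j \<in> {1..J-1} \<Longrightarrow> \<mu> \<le> D j" "\<And>j. j \<in> {1..J-1} \<Longrightarrow> \<bar>s j\<bar> \<le> L + \<eta> / om j"
  shows "- (h * (\<Sum>j=1..J-1. D j * (sdiff h w j)\<^sup>2 + s j * cdiff h u j * sdiff h w j + r j * sdiff h w j))
    \<le> - (\<mu> / 2) * S2 w + 2 * L\<^sup>2 / \<mu> * S1 u + \<eta> / 2 * Z u + 2 / \<mu> * (h * (\<Sum>j=1..J-1. (r j)\<^sup>2))"
proof -
  have "- (h * (\<Sum>j=1..J-1. D j * (sdiff h w j)\<^sup>2 + s j * cdiff h u j * sdiff h w j + r j * sdiff h w j))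
    = h * (\<Sum>j=1..J-1. - (D j * (sdiff h w j)\<^sup>2 + s j * cdiff h u j * sdiff h w j + r j * sdiff h w j))"
    by (simp only: sum_negf mult_minus_right)
  also have "\<dots> \<le> h * (\<Sum>j=1..J-1. - (\<mu> / 2) * (sdiff h w j)\<^sup>2 + 2 * L\<^sup>2 / \<mu> * (cdiff h u j)\<^sup>2
      + \<eta> / 2 * (cdiff h u j / om j)\<^sup>2 + 2 / \<mu> * (r j)\<^sup>2)"
    using assms h_pos by (intro mult_left_mono sum_mono dissipation_estimate) auto
  also have "\<dots> = - (\<mu> / 2) * S2 w + 2 * L\<^sup>2 / \<mu> * (h * (\<Sum>j=1..J-1. (cdiff h u j)\<^sup>2))
      + \<eta> / 2 * Z u + 2 / \<mu> * (h * (\<Sum>j=1..J-1. (r j)\<^sup>2))"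
    by (simp only: sum.distrib sum_distrib_left[symmetric] S2_def Z_def) (simp add: algebra_simps)
  also have "2 * L\<^sup>2 / \<mu> * (h * (\<Sum>j=1..J-1. (cdiff h u j)\<^sup>2)) \<le> 2 * L\<^sup>2 / \<mu> * S1 u"
    using assms sum_cdiff_le by (intro mult_left_mono) auto
  finally show ?thesis by simp
qed

section \<open>Energy and velocity estimates for one linear step with residuals\<close>

definition F :: "(nat \<Rightarrow> real) \<Rightarrow> (nat \<Rightarrow> real) \<Rightarrow> real \<Rightarrow> real \<Rightarrow> real" where
  "F r1 r2 s0 sJ = h * (\<Sum>j=1..J-1. (r1 j)\<^sup>2) + h * (\<Sum>j=1..J-1. (r2 j)\<^sup>2) + h * (s0\<^sup>2 + sJ\<^sup>2)"

text \<open>Solving the boundary condition for the velocity gives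
  \<open>v = 4 * D * (g / h - s)\<close>, so \<open>v * g\<close> contains the positive term
  \<open>4 D g^2 / h\<close>. Young spends a quarter of it on \<open>s\<close>; the remaining
  \<open>3 D\<close> is at least \<open>3/2 l\<close> and exceeds the loss \<open>l g^2 / h\<close>
  of \<open>singular_coercive\<close> by \<open>l / 2\<close>.\<close>

lemma boundary_product:
  assumes "0 < D" "D \<le> L" "0 \<le> l" "l / 2 \<le> D"
    and "g = h / 4 * v / D + h * s"
  shows "v * g \<ge> 3 / 2 * l * (g\<^sup>2 / h) - 4 * L * (h * s\<^sup>2)"
proof -
  have v: "v = 4 * D * (g / h - s)" using assms h_neq by (simp add: field_simps)
  have "v * g = 4 * D * (g\<^sup>2 / h - g * s)"
    unfolding v by (simp add: power2_eq_square algebra_simps)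
  also have "\<dots> \<ge> 4 * D * (g\<^sup>2 / h - (1 / (4 * h) * g\<^sup>2 + s\<^sup>2 / (4 * (1 / (4 * h)))))"
    using assms h_pos young_inequality[of "1 / (4 * h)" g s] by (intro mult_left_mono) auto
  also have "4 * D * (g\<^sup>2 / h - (1 / (4 * h) * g\<^sup>2 + s\<^sup>2 / (4 * (1 / (4 * h)))))
      = 3 * D * (g\<^sup>2 / h) - 4 * D * (h * s\<^sup>2)"
    by (simp add: algebra_simps)
  moreover have "3 / 2 * l * (g\<^sup>2 / h) \<le> 3 * D * (g\<^sup>2 / h)" "D * (h * s\<^sup>2) \<le> L * (h * s\<^sup>2)"
    by (rule mult_right_mono; use assms h_pos in simp)+
  ultimately show ?thesis by linarith
qed

text \<open>\<open>D j\<close> stands for the reciprocal of the squared discrete tangent length.\<close>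

lemma linear_energy_estimate:
  fixes \<alpha> \<beta> \<alpha>' \<beta>' D \<sigma> \<kappa> r1 r2 :: "nat \<Rightarrow> real"
  assumes \<tau>: "0 < \<tau>" and \<mu>: "0 < \<mu>" and L: "0 < L" and \<eta>: "0 \<le> \<eta>" "\<eta> \<le> \<mu> / 12"
    and eq1: "\<And>j. j \<in> {1..J-1} \<Longrightarrow>
      (\<alpha>' j - \<alpha> j) / \<tau> = D j * sdiff h \<alpha>' j + \<sigma> j * cdiff h \<beta>' j + r1 j"
    and eq2: "\<And>j. j \<in> {1..J-1} \<Longrightarrow>
      (\<beta>' j - \<beta> j) / \<tau> = D j * sdiff h \<beta>' j + \<kappa> j * cdiff h \<beta>' j + r2 j"
    and bc0: "bdiff h \<beta>' 1 = h / 4 * ((\<beta>' 0 - \<beta> 0) / \<tau>) / D 0 + h * s0"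
    and bcJ: "- bdiff h \<beta>' J = h / 4 * ((\<beta>' J - \<beta> J) / \<tau>) / D J + h * sJ"
    and dir: "\<alpha> 0 = 0" "\<alpha>' 0 = 0" "\<alpha> J = 0" "\<alpha>' J = 0"
    and D: "\<And>j. j \<le> J \<Longrightarrow> \<mu> \<le> D j" "\<And>j. j \<le> J \<Longrightarrow> D j \<le> L"
    and \<sigma>: "\<And>j. j \<in> {1..J-1} \<Longrightarrow> \<bar>\<sigma> j\<bar> \<le> L + \<eta> / om j"
    and \<kappa>: "\<And>j. j \<in> {1..J-1} \<Longrightarrow> \<bar>\<kappa> j - (l0 / q j - l1 / (1 - q j))\<bar> \<le> L + \<eta> / om j"
    and l: "\<mu> \<le> l0" "\<mu> \<le> l1" "l0 \<le> 2 * D 0" "l1 \<le> 2 * D J"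
  shows "(S1 \<alpha>' + S1 \<beta>') - (S1 \<alpha> + S1 \<beta>) + \<tau> * (\<mu> / 6) * (S2 \<alpha>' + S2 \<beta>' + Z \<beta>' + G \<beta>')
    \<le> \<tau> * (8 * L\<^sup>2 / \<mu> * S1 \<beta>' + (4 / \<mu> + 8 * L) * F r1 r2 s0 sJ)"
proof -
  define f1 where "f1 = h * (\<Sum>j=1..J-1. (r1 j)\<^sup>2)"
  define f2 where "f2 = h * (\<Sum>j=1..J-1. (r2 j)\<^sup>2)"
  define v where "v j = (\<beta>' j - \<beta> j) / \<tau>" for j
  have A: "(S1 \<alpha>' - S1 \<alpha>) / (2 * \<tau>) \<le> - (\<mu> / 2) * S2 \<alpha>' + 2 * L\<^sup>2 / \<mu> * S1 \<beta>' + \<eta> / 2 * Z \<beta>' + 2 / \<mu> * f1"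
  proof -
    have "h * (\<Sum>j=1..J-1. ((\<alpha>' j - \<alpha> j) / \<tau>) * sdiff h \<alpha>' j)
      = h * (\<Sum>j=1..J-1. D j * (sdiff h \<alpha>' j)\<^sup>2 + \<sigma> j * cdiff h \<beta>' j * sdiff h \<alpha>' j + r1 j * sdiff h \<alpha>' j)"
      by (intro arg_cong2[where f="(*)"] sum.cong refl) (simp add: eq1 power2_eq_square algebra_simps)
    moreover have "- (h * (\<Sum>j=1..J-1. D j * (sdiff h \<alpha>' j)\<^sup>2 + \<sigma> j * cdiff h \<beta>' j * sdiff h \<alpha>' j + r1 j * sdiff h \<alpha>' j))
      \<le> - (\<mu> / 2) * S2 \<alpha>' + 2 * L\<^sup>2 / \<mu> * S1 \<beta>' + \<eta> / 2 * Z \<beta>' + 2 / \<mu> * f1"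
      unfolding f1_def using \<mu> L \<eta> D \<sigma> by (intro sum_dissipation) auto
    moreover have "h * (\<Sum>j=1..J-1. ((\<alpha>' j - \<alpha> j) / \<tau>) * sdiff h \<alpha>' j) \<le> - ((S1 \<alpha>' - S1 \<alpha>) / (2 * \<tau>))"
      using energy_identity[OF \<tau>, of \<alpha>' \<alpha>] dir by simp
    ultimately show ?thesis by argo
  qed
  have B: "(S1 \<beta>' - S1 \<beta>) / (2 * \<tau>) + \<mu> / 2 * S2 \<beta>' + \<mu> / 6 * Z \<beta>' + \<mu> / 2 * G \<beta>'
      \<le> 2 * L\<^sup>2 / \<mu> * S1 \<beta>' + \<eta> / 2 * Z \<beta>' + 2 / \<mu> * f2 + 4 * L * (h * (s0\<^sup>2 + sJ\<^sup>2))"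
  proof -
    \<comment> \<open>The poles \<open>k0\<close> go to \<open>singular_coercive\<close>, which
      exploits their sign; only the deviation of \<kappa> from them is estimated in absolute
      value.\<close>
    define k0 where "k0 j = l0 / q j - l1 / (1 - q j)" for j
    define P where "P = h * (\<Sum>j=1..J-1. D j * (sdiff h \<beta>' j)\<^sup>2 + (\<kappa> j - k0 j) * cdiff h \<beta>' j * sdiff h \<beta>' j
           + r2 j * sdiff h \<beta>' j)"
    define Q where "Q = h * (\<Sum>j=1..J-1. k0 j * cdiff h \<beta>' j * sdiff h \<beta>' j)"
    have "h * (\<Sum>j=1..J-1. v j * sdiff h \<beta>' j) = P + Q"
      unfolding P_def Q_def distrib_left[symmetric] sum.distrib[symmetric]
      by (intro arg_cong2[where f="(*)"] sum.cong refl) (simp add: v_def eq2 power2_eq_square algebra_simps)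
    moreover have "- P \<le> - (\<mu> / 2) * S2 \<beta>' + 2 * L\<^sup>2 / \<mu> * S1 \<beta>' + \<eta> / 2 * Z \<beta>' + 2 / \<mu> * f2"
      unfolding f2_def P_def using \<mu> L \<eta> D \<kappa> by (intro sum_dissipation) (auto simp: k0_def)
    moreover have "Q \<ge> \<mu> / 6 * Z \<beta>' - (l0 * (bdiff h \<beta>' 1)\<^sup>2 + l1 * (bdiff h \<beta>' J)\<^sup>2) / h"
      unfolding Q_def k0_def using \<mu> l by (intro singular_coercive)
    moreover have "v 0 * bdiff h \<beta>' 1 \<ge> 3 / 2 * l0 * ((bdiff h \<beta>' 1)\<^sup>2 / h) - 4 * L * (h * s0\<^sup>2)"
      using D[of 0] l \<mu> bc0 by (intro boundary_product[where D="D 0"]) (auto simp: v_def)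
    moreover have "v J * (- bdiff h \<beta>' J) \<ge> 3 / 2 * l1 * ((- bdiff h \<beta>' J)\<^sup>2 / h) - 4 * L * (h * sJ\<^sup>2)"
      using D[of J] l \<mu> bcJ by (intro boundary_product[where D="D J"]) (auto simp: v_def)
    moreover have "\<mu> * ((bdiff h \<beta>' 1)\<^sup>2 / h) \<le> l0 * ((bdiff h \<beta>' 1)\<^sup>2 / h)"
      "\<mu> * ((bdiff h \<beta>' J)\<^sup>2 / h) \<le> l1 * ((bdiff h \<beta>' J)\<^sup>2 / h)"
      by (rule mult_right_mono; use l h_pos in simp)+
    ultimately show ?thesis
      using energy_identity[OF \<tau>, of \<beta>' \<beta>] unfolding v_def[symmetric] G_def
      by (simp add: add_divide_distrib algebra_simps)
  qed
  have FF: "F r1 r2 s0 sJ = f1 + f2 + h * (s0\<^sup>2 + sJ\<^sup>2)" by (simp add: F_def f1_def f2_def)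
  have nn: "0 \<le> f1" "0 \<le> f2" "0 \<le> h * (s0\<^sup>2 + sJ\<^sup>2)"
    using h_pos by (auto simp: f1_def f2_def intro!: mult_nonneg_nonneg sum_nonneg)
  \<comment> \<open>Each component charges \<eta> / 2 to \<open>Z\<close>; together they use at most
    half of the coercive \<mu> / 6.\<close>
  have "\<eta> * Z \<beta>' \<le> \<mu> / 12 * Z \<beta>'" using \<eta> Z_nonneg by (intro mult_right_mono)
  moreover have "0 \<le> 4 * L * f1" "0 \<le> 4 * L * f2" "0 \<le> 2 / \<mu> * (h * (s0\<^sup>2 + sJ\<^sup>2))"
    "0 \<le> \<mu> * S2 \<alpha>'" "0 \<le> \<mu> * S2 \<beta>'" "0 \<le> \<mu> * G \<beta>'"
    using nn L \<mu> S2_nonneg G_nonneg by (auto intro!: mult_nonneg_nonneg)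
  ultimately have *: "(S1 \<alpha>' - S1 \<alpha>) / (2 * \<tau>) + (S1 \<beta>' - S1 \<beta>) / (2 * \<tau>)
      + \<mu> / 12 * (S2 \<alpha>' + S2 \<beta>' + Z \<beta>' + G \<beta>')
      \<le> 4 * L\<^sup>2 / \<mu> * S1 \<beta>' + (2 / \<mu> + 4 * L) * F r1 r2 s0 sJ"
    using A B unfolding FF by (simp add: algebra_simps)
  have "2 * \<tau> * ((S1 \<alpha>' - S1 \<alpha>) / (2 * \<tau>)) = S1 \<alpha>' - S1 \<alpha>"
    "2 * \<tau> * ((S1 \<beta>' - S1 \<beta>) / (2 * \<tau>)) = S1 \<beta>' - S1 \<beta>" using \<tau> by simp_all
  with mult_left_mono[OF *, of "2 * \<tau>"] \<tau> show ?thesis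
    by (simp only: distrib_left) (simp add: algebra_simps)
qed

text \<open>The velocity is read off from the equations. Coefficients of size
  \<open>4 * L / om j\<close> are harmless here because \<open>Z\<close> is on the right-hand side;
  at the ends the boundary conditions express the velocity through \<open>g / h\<close>, which is
  what \<open>G\<close> measures.\<close>

lemma velocity_estimate:
  fixes \<alpha> \<beta> \<alpha>' \<beta>' D \<sigma> \<kappa> r1 r2 :: "nat \<Rightarrow> real"
  assumes \<tau>: "0 < \<tau>" and L: "0 < L" and \<eta>: "0 \<le> \<eta>" "\<eta> \<le> L"
    and eq1: "\<And>j. j \<in> {1..J-1} \<Longrightarrow>
      (\<alpha>' j - \<alpha> j) / \<tau> = D j * sdiff h \<alpha>' j + \<sigma> j * cdiff h \<beta>' j + r1 j"
    and eq2: "\<And>j. j \<in> {1..J-1} \<Longrightarrow>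
      (\<beta>' j - \<beta> j) / \<tau> = D j * sdiff h \<beta>' j + \<kappa> j * cdiff h \<beta>' j + r2 j"
    and bc0: "bdiff h \<beta>' 1 = h / 4 * ((\<beta>' 0 - \<beta> 0) / \<tau>) / D 0 + h * s0"
    and bcJ: "- bdiff h \<beta>' J = h / 4 * ((\<beta>' J - \<beta> J) / \<tau>) / D J + h * sJ"
    and dir: "\<alpha> 0 = 0" "\<alpha>' 0 = 0" "\<alpha> J = 0" "\<alpha>' J = 0"
    and D: "\<And>j. j \<le> J \<Longrightarrow> 0 < D j" "\<And>j. j \<le> J \<Longrightarrow> D j \<le> L"
    and \<sigma>: "\<And>j. j \<in> {1..J-1} \<Longrightarrow> \<bar>\<sigma> j\<bar> \<le> L + \<eta> / om j"
    and \<kappa>: "\<And>j. j \<in> {1..J-1} \<Longrightarrow> \<bar>\<kappa> j - (l0 / q j - l1 / (1 - q j))\<bar> \<le> L + \<eta> / om j"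
    and l: "0 \<le> l0" "0 \<le> l1" "l0 \<le> 2 * D 0" "l1 \<le> 2 * D J"
  shows "h * (\<Sum>j=1..J-1. ((\<alpha>' j - \<alpha> j) / \<tau>)\<^sup>2 + ((\<beta>' j - \<beta> j) / \<tau>)\<^sup>2)
      + h * ((\<beta>' 0 - \<beta> 0) / \<tau>)\<^sup>2 + h * ((\<beta>' J - \<beta> J) / \<tau>)\<^sup>2
    \<le> (3 + 96 * L\<^sup>2) * (S2 \<alpha>' + S2 \<beta>' + Z \<beta>' + G \<beta>' + F r1 r2 s0 sJ)"
proof -
  have sq3: "(x + y + z)\<^sup>2 \<le> 3 * (x\<^sup>2 + y\<^sup>2 + z\<^sup>2)" for x y z :: real
  proof -
    have "3 * (x\<^sup>2 + y\<^sup>2 + z\<^sup>2) - (x + y + z)\<^sup>2 = (x - y)\<^sup>2 + (y - z)\<^sup>2 + (x - z)\<^sup>2"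
      by (simp add: power2_eq_square algebra_simps)
    then show ?thesis by (smt (verit) zero_le_power2)
  qed
  have pt: "(d * y + s * z + r)\<^sup>2 \<le> 3 * L\<^sup>2 * y\<^sup>2 + 48 * L\<^sup>2 * (z / om j)\<^sup>2 + 3 * r\<^sup>2"
    if j: "j \<in> {1..J-1}" and d: "0 < d" "d \<le> L" and s: "\<bar>s\<bar> \<le> 4 * L / om j" for j d s y z r
  proof -
    have "(d * y)\<^sup>2 \<le> L\<^sup>2 * y\<^sup>2" unfolding power_mult_distrib
      using d by (intro mult_right_mono power_mono) auto
    moreover have "s\<^sup>2 \<le> (4 * L / om j)\<^sup>2" using s by (metis abs_ge_zero power2_abs power_mono)
    then have "(s * z)\<^sup>2 \<le> (4 * L / om j)\<^sup>2 * z\<^sup>2" unfolding power_mult_distrib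
      by (intro mult_right_mono) auto
    then have "(s * z)\<^sup>2 \<le> 16 * L\<^sup>2 * (z / om j)\<^sup>2"
      by (simp add: power_mult_distrib power_divide)
    ultimately show ?thesis using sq3[of "d * y" "s * z" r] by simp
  qed
  have om: "L + \<eta> / om j \<le> 2 * L / om j" if j: "j \<in> {1..J-1}" for j
  proof -
    have "L * om j \<le> L * 1" using om_le_1[OF j] L by (intro mult_left_mono) auto
    then have "L \<le> L / om j" using om_pos[OF j] by (simp add: field_simps)
    moreover have "\<eta> / om j \<le> L / om j" using om_pos[OF j] \<eta> by (intro divide_right_mono) auto
    ultimately show ?thesis by simp
  qed
  have s4: "\<bar>\<sigma> j\<bar> \<le> 4 * L / om j" "\<bar>\<kappa> j\<bar> \<le> 4 * L / om j" if j: "j \<in> {1..J-1}" for j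
  proof -
    have "2 * L / om j \<le> 4 * L / om j"
      using om_pos[OF j] L by (intro divide_right_mono) auto
    then show "\<bar>\<sigma> j\<bar> \<le> 4 * L / om j" using om[OF j] \<sigma>[OF j] by linarith
    have "l0 \<le> 2 * L" "l1 \<le> 2 * L" using l D(2)[of 0] D(2)[of J] by auto
    then have "l0 / q j \<le> 2 * L / q j" "l1 / (1 - q j) \<le> 2 * L / (1 - q j)"
      "0 \<le> l0 / q j" "0 \<le> l1 / (1 - q j)"
      using q_pos[OF j] l by (auto intro!: divide_right_mono)
    moreover have "2 * L / om j = 2 * L * (1 / om j)" by simp
    then have "2 * L / om j = 2 * L / q j + 2 * L / (1 - q j)"
      unfolding inverse_om[OF j] by (simp add: distrib_left)
    moreover have "4 * L / om j = 2 * L / om j + 2 * L / om j" by (simp add: add_divide_distrib[symmetric])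
    ultimately show "\<bar>\<kappa> j\<bar> \<le> 4 * L / om j" using om[OF j] \<kappa>[OF j] by linarith
  qed
  have bd: "h * v\<^sup>2 \<le> 32 * L\<^sup>2 * (g\<^sup>2 / h + h * s\<^sup>2)"
    if "0 < d" "d \<le> L" "g = h / 4 * v / d + h * s" for d g v s
  proof -
    have v: "v = 4 * d * (g / h - s)" using that h_neq by (simp add: field_simps)
    have "(g / h - s)\<^sup>2 \<le> 2 * ((g / h)\<^sup>2 + s\<^sup>2)"
      using power2_mean_le[of "g / h" "- s"] by (simp add: power_divide mult.commute)
    then have "v\<^sup>2 \<le> 16 * d\<^sup>2 * (2 * ((g / h)\<^sup>2 + s\<^sup>2))"
      unfolding v power_mult_distrib by (intro mult_mono) auto
    also have "\<dots> \<le> 16 * L\<^sup>2 * (2 * ((g / h)\<^sup>2 + s\<^sup>2))"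
      using that by (intro mult_right_mono mult_left_mono power_mono) auto
    finally have "h * v\<^sup>2 \<le> h * (16 * L\<^sup>2 * (2 * ((g / h)\<^sup>2 + s\<^sup>2)))"
      using h_pos by (intro mult_left_mono) auto
    also have "\<dots> = 32 * L\<^sup>2 * (g\<^sup>2 / h + h * s\<^sup>2)"
      using h_neq by (simp add: field_simps power2_eq_square)
    finally show ?thesis .
  qed
  define f1 where "f1 = h * (\<Sum>j=1..J-1. (r1 j)\<^sup>2)"
  define f2 where "f2 = h * (\<Sum>j=1..J-1. (r2 j)\<^sup>2)"
  have "h * (\<Sum>j=1..J-1. ((\<alpha>' j - \<alpha> j) / \<tau>)\<^sup>2 + ((\<beta>' j - \<beta> j) / \<tau>)\<^sup>2)
    \<le> h * (\<Sum>j=1..J-1. (3 * L\<^sup>2 * (sdiff h \<alpha>' j)\<^sup>2 + 48 * L\<^sup>2 * (cdiff h \<beta>' j / om j)\<^sup>2 + 3 * (r1 j)\<^sup>2)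
     + (3 * L\<^sup>2 * (sdiff h \<beta>' j)\<^sup>2 + 48 * L\<^sup>2 * (cdiff h \<beta>' j / om j)\<^sup>2 + 3 * (r2 j)\<^sup>2))"
  proof (intro mult_left_mono sum_mono add_mono[of _ "3 * L\<^sup>2 * _ + _ + _"])
    fix j assume j: "j \<in> {1..J-1}"
    then have "j \<le> J" by auto
    note D = D[OF this]
    show "((\<alpha>' j - \<alpha> j) / \<tau>)\<^sup>2 \<le> 3 * L\<^sup>2 * (sdiff h \<alpha>' j)\<^sup>2 + 48 * L\<^sup>2 * (cdiff h \<beta>' j / om j)\<^sup>2 + 3 * (r1 j)\<^sup>2"
      unfolding eq1[OF j] using D s4[OF j] by (intro pt j)
    show "((\<beta>' j - \<beta> j) / \<tau>)\<^sup>2 \<le> 3 * L\<^sup>2 * (sdiff h \<beta>' j)\<^sup>2 + 48 * L\<^sup>2 * (cdiff h \<beta>' j / om j)\<^sup>2 + 3 * (r2 j)\<^sup>2"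
      unfolding eq2[OF j] using D s4[OF j] by (intro pt j)
  qed (use h_pos in auto)
  also have "\<dots> = 3 * L\<^sup>2 * S2 \<alpha>' + 3 * L\<^sup>2 * S2 \<beta>' + 96 * L\<^sup>2 * Z \<beta>' + 3 * f1 + 3 * f2"
    by (simp only: sum.distrib sum_distrib_left[symmetric] S2_def Z_def f1_def f2_def) (simp add: algebra_simps)
  finally have I: "h * (\<Sum>j=1..J-1. ((\<alpha>' j - \<alpha> j) / \<tau>)\<^sup>2 + ((\<beta>' j - \<beta> j) / \<tau>)\<^sup>2)
    \<le> 3 * L\<^sup>2 * S2 \<alpha>' + 3 * L\<^sup>2 * S2 \<beta>' + 96 * L\<^sup>2 * Z \<beta>' + 3 * f1 + 3 * f2" .
  have B0: "h * ((\<beta>' 0 - \<beta> 0) / \<tau>)\<^sup>2 \<le> 32 * L\<^sup>2 * ((bdiff h \<beta>' 1)\<^sup>2 / h + h * s0\<^sup>2)"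
    using D[of 0] bc0 by (intro bd) auto
  have "h * ((\<beta>' J - \<beta> J) / \<tau>)\<^sup>2 \<le> 32 * L\<^sup>2 * ((- bdiff h \<beta>' J)\<^sup>2 / h + h * sJ\<^sup>2)"
    using D[of J] bcJ by (intro bd) auto
  then have BJ: "h * ((\<beta>' J - \<beta> J) / \<tau>)\<^sup>2 \<le> 32 * L\<^sup>2 * ((bdiff h \<beta>' J)\<^sup>2 / h + h * sJ\<^sup>2)" by simp
  have FF: "F r1 r2 s0 sJ = f1 + f2 + h * (s0\<^sup>2 + sJ\<^sup>2)" by (simp add: F_def f1_def f2_def)
  have f: "0 \<le> f1" "0 \<le> f2" and hs: "0 \<le> h * (s0\<^sup>2 + sJ\<^sup>2)"
    using h_pos by (auto simp: f1_def f2_def intro!: mult_nonneg_nonneg sum_nonneg)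
  have "0 \<le> (3 + 93 * L\<^sup>2) * (S2 \<alpha>' + S2 \<beta>')" "0 \<le> 3 * Z \<beta>'" "0 \<le> 96 * L\<^sup>2 * (f1 + f2)"
    "0 \<le> (3 + 64 * L\<^sup>2) * G \<beta>'" "0 \<le> (3 + 64 * L\<^sup>2) * (h * (s0\<^sup>2 + sJ\<^sup>2))"
    using f hs S2_nonneg Z_nonneg G_nonneg by (auto intro!: mult_nonneg_nonneg add_nonneg_nonneg)
  moreover define W where "W = h * (\<Sum>j=1..J-1. ((\<alpha>' j - \<alpha> j) / \<tau>)\<^sup>2 + ((\<beta>' j - \<beta> j) / \<tau>)\<^sup>2)"
  moreover define g0 gJ where "g0 = (bdiff h \<beta>' 1)\<^sup>2 / h" and "gJ = (bdiff h \<beta>' J)\<^sup>2 / h"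
  ultimately show ?thesis using I B0 BJ
    unfolding FF G_def W_def[symmetric] add_divide_distrib g0_def[symmetric] gJ_def[symmetric]
    by (simp add: algebra_simps)
qed

end

section \<open>Solvability of one step\<close>

fun two_step :: "(nat \<Rightarrow> real \<Rightarrow> real \<Rightarrow> real) \<Rightarrow> real \<Rightarrow> real \<Rightarrow> nat \<Rightarrow> real" where
  "two_step \<phi> a b 0 = a"
| "two_step \<phi> a b (Suc 0) = b"
| "two_step \<phi> a b (Suc (Suc n)) = \<phi> (Suc n) (two_step \<phi> a b (Suc n)) (two_step \<phi> a b n)"

text \<open>Shooting: a homogeneous solution that starts nonnegative and nondecreasing stays so by the sign
  conditions (a discrete maximum principle), hence it cannot satisfy the homogeneous right boundary condition.\<close>

lemma tridiagonal_shooting: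
  fixes p r s f :: "nat \<Rightarrow> real"
  assumes J: "J \<ge> 2"
    and p: "\<And>j. j \<in> {1..J-1} \<Longrightarrow> 0 < p j" and r: "\<And>j. j \<in> {1..J-1} \<Longrightarrow> 0 \<le> r j"
    and s: "\<And>j. j \<in> {1..J-1} \<Longrightarrow> 0 \<le> s j"
    and Q: "0 \<le> Q0" "Q0 \<le> Q1" "0 < Q1" and "0 \<le> \<theta>" "0 < c"
  obtains V t where "V 0 = P0 + t * Q0" "V 1 = P1 + t * Q1"
    "\<And>j. j \<in> {1..J-1} \<Longrightarrow>
      p j * (V (j + 1) - V j) - r j * (V j - V (j - 1)) - s j * V j = f j"
    "\<theta> * (V J - V (J - 1)) + c * V J = g"
proof -
  \<comment> \<open>\<open>P\<close> solves the given recursion and \<open>Q\<close> the homogeneous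
    one, both from prescribed first two values. The right boundary condition fixes the multiple
    \<open>t\<close> of \<open>Q\<close>, its left-hand side being positive on
    \<open>Q\<close>.\<close>
  define P where "P = two_step (\<lambda>j x y. x + (r j * (x - y) + s j * x + f j) / p j) P0 P1"
  define Q where "Q = two_step (\<lambda>j x y. x + (r j * (x - y) + s j * x) / p j) Q0 Q1"
  have P: "p j * (P (j + 1) - P j) = r j * (P j - P (j - 1)) + s j * P j + f j" if "j \<in> {1..J-1}" for j
    using that p[OF that] by (cases j) (auto simp: P_def)
  have Q': "p j * (Q (j + 1) - Q j) = r j * (Q j - Q (j - 1)) + s j * Q j" if "j \<in> {1..J-1}" for j
    using that p[OF that] by (cases j) (auto simp: Q_def)
  have mono: "Q n \<le> Q (Suc n) \<and> 0 < Q (Suc n)" if "n \<le> J - 1" for n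
    using that
  proof (induction n)
    case 0
    then show ?case using Q by (simp add: Q_def)
  next
    case (Suc n)
    then have j: "Suc n \<in> {1..J-1}" by simp
    have "0 \<le> p (Suc n) * (Q (Suc n + 1) - Q (Suc n))"
      unfolding Q'[OF j] using Suc r[OF j] s[OF j] by (intro add_nonneg_nonneg mult_nonneg_nonneg) auto
    then have "Q (Suc n) \<le> Q (Suc (Suc n))"
      using p[OF j] by (simp add: zero_le_mult_iff)
    then show ?case using Suc by auto
  qed
  have "Q (J - 1) \<le> Q J" "0 < Q J" using mono[of "J - 1"] J by auto
  then have pos: "0 < \<theta> * (Q J - Q (J - 1)) + c * Q J"
    using assms by (intro add_nonneg_pos mult_nonneg_nonneg mult_pos_pos) auto
  define t where "t = (g - (\<theta> * (P J - P (J - 1)) + c * P J)) / (\<theta> * (Q J - Q (J - 1)) + c * Q J)"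
  have t: "t * (\<theta> * (Q J - Q (J - 1)) + c * Q J) = g - (\<theta> * (P J - P (J - 1)) + c * P J)"
    using pos by (simp add: t_def)
  show ?thesis
  proof (rule that[of "\<lambda>j. P j + t * Q j" t])
    fix j assume j: "j \<in> {1..J-1}"
    have "p j * (P (j + 1) - P j) + t * (p j * (Q (j + 1) - Q j))
        = r j * (P j - P (j - 1)) + s j * P j + f j + t * (r j * (Q j - Q (j - 1)) + s j * Q j)"
      unfolding P[OF j] Q'[OF j] by simp
    then show "p j * (P (j + 1) + t * Q (j + 1) - (P j + t * Q j))
        - r j * (P j + t * Q j - (P (j - 1) + t * Q (j - 1))) - s j * (P j + t * Q j) = f j"
      by (simp add: algebra_simps)
  next
    show "\<theta> * (P J + t * Q J - (P (J - 1) + t * Q (J - 1))) + c * (P J + t * Q J) = g"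
      using t by (simp add: algebra_simps)
  qed (simp_all add: P_def Q_def)
qed

context grid
begin

text \<open>The second equation contains \<open>B'\<close> alone; it is solved first and then enters
  the first equation as a source. After multiplication by \<open>D j * h^2\<close> its two
  differences carry the weights \<open>1 + e j\<close> and \<open>1 - e j\<close>, which the last
  hypothesis on \<open>A\<close> keeps positive.\<close>

lemma scheme_components_solvable:
  fixes A B D :: "nat \<Rightarrow> real"
  assumes \<tau>: "0 < \<tau>"
    and D: "\<And>j. j \<le> J \<Longrightarrow> 0 < D j"
    and A: "\<And>j. j \<in> {1..J-1} \<Longrightarrow> 0 < A j"
    and A2: "\<And>j. j \<in> {1..J-1} \<Longrightarrow> \<bar>A (j + 1) - A (j - 1)\<bar> < 4 * A j"
  obtains A' B' where
    "\<And>j. j \<in> {1..J-1} \<Longrightarrow>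
      (A' j - A j) / \<tau> = sdiff h A' j / D j - cdiff h B' j / A j * cdiff h B j / D j"
    "\<And>j. j \<in> {1..J-1} \<Longrightarrow>
      (B' j - B j) / \<tau> = sdiff h B' j / D j + cdiff h B' j / A j * cdiff h A j / D j"
    "A' 0 = 0" "A' J = 0"
    "bdiff h B' 1 = h / 4 * D 0 * ((B' 0 - B 0) / \<tau>)"
    "bdiff h B' J = - (h / 4 * D J * ((B' J - B J) / \<tau>))"
proof -
  define e where "e j = (A (j + 1) - A (j - 1)) / (4 * A j)" for j
  define s where "s j = D j * h\<^sup>2 / \<tau>" for j
  have s: "0 < s j" if "j \<le> J" for j using D[OF that] \<tau> h_pos by (simp add: s_def)
  have e: "\<bar>e j\<bar> < 1" if "j \<in> {1..J-1}" for j
    using A2[OF that] A[OF that] by (simp add: e_def abs_divide)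
  have Ds: "D j \<noteq> 0" and sD: "s j / D j = h\<^sup>2 / \<tau>" if "j \<in> {1..J-1}" for j
  proof -
    have "0 < D j" using that by (intro D) auto
    then show "D j \<noteq> 0" "s j / D j = h\<^sup>2 / \<tau>" by (simp_all add: s_def)
  qed
  \<comment> \<open>The unknown is \<open>t = B' 0\<close>. The left boundary condition reads
    \<open>B' 1 - B' 0 = s 0 / 4 * (B' 0 - B 0)\<close>, which gives the start \<open>B' 1\<close>
    as an affine function of \<open>t\<close>.\<close>
  obtain B' t where B': "B' 0 = 0 + t * 1" "B' 1 = - (s 0 / 4 * B 0) + t * (1 + s 0 / 4)"
    "\<And>j. j \<in> {1..J-1} \<Longrightarrow>
      (1 + e j) * (B' (j + 1) - B' j) - (1 - e j) * (B' j - B' (j - 1)) - s j * B' j = - s j * B j"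
    "1 * (B' J - B' (J - 1)) + s J / 4 * B' J = s J / 4 * B J"
  proof (rule tridiagonal_shooting[OF J_ge_2, of "\<lambda>j. 1 + e j" "\<lambda>j. 1 - e j" s 1 "1 + s 0 / 4" 1 "s J / 4"
      0 "- (s 0 / 4 * B 0)" "\<lambda>j. - s j * B j" "s J / 4 * B J"])
    show "0 < 1 + e j" "0 \<le> 1 - e j" "0 \<le> s j" if "j \<in> {1..J-1}" for j
    proof -
      show "0 < 1 + e j" "0 \<le> 1 - e j" using e[OF that] by auto
      have "j \<le> J" using that by auto
      then show "0 \<le> s j" using s[of j] by simp
    qed
  qed (use s[of 0] s[of J] in auto)
  define k where "k j = cdiff h B' j / A j * cdiff h B j" for j
  \<comment> \<open>Now \<open>A' 0 = 0\<close> is built into the start, the unknown is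
    \<open>t' = A' 1\<close>, and \<theta> = 0 with \<open>c = 1\<close> turns the right condition
    into \<open>A' J = 0\<close>.\<close>
  obtain A' t' where A': "A' 0 = 0 + t' * 0" "A' 1 = 0 + t' * 1"
    "\<And>j. j \<in> {1..J-1} \<Longrightarrow>
      1 * (A' (j + 1) - A' j) - 1 * (A' j - A' (j - 1)) - s j * A' j = - s j * A j + h\<^sup>2 * k j"
    "0 * (A' J - A' (J - 1)) + 1 * A' J = 0"
  proof (rule tridiagonal_shooting[OF J_ge_2, of "\<lambda>j. 1" "\<lambda>j. 1" s 0 1 0 1
      0 0 "\<lambda>j. - s j * A j + h\<^sup>2 * k j" 0])
    show "0 \<le> s j" if "j \<in> {1..J-1}" for j
    proof -
      have "j \<le> J" using that by auto
      then show "0 \<le> s j" using s[of j] by simp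
    qed
  qed auto
  show ?thesis
  proof (rule that[of A' B'])
    fix j assume j: "j \<in> {1..J-1}"
    have eq: "(V j - U j) / \<tau> = sdiff h V j / D j + R / D j"
      if "V (j + 1) - 2 * V j + V (j - 1) + h\<^sup>2 * R = s j * (V j - U j)" for U V R
    proof -
      have "s j * (V j - U j) / (D j * h\<^sup>2) = (V j - U j) / \<tau>"
        using Ds[OF j] h_neq by (simp add: s_def)
      moreover have "(V (j + 1) - 2 * V j + V (j - 1) + h\<^sup>2 * R) / (D j * h\<^sup>2) = sdiff h V j / D j + R / D j"
        using h_neq Ds[OF j] by (simp add: sdiff_def add_divide_distrib mult.commute)
      ultimately show ?thesis using that by simp
    qed
    have "(A' j - A j) / \<tau> = sdiff h A' j / D j + (- k j) / D j"
      using A'(3)[OF j] by (intro eq) (simp add: algebra_simps)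
    then show "(A' j - A j) / \<tau> = sdiff h A' j / D j - cdiff h B' j / A j * cdiff h B j / D j"
      by (simp add: k_def)
    have "h\<^sup>2 * (cdiff h B' j / A j * cdiff h A j) = e j * (B' (j + 1) - B' (j - 1))"
      using h_neq A[OF j] by (simp add: cdiff_def e_def power2_eq_square)
    then show "(B' j - B j) / \<tau> = sdiff h B' j / D j + cdiff h B' j / A j * cdiff h A j / D j"
      using B'(3)[OF j] by (intro eq) (simp add: algebra_simps)
  next
    show "A' 0 = 0" "A' J = 0" using A' by auto
    have "B' 1 - B' (1 - 1) = s 0 / 4 * (B' 0 - B 0)" using B'(1,2) by (simp add: algebra_simps)
    then have "bdiff h B' 1 = s 0 / 4 * (B' 0 - B 0) / h"
      unfolding bdiff_def by (simp only:)
    then show "bdiff h B' 1 = h / 4 * D 0 * ((B' 0 - B 0) / \<tau>)"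
      using h_neq by (simp add: s_def power2_eq_square mult.commute mult.left_commute)
    have "B' J - B' (J - 1) = - (s J / 4 * (B' J - B J))" using B'(4) by (simp only: right_diff_distrib)
    then show "bdiff h B' J = - (h / 4 * D J * ((B' J - B J) / \<tau>))"
      using h_neq by (simp add: bdiff_def s_def power2_eq_square mult.commute mult.left_commute)
  qed
qed

end

section \<open>Error equations for one step\<close>

lemma abs_mult_le: "\<bar>x\<bar> \<le> a \<Longrightarrow> \<bar>y\<bar> \<le> b \<Longrightarrow> \<bar>x * y\<bar> \<le> a * b" for x y :: real
  unfolding abs_mult by (intro mult_mono) auto

lemma abs_divide_le: "\<bar>x\<bar> \<le> a \<Longrightarrow> 0 < c \<Longrightarrow> c \<le> y \<Longrightarrow> \<bar>x / y\<bar> \<le> a / c" for x y :: real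
  unfolding abs_divide by (intro frac_le) auto

text \<open>At the ends the one-sided differences of the boundary conditions are taken, so that one
  function supplies the coefficients of all equations of a step.\<close>

definition (in grid) speed_sq :: "(nat \<Rightarrow> real) \<Rightarrow> (nat \<Rightarrow> real) \<Rightarrow> nat \<Rightarrow> real" where
  "speed_sq a b j = (if j = 0 then (bdiff h a 1)\<^sup>2 + (bdiff h b 1)\<^sup>2
    else if j = J then (bdiff h a J)\<^sup>2 + (bdiff h b J)\<^sup>2
    else (cdiff h a j)\<^sup>2 + (cdiff h b j)\<^sup>2)"

lemma (in grid) speed_sq_simps:
  "j \<in> {1..J-1} \<Longrightarrow> speed_sq a b j = (cdiff h a j)\<^sup>2 + (cdiff h b j)\<^sup>2"
  "speed_sq a b 0 = (bdiff h a 1)\<^sup>2 + (bdiff h b 1)\<^sup>2" "speed_sq a b J = (bdiff h a J)\<^sup>2 + (bdiff h b J)\<^sup>2"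
  using J_ge_2 by (auto simp: speed_sq_def)

text \<open>\<open>(a, b)\<close> and \<open>(a', b')\<close> are the grid values of the exact solution at two consecutive times, \<open>S\<close> bounds
  the consistency errors, and \<open>l0\<close>, \<open>l1\<close> are the leading coefficients of the singular term at the two ends.\<close>

locale consistent_step = grid +
  fixes K S \<tau> l0 l1 :: real and a b a' b' :: "nat \<Rightarrow> real"
  assumes K: "1 \<le> K" and S: "0 \<le> S" and \<tau>: "0 < \<tau>"
    and dirichlet: "a 0 = 0" "a J = 0" "a' 0 = 0" "a' J = 0"
    and a_ge: "\<And>j. j \<in> {1..J-1} \<Longrightarrow> om j / K \<le> a j"
    and ca: "\<And>j. j \<in> {1..J-1} \<Longrightarrow> \<bar>cdiff h a j\<bar> \<le> K"
    and cb: "\<And>j. j \<in> {1..J-1} \<Longrightarrow> \<bar>cdiff h b j\<bar> \<le> K * om j"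
    and cb': "\<And>j. j \<in> {1..J-1} \<Longrightarrow> \<bar>cdiff h b' j\<bar> \<le> K * om j"
    and speed: "\<And>j. j \<in> {1..J-1} \<Longrightarrow> 1 / K \<le> (cdiff h a j)\<^sup>2 + (cdiff h b j)\<^sup>2"
    and singular: "\<And>j. j \<in> {1..J-1} \<Longrightarrow>
      \<bar>cdiff h a j / a j / ((cdiff h a j)\<^sup>2 + (cdiff h b j)\<^sup>2) - (l0 / q j - l1 / (1 - q j))\<bar> \<le> K"
    and res1: "\<And>j. j \<in> {1..J-1} \<Longrightarrow>
      \<bar>sdiff h a' j - cdiff h b' j / a j * cdiff h b j
        - ((cdiff h a j)\<^sup>2 + (cdiff h b j)\<^sup>2) * ((a' j - a j) / \<tau>)\<bar> \<le> S"
    and res2: "\<And>j. j \<in> {1..J-1} \<Longrightarrow>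
      \<bar>sdiff h b' j + cdiff h b' j / a j * cdiff h a j
        - ((cdiff h a j)\<^sup>2 + (cdiff h b j)\<^sup>2) * ((b' j - b j) / \<tau>)\<bar> \<le> S"
    and velocity: "\<And>j. j \<le> J \<Longrightarrow> \<bar>(a' j - a j) / \<tau>\<bar> \<le> K" "\<And>j. j \<le> J \<Longrightarrow> \<bar>(b' j - b j) / \<tau>\<bar> \<le> K"
    and l: "1 / K \<le> l0" "1 / K \<le> l1"
    and bd: "\<And>j. j \<in> {1, J} \<Longrightarrow> \<bar>bdiff h a j\<bar> \<le> K" "\<And>j. j \<in> {1, J} \<Longrightarrow> \<bar>bdiff h b j\<bar> \<le> K"
      "\<And>j. j \<in> {1, J} \<Longrightarrow> 1 / K \<le> (bdiff h a j)\<^sup>2 + (bdiff h b j)\<^sup>2"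
    and l_speed: "l0 * ((bdiff h a 1)\<^sup>2 + (bdiff h b 1)\<^sup>2) \<le> 3 / 2"
      "l1 * ((bdiff h a J)\<^sup>2 + (bdiff h b J)\<^sup>2) \<le> 3 / 2"
    and res_bd: "\<bar>bdiff h b' 1 - h / 4 * ((bdiff h a 1)\<^sup>2 + (bdiff h b 1)\<^sup>2) * ((b' 0 - b 0) / \<tau>)\<bar> \<le> h * S"
      "\<bar>bdiff h b' J + h / 4 * ((bdiff h a J)\<^sup>2 + (bdiff h b J)\<^sup>2) * ((b' J - b J) / \<tau>)\<bar> \<le> h * S"
begin

lemma K_powers: "n \<le> m \<Longrightarrow> K ^ n \<le> K ^ m" "0 < K" "0 < K ^ n" "1 \<le> K ^ n"
  using K by (auto intro: power_increasing)

end

text \<open>\<open>(A, B)\<close> is a numerical solution at the old time that is close to the exact one.\<close>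

locale perturbed_step = consistent_step +
  fixes A B :: "nat \<Rightarrow> real" and \<epsilon> :: real
  assumes AB0: "A 0 = 0" "A J = 0"
    and \<epsilon>: "0 \<le> \<epsilon>" "\<epsilon> \<le> 1 / (1000 * K ^ 7)"
    and close: "\<And>j. j \<in> {1..J} \<Longrightarrow> \<bar>bdiff h a j - bdiff h A j\<bar> \<le> \<epsilon>"
      "\<And>j. j \<in> {1..J} \<Longrightarrow> \<bar>bdiff h b j - bdiff h B j\<bar> \<le> \<epsilon>"
begin

section \<open>Effect of the old error on the coefficients\<close>

definition \<alpha> where "\<alpha> j = a j - A j"
definition \<beta> where "\<beta> j = b j - B j"

abbreviation "d \<equiv> speed_sq a b"
abbreviation "D \<equiv> speed_sq A B"

lemma \<epsilon>_small: "n \<le> 7 \<Longrightarrow> \<epsilon> * K ^ n \<le> 1 / 1000"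
proof -
  assume n: "n \<le> 7"
  have "\<epsilon> * K ^ n \<le> \<epsilon> * K ^ 7" using \<epsilon> K_powers(1)[OF n] by (intro mult_left_mono) auto
  also have "\<dots> \<le> 1 / (1000 * K ^ 7) * K ^ 7" using \<epsilon> K_powers(3)[of 7] by (intro mult_right_mono) auto
  also have "\<dots> = 1 / 1000" using K_powers(3)[of 7] by simp
  finally show ?thesis .
qed

lemma bdiff_\<alpha>: "j \<in> {1..J} \<Longrightarrow> \<bar>bdiff h \<alpha> j\<bar> \<le> \<epsilon>" "j \<in> {1..J} \<Longrightarrow> \<bar>bdiff h \<beta> j\<bar> \<le> \<epsilon>"
  using close[of j] by (simp_all add: \<alpha>_def[abs_def] \<beta>_def[abs_def] bdiff_diff)

lemma cdiff_\<alpha>: "j \<in> {1..J-1} \<Longrightarrow> \<bar>cdiff h \<alpha> j\<bar> \<le> \<epsilon>" "j \<in> {1..J-1} \<Longrightarrow> \<bar>cdiff h \<beta> j\<bar> \<le> \<epsilon>"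
proof -
  assume "j \<in> {1..J-1}"
  then have "j \<in> {1..J}" "Suc j \<in> {1..J}" by auto
  then show "\<bar>cdiff h \<alpha> j\<bar> \<le> \<epsilon>" "\<bar>cdiff h \<beta> j\<bar> \<le> \<epsilon>"
    unfolding cdiff_bdiff[OF h_neq] using bdiff_\<alpha>[of j] bdiff_\<alpha>[of "Suc j"] by auto
qed

lemma cdiff_A: "cdiff h A j = cdiff h a j - cdiff h \<alpha> j" "cdiff h B j = cdiff h b j - cdiff h \<beta> j"
  by (simp_all add: \<alpha>_def[abs_def] \<beta>_def[abs_def] cdiff_diff)

lemma bdiff_A: "bdiff h A j = bdiff h a j - bdiff h \<alpha> j" "bdiff h B j = bdiff h b j - bdiff h \<beta> j"
  by (simp_all add: \<alpha>_def[abs_def] \<beta>_def[abs_def] bdiff_diff)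

text \<open>The first component of the old error vanishes at both ends and has slopes at most
  \<epsilon>, so it is at most \<epsilon> times the distance to either end. Hence its size relative
  to \<open>a\<close> is small up to the axis, where \<open>a\<close> itself tends to zero.\<close>

lemma \<alpha>_le: "j \<in> {1..J-1} \<Longrightarrow> \<bar>\<alpha> j\<bar> \<le> 2 * \<epsilon> * om j"
proof -
  have step: "\<bar>\<alpha> (Suc n)\<bar> \<le> \<bar>\<alpha> n\<bar> + \<epsilon> * h" "\<bar>\<alpha> n\<bar> \<le> \<bar>\<alpha> (Suc n)\<bar> + \<epsilon> * h" if "n < J" for n
  proof -
    have "\<bar>\<alpha> (Suc n) - \<alpha> n\<bar> / h \<le> \<epsilon>"
      using bdiff_\<alpha>(1)[of "Suc n"] that h_pos by (simp add: bdiff_def abs_divide)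
    then have "\<bar>\<alpha> (Suc n) - \<alpha> n\<bar> \<le> \<epsilon> * h" using h_pos by (simp add: field_simps)
    then show "\<bar>\<alpha> (Suc n)\<bar> \<le> \<bar>\<alpha> n\<bar> + \<epsilon> * h" "\<bar>\<alpha> n\<bar> \<le> \<bar>\<alpha> (Suc n)\<bar> + \<epsilon> * h" by linarith+
  qed
  have L: "\<bar>\<alpha> n\<bar> \<le> \<epsilon> * q n" if "n \<le> J" for n
    using that
  proof (induction n)
    case 0
    then show ?case using dirichlet AB0 by (simp add: \<alpha>_def q_def)
  next
    case (Suc n)
    then show ?case using step(1)[of n] by (simp add: q_def algebra_simps)
  qed
  have R: "\<bar>\<alpha> (J - n)\<bar> \<le> \<epsilon> * q n" if "n \<le> J" for n
    using that
  proof (induction n)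
    case 0
    then show ?case using dirichlet AB0 by (simp add: \<alpha>_def q_def)
  next
    case (Suc n)
    then have "Suc (J - Suc n) = J - n" by simp
    then show ?case using step(2)[of "J - Suc n"] Suc by (simp add: q_def algebra_simps)
  qed
  assume j: "j \<in> {1..J-1}"
  have "J - (J - j) = j" using j by auto
  then have 1: "\<bar>\<alpha> j\<bar> \<le> \<epsilon> * q j" "\<bar>\<alpha> j\<bar> \<le> \<epsilon> * (1 - q j)"
    using L[of j] R[of "J - j"] j q_reflect[of j] by auto
  show ?thesis
  proof (cases "q j \<le> 1/2")
    case True
    then have "q j * (1/2) \<le> q j * (1 - q j)" using q_pos[OF j] by (intro mult_left_mono) auto
    then have "\<epsilon> * q j \<le> \<epsilon> * (2 * om j)" using \<epsilon> by (intro mult_left_mono) (auto simp: om_def)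
    then show ?thesis using 1 by simp
  next
    case False
    then have "(1/2) * (1 - q j) \<le> q j * (1 - q j)" using q_pos[OF j] by (intro mult_right_mono) auto
    then have "\<epsilon> * (1 - q j) \<le> \<epsilon> * (2 * om j)" using \<epsilon> by (intro mult_left_mono) (auto simp: om_def)
    then show ?thesis using 1 by simp
  qed
qed

lemma A_ge: "j \<in> {1..J-1} \<Longrightarrow> om j / (2 * K) \<le> A j"
proof -
  assume j: "j \<in> {1..J-1}"
  have "2 * \<epsilon> \<le> 1 / (2 * K)" using \<epsilon>_small[of 1] K by (simp add: field_simps)
  then have "2 * \<epsilon> * om j \<le> 1 / (2 * K) * om j" using om_pos[OF j] by (intro mult_right_mono) auto
  moreover have "om j / K = om j / (2 * K) + 1 / (2 * K) * om j" using K by (simp add: field_simps)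
  ultimately show ?thesis using \<alpha>_le[OF j] a_ge[OF j] by (simp add: \<alpha>_def)
qed

lemma A_pos: "j \<in> {1..J-1} \<Longrightarrow> 0 < A j" "j \<in> {1..J-1} \<Longrightarrow> 0 < a j"
proof -
  assume j: "j \<in> {1..J-1}"
  have "0 < om j / (2 * K)" "0 < om j / K" using om_pos[OF j] K by auto
  then show "0 < A j" "0 < a j" using A_ge[OF j] a_ge[OF j] by linarith+
qed

text \<open>Abstract slopes are used because the same estimate serves the centred differences inside
  and the one-sided ones at the ends. The first bound is linear in the error, as the residuals
  require; the others confine the perturbed squared speed to a fixed range.\<close>

lemma square_perturbation:
  assumes "\<bar>u\<bar> \<le> K" "\<bar>v\<bar> \<le> K" "\<bar>\<delta>\<bar> \<le> \<epsilon>" "\<bar>\<gamma>\<bar> \<le> \<epsilon>" "U = u - \<delta>" "V = v - \<gamma>" "1 / K \<le> u\<^sup>2 + v\<^sup>2"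
  shows "\<bar>u\<^sup>2 + v\<^sup>2 - (U\<^sup>2 + V\<^sup>2)\<bar> \<le> 3 * K * (\<bar>\<delta>\<bar> + \<bar>\<gamma>\<bar>)"
    and "\<bar>u\<^sup>2 + v\<^sup>2 - (U\<^sup>2 + V\<^sup>2)\<bar> \<le> 6 * K * \<epsilon>"
    and "1 / (2 * K) \<le> U\<^sup>2 + V\<^sup>2" and "U\<^sup>2 + V\<^sup>2 \<le> 3 * K\<^sup>2"
proof -
  have "\<epsilon> \<le> K" using \<epsilon>_small[of 0] K by simp
  then have "\<bar>\<delta> * (2 * u - \<delta>)\<bar> \<le> \<bar>\<delta>\<bar> * (3 * K)" "\<bar>\<gamma> * (2 * v - \<gamma>)\<bar> \<le> \<bar>\<gamma>\<bar> * (3 * K)"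
    using assms by (intro abs_mult_le; linarith)+
  moreover have e: "u\<^sup>2 + v\<^sup>2 - (U\<^sup>2 + V\<^sup>2) = \<delta> * (2 * u - \<delta>) + \<gamma> * (2 * v - \<gamma>)"
    by (simp add: assms power2_eq_square algebra_simps)
  ultimately show 1: "\<bar>u\<^sup>2 + v\<^sup>2 - (U\<^sup>2 + V\<^sup>2)\<bar> \<le> 3 * K * (\<bar>\<delta>\<bar> + \<bar>\<gamma>\<bar>)"
    by (simp add: algebra_simps)
  also have "\<dots> \<le> 3 * K * (\<epsilon> + \<epsilon>)" using assms K by (intro mult_left_mono) auto
  finally show 2: "\<bar>u\<^sup>2 + v\<^sup>2 - (U\<^sup>2 + V\<^sup>2)\<bar> \<le> 6 * K * \<epsilon>" by simp
  have "\<epsilon> * K\<^sup>2 \<le> 1 / 1000" using \<epsilon>_small[of 2] by simp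
  then have 3: "6 * K * \<epsilon> \<le> 1 / (2 * K)" using K by (simp add: field_simps power2_eq_square)
  moreover have "1 / K = 1 / (2 * K) + 1 / (2 * K)" by simp
  ultimately show "1 / (2 * K) \<le> U\<^sup>2 + V\<^sup>2" using 2 assms(7) by linarith
  have "u\<^sup>2 \<le> K\<^sup>2" "v\<^sup>2 \<le> K\<^sup>2" using assms(1,2) by (metis abs_ge_zero power2_abs power_mono)+
  moreover have "1 / (2 * K) \<le> 1" using K by (simp add: field_simps)
  ultimately show "U\<^sup>2 + V\<^sup>2 \<le> 3 * K\<^sup>2" using 2 3 K_powers(4)[of 2] by linarith
qed

lemma cb_K: "j \<in> {1..J-1} \<Longrightarrow> \<bar>cdiff h b j\<bar> \<le> K"
proof -
  assume j: "j \<in> {1..J-1}"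
  have "K * om j \<le> K * 1" using om_le_1[OF j] K by (intro mult_left_mono) auto
  then show ?thesis using cb[OF j] by simp
qed

lemma interior_perturbation:
  assumes j: "j \<in> {1..J-1}"
  shows "\<bar>d j - D j\<bar> \<le> 3 * K * (\<bar>cdiff h \<alpha> j\<bar> + \<bar>cdiff h \<beta> j\<bar>)"
  unfolding speed_sq_simps(1)[OF j] using j
  by (intro square_perturbation(1) ca cb_K cdiff_\<alpha> cdiff_A speed)

lemma boundary_perturbation:
  "\<bar>d 0 - D 0\<bar> \<le> 3 * K * (\<bar>bdiff h \<alpha> 1\<bar> + \<bar>bdiff h \<beta> 1\<bar>)"
  "\<bar>d J - D J\<bar> \<le> 3 * K * (\<bar>bdiff h \<alpha> J\<bar> + \<bar>bdiff h \<beta> J\<bar>)"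
  unfolding speed_sq_simps(2,3) using J_ge_2
  by (intro square_perturbation(1) bd bdiff_\<alpha> bdiff_A; simp)+

lemma D_perturbation:
  assumes "j \<le> J"
  shows "1 / (2 * K) \<le> D j" "D j \<le> 3 * K\<^sup>2" "1 / K \<le> d j" "\<bar>d j - D j\<bar> \<le> 6 * K * \<epsilon>"
proof -
  consider "j = 0" | "j = J" | "j \<in> {1..J-1}" using assms by fastforce
  then have "1 / (2 * K) \<le> D j \<and> D j \<le> 3 * K\<^sup>2 \<and> 1 / K \<le> d j \<and> \<bar>d j - D j\<bar> \<le> 6 * K * \<epsilon>"
  proof cases
    case 1
    have "(1::nat) \<in> {1..J}" using J_ge_2 by auto
    then show ?thesis using square_perturbation[OF bd(1)[of 1] bd(2)[of 1] bdiff_\<alpha>[of 1] bdiff_A bd(3)[of 1]] bd(3)[of 1]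
      by (simp add: speed_sq_simps 1)
  next
    case 2
    have "J \<in> {1..J}" using J_ge_2 by auto
    then show ?thesis using square_perturbation[OF bd(1)[of J] bd(2)[of J] bdiff_\<alpha>[of J] bdiff_A bd(3)[of J]] bd(3)[of J]
      by (simp add: speed_sq_simps 2)
  next
    case 3
    then show ?thesis
      using square_perturbation[OF ca cb_K cdiff_\<alpha> cdiff_A speed, OF 3 3 3 3 3] speed[OF 3] by (simp add: speed_sq_simps)
  qed
  then show "1 / (2 * K) \<le> D j" "D j \<le> 3 * K\<^sup>2" "1 / K \<le> d j" "\<bar>d j - D j\<bar> \<le> 6 * K * \<epsilon>" by auto
qed

lemma D_pos: "j \<le> J \<Longrightarrow> 0 < D j"
  using D_perturbation(1)[of j] K by (smt (verit) divide_pos_pos)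

lemma inverse_D: "j \<le> J \<Longrightarrow> 1 / D j \<le> 2 * K" "j \<le> J \<Longrightarrow> 1 / (3 * K\<^sup>2) \<le> 1 / D j"
proof -
  assume j: "j \<le> J"
  show "1 / D j \<le> 2 * K" using D_perturbation(1)[OF j] D_pos[OF j] K by (simp add: field_simps)
  show "1 / (3 * K\<^sup>2) \<le> 1 / D j" using D_perturbation[OF j] D_pos[OF j] K by (intro divide_left_mono) auto
qed

text \<open>The error of the denominator brings a second factor \<open>1 / om j\<close>, but paired
  with \<alpha>, where \<open>hardy_om\<close> or \<open>\<alpha>_le\<close> can deal with it. Only
  one such factor remains outside.\<close>

lemma quotient_difference:
  assumes j: "j \<in> {1..J-1}" and u: "\<bar>u\<bar> \<le> K" and U: "U = u - \<delta>"
  shows "\<bar>u / a j - U / A j\<bar> \<le> 2 * K ^ 3 * (\<bar>\<delta>\<bar> + \<bar>\<alpha> j\<bar> / om j) / om j"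
proof -
  have om: "0 < om j" using om_pos[OF j] .
  have "u / a j - U / A j = \<delta> / A j - u / a j * (\<alpha> j / A j)"
    using A_pos[OF j] unfolding U \<alpha>_def by (simp add: field_simps)
  moreover have "\<bar>\<delta> / A j\<bar> \<le> \<bar>\<delta>\<bar> / (om j / (2 * K))" "\<bar>\<alpha> j / A j\<bar> \<le> \<bar>\<alpha> j\<bar> / (om j / (2 * K))"
    "\<bar>u / a j\<bar> \<le> K / (om j / K)"
    using A_ge[OF j] a_ge[OF j] u om K by (intro abs_divide_le; simp)+
  moreover from this have "\<bar>u / a j * (\<alpha> j / A j)\<bar> \<le> K / (om j / K) * (\<bar>\<alpha> j\<bar> / (om j / (2 * K)))"
    by (intro abs_mult_le)
  moreover have "\<bar>\<delta>\<bar> / (om j / (2 * K)) = 2 * K * (\<bar>\<delta>\<bar> / om j)" using om by simp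
  moreover have "2 * K * (\<bar>\<delta>\<bar> / om j) \<le> 2 * K ^ 3 * (\<bar>\<delta>\<bar> / om j)"
    using om K K_powers(1)[of 1 3] by (intro mult_right_mono) auto
  moreover have "K / (om j / K) * (\<bar>\<alpha> j\<bar> / (om j / (2 * K))) = 2 * K ^ 3 * (\<bar>\<alpha> j\<bar> / om j / om j)"
    using om K by (simp add: power3_eq_cube)
  moreover have "2 * K ^ 3 * (\<bar>\<delta>\<bar> + \<bar>\<alpha> j\<bar> / om j) / om j = 2 * K ^ 3 * (\<bar>\<delta>\<bar> / om j) + 2 * K ^ 3 * (\<bar>\<alpha> j\<bar> / om j / om j)"
    by (simp add: add_divide_distrib distrib_left)
  ultimately show ?thesis by linarith
qed

text \<open>The condition of \<open>scheme_components_solvable\<close> is delicate next to the axis,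
  where the lower bound for \<open>A j\<close> is only of order \<open>h\<close>. There
  \<open>h^2 * sdiff h A j\<close> is at most \<open>h * (h * K + 2 * \<epsilon>)\<close> and hence
  at most \<open>A j\<close>, so the two nonnegative neighbours add up to at most
  \<open>3 * A j\<close>.\<close>

lemma solvable:
  assumes h: "h \<le> 1 / (100 * K ^ 2)" and a2: "\<And>j. j \<in> {1..J-1} \<Longrightarrow> \<bar>sdiff h a j\<bar> \<le> K"
  obtains A' B' where
    "\<And>j. j \<in> {1..J-1} \<Longrightarrow>
      (A' j - A j) / \<tau> = sdiff h A' j / D j - cdiff h B' j / A j * cdiff h B j / D j"
    "\<And>j. j \<in> {1..J-1} \<Longrightarrow>
      (B' j - B j) / \<tau> = sdiff h B' j / D j + cdiff h B' j / A j * cdiff h A j / D j"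
    "A' 0 = 0" "A' J = 0"
    "bdiff h B' 1 = h / 4 * D 0 * ((B' 0 - B 0) / \<tau>)"
    "bdiff h B' J = - (h / 4 * D J * ((B' J - B J) / \<tau>))"
proof (rule scheme_components_solvable[of \<tau> D A B])
  fix j assume j: "j \<in> {1..J-1}"
  have om: "0 < om j" using om_pos[OF j] .
  have nn: "0 \<le> A (j + 1)" "0 \<le> A (j - 1)"
  proof -
    have "j + 1 = J \<or> j + 1 \<in> {1..J-1}" "j - 1 = 0 \<or> j - 1 \<in> {1..J-1}" using j by auto
    then show "0 \<le> A (j + 1)" "0 \<le> A (j - 1)"
      using AB0 A_pos(1)[of "j + 1"] A_pos(1)[of "j - 1"] by auto
  qed
  have "sdiff h A j = sdiff h a j - sdiff h \<alpha> j" by (simp add: \<alpha>_def[abs_def] sdiff_diff)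
  moreover have "\<bar>sdiff h \<alpha> j\<bar> \<le> 2 * \<epsilon> / h"
  proof -
    have "j \<in> {1..J}" "Suc j \<in> {1..J}" using j by auto
    then have "\<bar>bdiff h \<alpha> (Suc j) - bdiff h \<alpha> j\<bar> \<le> 2 * \<epsilon>"
      using bdiff_\<alpha>(1)[of j] bdiff_\<alpha>(1)[of "Suc j"] by auto
    then show ?thesis unfolding sdiff_bdiff[OF h_neq] using h_pos by (intro abs_divide_le) auto
  qed
  ultimately have "sdiff h A j \<le> K + 2 * \<epsilon> / h" using a2[OF j] by linarith
  then have "h\<^sup>2 * sdiff h A j \<le> h\<^sup>2 * (K + 2 * \<epsilon> / h)" by (intro mult_left_mono) auto
  also have "\<dots> = h * (h * K + 2 * \<epsilon>)" using h_neq by (simp add: power2_eq_square field_simps)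
  also have "\<dots> \<le> h * (1 / (4 * K))"
  proof (intro mult_left_mono)
    have "h * K \<le> 1 / (100 * K ^ 2) * K" using h K by (intro mult_right_mono) auto
    also have "\<dots> = 1 / (100 * K)" using K by (simp add: power2_eq_square)
    also have "\<dots> \<le> 1 / (8 * K)" using K by (simp add: field_simps)
    finally have "h * K \<le> 1 / (8 * K)" .
    moreover have "2 * \<epsilon> \<le> 1 / (8 * K)" using \<epsilon>_small[of 1] K by (simp add: field_simps)
    ultimately show "h * K + 2 * \<epsilon> \<le> 1 / (4 * K)" by (simp add: field_simps)
  qed (use h_pos in auto)
  also have "\<dots> \<le> (2 * om j) * (1 / (4 * K))" using h_le_om[OF j] K by (intro mult_right_mono) auto
  also have "\<dots> \<le> A j" using A_ge[OF j] by simp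
  finally have "h\<^sup>2 * sdiff h A j \<le> A j" .
  then have "A (j + 1) + A (j - 1) \<le> 3 * A j" using h_neq by (simp add: sdiff_def)
  then show "\<bar>A (j + 1) - A (j - 1)\<bar> < 4 * A j" using nn A_pos(1)[OF j] by linarith
qed (use \<tau> D_pos A_pos that in auto)

section \<open>Residuals caused by the old error\<close>

definition X where "X j = \<bar>cdiff h \<alpha> j\<bar> + \<bar>cdiff h \<beta> j\<bar> + \<bar>\<alpha> j\<bar> / om j"

text \<open>One bound for both components: \<open>c\<close> will be the centred difference of
  \<open>b'\<close> up to sign. As it vanishes like \<open>om j\<close> at the axis, it cancels the
  factor \<open>1 / om j\<close> left by \<open>quotient_difference\<close>.\<close>

lemma remainder_bound:
  assumes j: "j \<in> {1..J-1}" and c: "\<bar>c\<bar> \<le> K * om j" and u: "\<bar>u\<bar> \<le> K" and U: "U = u - \<delta>"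
    and \<delta>: "\<bar>\<delta>\<bar> \<le> \<bar>cdiff h \<alpha> j\<bar> + \<bar>cdiff h \<beta> j\<bar>" and v: "\<bar>v\<bar> \<le> K" and \<rho>: "\<bar>\<rho>\<bar> \<le> S"
  shows "\<bar>(c * (u / a j - U / A j) - (d j - D j) * v - \<rho>) / D j\<bar> \<le> 10 * K ^ 5 * (X j + S)"
proof -
  have om: "0 < om j" using om_pos[OF j] .
  have X0: "0 \<le> X j" using om by (simp add: X_def)
  have jJ: "j \<le> J" using j by auto
  have "\<bar>c * (u / a j - U / A j)\<bar> \<le> K * om j * (2 * K ^ 3 * (\<bar>\<delta>\<bar> + \<bar>\<alpha> j\<bar> / om j) / om j)"
    using quotient_difference[OF j u U] c by (intro abs_mult_le)
  also have "\<dots> = 2 * K ^ 4 * (\<bar>\<delta>\<bar> + \<bar>\<alpha> j\<bar> / om j)" using om by (simp add: eval_nat_numeral)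
  also have "\<dots> \<le> 2 * K ^ 4 * X j" using \<delta> K_powers(3)[of 4] by (intro mult_left_mono) (auto simp: X_def)
  finally have 1: "\<bar>c * (u / a j - U / A j)\<bar> \<le> 2 * K ^ 4 * X j" .
  have "\<bar>(d j - D j) * v\<bar> \<le> 3 * K * (\<bar>cdiff h \<alpha> j\<bar> + \<bar>cdiff h \<beta> j\<bar>) * K"
    using interior_perturbation[OF j] v by (intro abs_mult_le)
  also have "\<dots> = 3 * K ^ 2 * (\<bar>cdiff h \<alpha> j\<bar> + \<bar>cdiff h \<beta> j\<bar>)" by (simp add: power2_eq_square)
  also have "\<dots> \<le> 3 * K ^ 4 * X j"
    using K_powers(1)[of 2 4] K om by (intro mult_mono) (auto simp: X_def)
  finally have 2: "\<bar>(d j - D j) * v\<bar> \<le> 3 * K ^ 4 * X j" .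
  have "1 * S \<le> 5 * K ^ 4 * S" using K_powers(4)[of 4] S by (intro mult_right_mono) auto
  then have "\<bar>c * (u / a j - U / A j) - (d j - D j) * v - \<rho>\<bar> \<le> 5 * K ^ 4 * (X j + S)"
  proof -
    have "\<bar>x - y - z\<bar> \<le> p + p' + p''" if "\<bar>x\<bar> \<le> p" "\<bar>y\<bar> \<le> p'" "\<bar>z\<bar> \<le> p''" for x y z p p' p'' :: real
      using that by linarith
    from this[OF 1 2 \<rho>] \<open>1 * S \<le> 5 * K ^ 4 * S\<close> show ?thesis by (simp add: distrib_left)
  qed
  then have "\<bar>(c * (u / a j - U / A j) - (d j - D j) * v - \<rho>) * (1 / D j)\<bar> \<le> 5 * K ^ 4 * (X j + S) * (2 * K)"
    using inverse_D(1)[OF jJ] D_pos[OF jJ] by (intro abs_mult_le) auto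
  moreover have "5 * K ^ 4 * (X j + S) * (2 * K) = 10 * K ^ 5 * (X j + S)" by (simp add: eval_nat_numeral)
  ultimately show ?thesis by (simp only: times_divide_eq_right mult_1_right)
qed

text \<open>Squaring \<open>X\<close> produces \<open>(\<alpha> j / om j)^2\<close>, whose sum
  \<open>hardy_om\<close> bounds by \<open>16 * S1 \<alpha>\<close>. The constant is 6800 = 100 * 4
  * 17 with 17 = 1 + 16.\<close>

lemma remainder_sum:
  assumes "\<And>j. j \<in> {1..J-1} \<Longrightarrow> \<bar>r j\<bar> \<le> 10 * K ^ 5 * (X j + S)"
  shows "h * (\<Sum>j=1..J-1. (r j)\<^sup>2) \<le> 6800 * K ^ 10 * (S1 \<alpha> + S1 \<beta> + S\<^sup>2)"
proof -
  have sq4: "(x + y + z + w)\<^sup>2 \<le> 4 * (x\<^sup>2 + y\<^sup>2 + z\<^sup>2 + w\<^sup>2)" for x y z w :: real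
  proof -
    have "(x + y + z + w)\<^sup>2 = 4 * (((x + y) + (z + w)) / 2)\<^sup>2" by (simp add: power_divide add.assoc)
    also have "\<dots> \<le> 4 * (((x + y)\<^sup>2 + (z + w)\<^sup>2) / 2)" by (intro mult_left_mono power2_mean_le) auto
    also have "\<dots> = 4 * (2 * ((x + y) / 2)\<^sup>2 + 2 * ((z + w) / 2)\<^sup>2)" by (simp add: power_divide)
    also have "\<dots> \<le> 4 * (x\<^sup>2 + y\<^sup>2 + z\<^sup>2 + w\<^sup>2)"
      using power2_mean_le[of x y] power2_mean_le[of z w] by argo
    finally show ?thesis .
  qed
  have pt: "(r j)\<^sup>2 \<le> 400 * K ^ 10 * ((cdiff h \<alpha> j)\<^sup>2 + (cdiff h \<beta> j)\<^sup>2 + (\<alpha> j / om j)\<^sup>2 + S\<^sup>2)" if j: "j \<in> {1..J-1}" for j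
  proof -
    have "(r j)\<^sup>2 \<le> (10 * K ^ 5 * (X j + S))\<^sup>2" using assms[OF j] by (metis abs_ge_zero power2_abs power_mono)
    also have "\<dots> = 100 * K ^ 10 * (X j + S)\<^sup>2" by (simp add: power_mult_distrib flip: power_mult)
    also have "\<dots> \<le> 100 * K ^ 10 * (4 * ((cdiff h \<alpha> j)\<^sup>2 + (cdiff h \<beta> j)\<^sup>2 + (\<alpha> j / om j)\<^sup>2 + S\<^sup>2))"
      using sq4[of "\<bar>cdiff h \<alpha> j\<bar>" "\<bar>cdiff h \<beta> j\<bar>" "\<bar>\<alpha> j\<bar> / om j" S] K_powers(3)[of 10]
      by (intro mult_left_mono) (auto simp: X_def power_divide)
    also have "\<dots> = 400 * K ^ 10 * ((cdiff h \<alpha> j)\<^sup>2 + (cdiff h \<beta> j)\<^sup>2 + (\<alpha> j / om j)\<^sup>2 + S\<^sup>2)"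
      by (simp only: mult.assoc[symmetric] mult.commute[of "100 * K ^ 10" 4] numeral_times_numeral semiring_norm)
    finally show ?thesis .
  qed
  have "h * (\<Sum>j=1..J-1. (r j)\<^sup>2)
    \<le> h * (\<Sum>j=1..J-1. 400 * K ^ 10 * ((cdiff h \<alpha> j)\<^sup>2 + (cdiff h \<beta> j)\<^sup>2 + (\<alpha> j / om j)\<^sup>2 + S\<^sup>2))"
    using h_pos by (intro mult_left_mono sum_mono pt) auto
  also have "\<dots> = 400 * K ^ 10 * (h * (\<Sum>j=1..J-1. (cdiff h \<alpha> j)\<^sup>2) + h * (\<Sum>j=1..J-1. (cdiff h \<beta> j)\<^sup>2)
      + h * (\<Sum>j=1..J-1. (\<alpha> j / om j)\<^sup>2) + h * (\<Sum>j=1..J-1. S\<^sup>2))"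
    by (simp only: sum.distrib sum_distrib_left[symmetric] distrib_left) (simp add: mult.left_commute)
  also have "\<dots> \<le> 400 * K ^ 10 * (S1 \<alpha> + S1 \<beta> + 16 * S1 \<alpha> + S\<^sup>2)"
  proof (intro mult_left_mono add_mono sum_cdiff_le hardy_om)
    have "real (J - 1) * h \<le> real J * h" using h_pos by (intro mult_right_mono) auto
    then have "h * real (J - 1) * S\<^sup>2 \<le> 1 * S\<^sup>2" unfolding Jh by (intro mult_right_mono) (auto simp: mult.commute)
    then show "h * (\<Sum>j=1..J-1. S\<^sup>2) \<le> S\<^sup>2" by simp
  qed (use dirichlet AB0 K_powers(3)[of 10] in \<open>auto simp: \<alpha>_def\<close>)
  also have "\<dots> \<le> 400 * K ^ 10 * (17 * (S1 \<alpha> + S1 \<beta> + S\<^sup>2))"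
    using K_powers(3)[of 10] S1_nonneg by (intro mult_left_mono) auto
  also have "\<dots> = 6800 * K ^ 10 * (S1 \<alpha> + S1 \<beta> + S\<^sup>2)"
    by (simp only: mult.assoc[symmetric] mult.commute[of "400 * K ^ 10" 17] numeral_times_numeral semiring_norm)
  finally show ?thesis .
qed

lemma boundary_remainder_sum:
  assumes "\<bar>s0\<bar> \<le> K\<^sup>2 * (\<bar>bdiff h \<alpha> 1\<bar> + \<bar>bdiff h \<beta> 1\<bar> + S)" "\<bar>sJ\<bar> \<le> K\<^sup>2 * (\<bar>bdiff h \<alpha> J\<bar> + \<bar>bdiff h \<beta> J\<bar> + S)"
  shows "h * (s0\<^sup>2 + sJ\<^sup>2) \<le> 3 * K ^ 4 * (S1 \<alpha> + S1 \<beta> + S\<^sup>2)"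
proof -
  have sq: "s\<^sup>2 \<le> K ^ 4 * (3 * (x\<^sup>2 + y\<^sup>2 + S\<^sup>2))" if "\<bar>s\<bar> \<le> K\<^sup>2 * (\<bar>x\<bar> + \<bar>y\<bar> + S)" for s x y
  proof -
    have "s\<^sup>2 \<le> (K\<^sup>2 * (\<bar>x\<bar> + \<bar>y\<bar> + S))\<^sup>2" using that by (metis abs_ge_zero power2_abs power_mono)
    also have "\<dots> = K ^ 4 * (\<bar>x\<bar> + \<bar>y\<bar> + S)\<^sup>2" by (simp add: power_mult_distrib flip: power_mult)
    also have "\<dots> \<le> K ^ 4 * (3 * (\<bar>x\<bar>\<^sup>2 + \<bar>y\<bar>\<^sup>2 + S\<^sup>2))"
    proof (intro mult_left_mono)
      have "3 * (\<bar>x\<bar>\<^sup>2 + \<bar>y\<bar>\<^sup>2 + S\<^sup>2) - (\<bar>x\<bar> + \<bar>y\<bar> + S)\<^sup>2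
          = (\<bar>x\<bar> - \<bar>y\<bar>)\<^sup>2 + (\<bar>y\<bar> - S)\<^sup>2 + (\<bar>x\<bar> - S)\<^sup>2"
        by (simp only: power2_eq_square) (simp add: algebra_simps)
      moreover have "\<dots> \<ge> 0" by simp
      ultimately show "(\<bar>x\<bar> + \<bar>y\<bar> + S)\<^sup>2 \<le> 3 * (\<bar>x\<bar>\<^sup>2 + \<bar>y\<bar>\<^sup>2 + S\<^sup>2)" by linarith
    qed (use K_powers(3)[of 4] in auto)
    finally show ?thesis by simp
  qed
  have two: "h * ((bdiff h u 1)\<^sup>2 + (bdiff h u J)\<^sup>2) \<le> S1 u" for u
  proof -
    have "(\<Sum>j\<in>{1, J}. (bdiff h u j)\<^sup>2) \<le> (\<Sum>j=1..J. (bdiff h u j)\<^sup>2)"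
      using J_ge_2 by (intro sum_mono2) auto
    then show ?thesis using J_ge_2 h_pos by (simp add: S1_def)
  qed
  have "h * (s0\<^sup>2 + sJ\<^sup>2) \<le> h * (K ^ 4 * (3 * ((bdiff h \<alpha> 1)\<^sup>2 + (bdiff h \<beta> 1)\<^sup>2 + S\<^sup>2))
      + K ^ 4 * (3 * ((bdiff h \<alpha> J)\<^sup>2 + (bdiff h \<beta> J)\<^sup>2 + S\<^sup>2)))"
    using assms h_pos by (intro mult_left_mono add_mono sq) auto
  also have "\<dots> = 3 * K ^ 4 * (h * ((bdiff h \<alpha> 1)\<^sup>2 + (bdiff h \<alpha> J)\<^sup>2)
      + h * ((bdiff h \<beta> 1)\<^sup>2 + (bdiff h \<beta> J)\<^sup>2) + 2 * h * S\<^sup>2)" by (simp add: algebra_simps)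
  also have "\<dots> \<le> 3 * K ^ 4 * (S1 \<alpha> + S1 \<beta> + S\<^sup>2)"
    using two[of \<alpha>] two[of \<beta>] h_le K_powers(3)[of 4] mult_right_mono[of "2 * h" 1 "S\<^sup>2"]
    by (intro mult_left_mono add_mono) auto
  finally show ?thesis .
qed

text \<open>This is the shape \<open>L + \<eta> / om j\<close> of the linear estimates. In the first
  bound the exact slope \<open>cdiff h b j\<close> is of order \<open>om j\<close>, so only its
  perturbation is left over \<open>om j\<close>. In the second the exact coefficient is regular once
  its poles are subtracted, and the perturbations of quotient and speed contribute
  \<open>12 * K ^ 5 * \<epsilon> / om j\<close> each.\<close>

lemma coefficient_bounds:
  assumes j: "j \<in> {1..J-1}"
  shows "\<bar>- (cdiff h B j / A j / D j)\<bar> \<le> 4 * K ^ 3 + 24 * K ^ 5 * \<epsilon> / om j"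
    and "\<bar>cdiff h A j / A j / D j - (l0 / q j - l1 / (1 - q j))\<bar> \<le> 4 * K ^ 3 + 24 * K ^ 5 * \<epsilon> / om j"
proof -
  have om: "0 < om j" using om_pos[OF j] .
  have jJ: "j \<le> J" using j by auto
  have "\<bar>cdiff h B j\<bar> \<le> K * om j + \<epsilon>"
    using cb[OF j] cdiff_\<alpha>(2)[OF j] cdiff_A(2)[of j] by linarith
  then have "\<bar>cdiff h B j / A j\<bar> \<le> (K * om j + \<epsilon>) / (om j / (2 * K))"
    using A_ge[OF j] om K by (intro abs_divide_le) auto
  then have "\<bar>cdiff h B j / A j * (1 / D j)\<bar> \<le> (K * om j + \<epsilon>) / (om j / (2 * K)) * (2 * K)"
    using inverse_D(1)[OF jJ] D_pos[OF jJ] by (intro abs_mult_le) auto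
  also have "\<dots> = 4 * K ^ 3 + 4 * K\<^sup>2 * \<epsilon> / om j"
    using om by (simp add: field_simps power3_eq_cube power2_eq_square)
  also have "4 * K\<^sup>2 * \<epsilon> / om j \<le> 24 * K ^ 5 * \<epsilon> / om j"
  proof -
    have "4 * K\<^sup>2 \<le> 24 * K ^ 5" using K_powers(1)[of 2 5] K_powers(3)[of 5] by linarith
    then show ?thesis using \<epsilon> om by (intro divide_right_mono mult_right_mono) auto
  qed
  finally show "\<bar>- (cdiff h B j / A j / D j)\<bar> \<le> 4 * K ^ 3 + 24 * K ^ 5 * \<epsilon> / om j" by simp
  have Q: "\<bar>cdiff h a j / a j - cdiff h A j / A j\<bar> \<le> 6 * K ^ 3 * \<epsilon> / om j"
  proof -
    have "\<bar>\<alpha> j\<bar> / om j \<le> 2 * \<epsilon>" using \<alpha>_le[OF j] om by (simp add: field_simps)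
    then have "2 * K ^ 3 * (\<bar>cdiff h \<alpha> j\<bar> + \<bar>\<alpha> j\<bar> / om j) / om j \<le> 2 * K ^ 3 * (\<epsilon> + 2 * \<epsilon>) / om j"
      using cdiff_\<alpha>(1)[OF j] om K_powers(3)[of 3] by (intro divide_right_mono mult_left_mono add_mono) auto
    then show ?thesis using quotient_difference[OF j ca[OF j] cdiff_A(1)] by simp
  qed
  have P: "\<bar>1 / d j - 1 / D j\<bar> \<le> 12 * K ^ 3 * \<epsilon>"
  proof -
    have dp: "0 < d j" using D_perturbation(3)[OF jJ] K by (smt (verit) divide_pos_pos)
    then have dK: "\<bar>1 / d j\<bar> \<le> K" using D_perturbation(3)[OF jJ] K by (simp add: field_simps)
    have DK: "\<bar>1 / D j\<bar> \<le> 2 * K" using inverse_D(1)[OF jJ] D_pos[OF jJ] by simp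
    have "1 / d j - 1 / D j = - (d j - D j) * (1 / d j * (1 / D j))"
      using dp D_pos[OF jJ] by (simp add: field_simps)
    also have "\<bar>\<dots>\<bar> \<le> 6 * K * \<epsilon> * (K * (2 * K))"
      using dK DK D_perturbation(4)[OF jJ] by (intro abs_mult_le) auto
    finally show ?thesis by (simp add: power3_eq_cube algebra_simps)
  qed
  have aa: "\<bar>cdiff h a j / a j\<bar> \<le> K / (om j / K)"
    using a_ge[OF j] ca[OF j] om K by (intro abs_divide_le) auto
  define M where "M = 12 * K ^ 5 * \<epsilon> / om j"
  have e: "cdiff h a j / a j / d j - cdiff h A j / A j / D j
      = (cdiff h a j / a j - cdiff h A j / A j) * (1 / D j) + cdiff h a j / a j * (1 / d j - 1 / D j)"
    by (simp add: algebra_simps)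
  have "\<bar>(cdiff h a j / a j - cdiff h A j / A j) * (1 / D j)\<bar> \<le> 6 * K ^ 3 * \<epsilon> / om j * (2 * K)"
    using Q inverse_D(1)[OF jJ] D_pos[OF jJ] by (intro abs_mult_le) auto
  also have "\<dots> = 12 * K ^ 4 * \<epsilon> / om j" by (simp add: eval_nat_numeral)
  also have "\<dots> \<le> M"
    using K_powers(1)[of 4 5] \<epsilon> om unfolding M_def by (intro divide_right_mono mult_right_mono) auto
  finally have 1: "\<bar>(cdiff h a j / a j - cdiff h A j / A j) * (1 / D j)\<bar> \<le> M" .
  have "\<bar>cdiff h a j / a j * (1 / d j - 1 / D j)\<bar> \<le> K / (om j / K) * (12 * K ^ 3 * \<epsilon>)"
    using aa P by (intro abs_mult_le)
  also have "\<dots> = M" by (simp add: eval_nat_numeral M_def)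
  finally have 2: "\<bar>cdiff h a j / a j * (1 / d j - 1 / D j)\<bar> \<le> M" .
  have 3: "\<bar>cdiff h a j / a j / d j - (l0 / q j - l1 / (1 - q j))\<bar> \<le> K"
    using singular[OF j] by (simp add: speed_sq_simps(1)[OF j])
  have "\<bar>y - t\<bar> \<le> K + 2 * M" if "x - y = u + v" "\<bar>u\<bar> \<le> M" "\<bar>v\<bar> \<le> M" "\<bar>x - t\<bar> \<le> K" for x y t u v
    using that by linarith
  from this[OF e 1 2 3] have "\<bar>cdiff h A j / A j / D j - (l0 / q j - l1 / (1 - q j))\<bar> \<le> K + 2 * M" .
  also have "\<dots> \<le> 4 * K ^ 3 + 24 * K ^ 5 * \<epsilon> / om j"
    using K_powers(1)[of 1 3] K_powers(3)[of 3] by (simp add: M_def)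
  finally show "\<bar>cdiff h A j / A j / D j - (l0 / q j - l1 / (1 - q j))\<bar> \<le> 4 * K ^ 3 + 24 * K ^ 5 * \<epsilon> / om j" .
qed

text \<open>For the exact curve the product of pole strength and squared speed is at most 3/2 by
  \<open>l_speed\<close>; perturbing the speed costs at most 1/2 more.\<close>

lemma l_le: "l0 \<le> 2 * (1 / D 0)" "l1 \<le> 2 * (1 / D J)"
proof -
  have *: "l \<le> 2 * (1 / D j)" if j: "j \<le> J" and l: "1 / K \<le> l" "l * d j \<le> 3 / 2" for l j
  proof -
    have l0: "0 < l" using l K by (smt (verit) divide_pos_pos)
    have "l * (1 / K) \<le> l * d j" using D_perturbation(3)[OF j] l0 by (intro mult_left_mono) auto
    then have "l / K \<le> 3 / 2" using l(2) by (simp only: times_divide_eq_right mult_1_right)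
    then have "l \<le> 3 / 2 * K" using K by (simp add: field_simps)
    then have "\<bar>l * (D j - d j)\<bar> \<le> 3 / 2 * K * (6 * K * \<epsilon>)"
      using D_perturbation(4)[OF j] l0 by (intro abs_mult_le) auto
    also have "\<dots> \<le> 1 / 2" using \<epsilon>_small[of 2] by (simp add: power2_eq_square algebra_simps)
    finally have "l * D j \<le> 2" using l(2) unfolding right_diff_distrib by linarith
    then show ?thesis using D_pos[OF j] by (simp add: field_simps)
  qed
  show "l0 \<le> 2 * (1 / D 0)" "l1 \<le> 2 * (1 / D J)" using l l_speed *[of 0 l0] *[of J l1] by (auto simp: speed_sq_simps)
qed

end

locale scheme_step_error = perturbed_step +
  fixes A' B' :: "nat \<Rightarrow> real"
  assumes eqA: "\<And>j. j \<in> {1..J-1} \<Longrightarrow>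
      (A' j - A j) / \<tau> = sdiff h A' j / D j - cdiff h B' j / A j * cdiff h B j / D j"
    and eqB: "\<And>j. j \<in> {1..J-1} \<Longrightarrow>
      (B' j - B j) / \<tau> = sdiff h B' j / D j + cdiff h B' j / A j * cdiff h A j / D j"
    and A'0: "A' 0 = 0" "A' J = 0"
    and bdB: "bdiff h B' 1 = h / 4 * D 0 * ((B' 0 - B 0) / \<tau>)"
      "bdiff h B' J = - (h / 4 * D J * ((B' J - B J) / \<tau>))"
begin

section \<open>The error equations with numerical coefficients\<close>

definition \<alpha>' where "\<alpha>' j = a' j - A' j"
definition \<beta>' where "\<beta>' j = b' j - B' j"

definition rho1 where "rho1 j = sdiff h a' j - cdiff h b' j / a j * cdiff h b j - d j * ((a' j - a j) / \<tau>)"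
definition rho2 where "rho2 j = sdiff h b' j + cdiff h b' j / a j * cdiff h a j - d j * ((b' j - b j) / \<tau>)"

text \<open>Subtracting the equations so that the new error keeps the numerical coefficients puts
  every coefficient difference on exact quantities. The residual thus depends on the old error and
  the consistency error, not on the new error.\<close>

definition r1 where "r1 j = (- cdiff h b' j * (cdiff h b j / a j - cdiff h B j / A j)
    - (d j - D j) * ((a' j - a j) / \<tau>) - rho1 j) / D j"
definition r2 where "r2 j = (cdiff h b' j * (cdiff h a j / a j - cdiff h A j / A j)
    - (d j - D j) * ((b' j - b j) / \<tau>) - rho2 j) / D j"

definition s0 where "s0 = (d 0 - D 0) / 4 * ((b' 0 - b 0) / \<tau>)
    + (bdiff h b' 1 - h / 4 * d 0 * ((b' 0 - b 0) / \<tau>)) / h"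
definition sJ where "sJ = (d J - D J) / 4 * ((b' J - b J) / \<tau>)
    - (bdiff h b' J + h / 4 * d J * ((b' J - b J) / \<tau>)) / h"

lemma error_equation1:
  assumes j: "j \<in> {1..J-1}"
  shows "(\<alpha>' j - \<alpha> j) / \<tau> = 1 / D j * sdiff h \<alpha>' j + - (cdiff h B j / A j / D j) * cdiff h \<beta>' j + r1 j"
proof -
  have "0 < D j" using j by (intro D_pos) auto
  moreover define w W where "w = (a' j - a j) / \<tau>" and "W = (A' j - A j) / \<tau>"
  ultimately have "D j * W = sdiff h A' j - cdiff h B' j / A j * cdiff h B j"
    using eqA[OF j] by (simp add: right_diff_distrib)
  moreover have s: "sdiff h A' j = sdiff h a' j - sdiff h \<alpha>' j" "cdiff h B' j = cdiff h b' j - cdiff h \<beta>' j"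
    by (simp_all add: \<alpha>'_def[abs_def] \<beta>'_def[abs_def] sdiff_diff cdiff_diff)
  ultimately have "D j * (w - W) = sdiff h \<alpha>' j - cdiff h B j / A j * cdiff h \<beta>' j
    + (- cdiff h b' j * (cdiff h b j / a j - cdiff h B j / A j) - (d j - D j) * w - rho1 j)"
    unfolding rho1_def w_def[symmetric] by (simp add: algebra_simps diff_divide_distrib)
  then have "w - W = (sdiff h \<alpha>' j - cdiff h B j / A j * cdiff h \<beta>' j
    + (- cdiff h b' j * (cdiff h b j / a j - cdiff h B j / A j) - (d j - D j) * w - rho1 j)) / D j"
    using \<open>0 < D j\<close> by (simp add: field_simps)
  moreover have "(\<alpha>' j - \<alpha> j) / \<tau> = w - W"
    by (simp add: \<alpha>_def \<alpha>'_def w_def W_def diff_divide_distrib)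
  ultimately show ?thesis
    unfolding r1_def w_def[symmetric] by (simp add: add_divide_distrib diff_divide_distrib)
qed

lemma error_equation2:
  assumes j: "j \<in> {1..J-1}"
  shows "(\<beta>' j - \<beta> j) / \<tau> = 1 / D j * sdiff h \<beta>' j + cdiff h A j / A j / D j * cdiff h \<beta>' j + r2 j"
proof -
  have "0 < D j" using j by (intro D_pos) auto
  moreover define w W where "w = (b' j - b j) / \<tau>" and "W = (B' j - B j) / \<tau>"
  ultimately have "D j * W = sdiff h B' j + cdiff h B' j / A j * cdiff h A j"
    using eqB[OF j] by (simp add: distrib_left)
  moreover have s: "sdiff h B' j = sdiff h b' j - sdiff h \<beta>' j" "cdiff h B' j = cdiff h b' j - cdiff h \<beta>' j"
    by (simp_all add: \<alpha>'_def[abs_def] \<beta>'_def[abs_def] sdiff_diff cdiff_diff)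
  ultimately have "D j * (w - W) = sdiff h \<beta>' j + cdiff h A j / A j * cdiff h \<beta>' j
    + (cdiff h b' j * (cdiff h a j / a j - cdiff h A j / A j) - (d j - D j) * w - rho2 j)"
    unfolding rho2_def w_def[symmetric] by (simp add: algebra_simps diff_divide_distrib)
  then have "w - W = (sdiff h \<beta>' j + cdiff h A j / A j * cdiff h \<beta>' j
    + (cdiff h b' j * (cdiff h a j / a j - cdiff h A j / A j) - (d j - D j) * w - rho2 j)) / D j"
    using \<open>0 < D j\<close> by (simp add: field_simps)
  moreover have "(\<beta>' j - \<beta> j) / \<tau> = w - W"
    by (simp add: \<beta>_def \<beta>'_def w_def W_def diff_divide_distrib)
  ultimately show ?thesis
    unfolding r2_def w_def[symmetric] by (simp add: add_divide_distrib diff_divide_distrib)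
qed

lemma error_boundary:
  "bdiff h \<beta>' 1 = h / 4 * ((\<beta>' 0 - \<beta> 0) / \<tau>) / (1 / D 0) + h * s0"
  "- bdiff h \<beta>' J = h / 4 * ((\<beta>' J - \<beta> J) / \<tau>) / (1 / D J) + h * sJ"
proof -
  have b: "bdiff h \<beta>' j = bdiff h b' j - bdiff h B' j" for j by (simp add: \<beta>'_def[abs_def] bdiff_diff)
  have v: "(\<beta>' j - \<beta> j) / \<tau> = (b' j - b j) / \<tau> - (B' j - B j) / \<tau>" for j
    by (simp add: \<beta>_def \<beta>'_def diff_divide_distrib)
  define w0 W0 wJ WJ where "w0 = (b' 0 - b 0) / \<tau>" and "W0 = (B' 0 - B 0) / \<tau>"
    and "wJ = (b' J - b J) / \<tau>" and "WJ = (B' J - B J) / \<tau>"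
  have "h * s0 = h * (d 0 - D 0) / 4 * w0 + (bdiff h b' 1 - h / 4 * d 0 * w0)"
    using h_neq by (simp add: s0_def w0_def[symmetric] distrib_left)
  then show "bdiff h \<beta>' 1 = h / 4 * ((\<beta>' 0 - \<beta> 0) / \<tau>) / (1 / D 0) + h * s0"
    unfolding b v bdB w0_def[symmetric] W0_def[symmetric] by (simp add: algebra_simps) argo
  have "h * sJ = h * (d J - D J) / 4 * wJ - (bdiff h b' J + h / 4 * d J * wJ)"
    using h_neq by (simp add: sJ_def wJ_def[symmetric] right_diff_distrib)
  then show "- bdiff h \<beta>' J = h / 4 * ((\<beta>' J - \<beta> J) / \<tau>) / (1 / D J) + h * sJ"
    unfolding b v bdB wJ_def[symmetric] WJ_def[symmetric] by (simp add: algebra_simps) argo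
qed

text \<open>14000 = 2 * 6800 + 400, the last summand covering the two boundary residuals.\<close>

lemma F_bound: "F r1 r2 s0 sJ \<le> 14000 * K ^ 10 * (S1 \<alpha> + S1 \<beta> + S\<^sup>2)"
proof -
  have "\<bar>r1 j\<bar> \<le> 10 * K ^ 5 * (X j + S)" "\<bar>r2 j\<bar> \<le> 10 * K ^ 5 * (X j + S)" if j: "j \<in> {1..J-1}" for j
  proof -
    have jJ: "j \<le> J" using j by auto
    show "\<bar>r1 j\<bar> \<le> 10 * K ^ 5 * (X j + S)" unfolding r1_def
      using res1[OF j] cb'[OF j] velocity[OF jJ] cb_K[OF j]
      by (intro remainder_bound[OF j, where \<delta>="cdiff h \<beta> j"] cdiff_A) (auto simp: rho1_def speed_sq_simps(1)[OF j])
    show "\<bar>r2 j\<bar> \<le> 10 * K ^ 5 * (X j + S)" unfolding r2_def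
      using res2[OF j] cb'[OF j] velocity[OF jJ] ca[OF j]
      by (intro remainder_bound[OF j, where \<delta>="cdiff h \<alpha> j"] cdiff_A) (auto simp: rho2_def speed_sq_simps(1)[OF j])
  qed
  then have "h * (\<Sum>j=1..J-1. (r1 j)\<^sup>2) \<le> 6800 * K ^ 10 * (S1 \<alpha> + S1 \<beta> + S\<^sup>2)"
    "h * (\<Sum>j=1..J-1. (r2 j)\<^sup>2) \<le> 6800 * K ^ 10 * (S1 \<alpha> + S1 \<beta> + S\<^sup>2)"
    by (intro remainder_sum; simp)+
  moreover have "h * (s0\<^sup>2 + sJ\<^sup>2) \<le> 3 * K ^ 4 * (S1 \<alpha> + S1 \<beta> + S\<^sup>2)"
  proof (rule boundary_remainder_sum)
    have *: "\<bar>(d j - D j) / 4 * w + \<rho> / h\<bar> \<le> K\<^sup>2 * (x + S)"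
      if "\<bar>d j - D j\<bar> \<le> 3 * K * x" "\<bar>w\<bar> \<le> K" "\<bar>\<rho>\<bar> \<le> h * S" "0 \<le> x" for j x w \<rho>
    proof -
      define y where "y = (d j - D j) / 4 * w"
      have "\<bar>y\<bar> \<le> 3 * K * x / 4 * K" unfolding y_def using that by (intro abs_mult_le) auto
      also have "\<dots> = 3 / 4 * (K\<^sup>2 * x)" by (simp add: power2_eq_square)
      finally have "\<bar>y\<bar> \<le> 3 / 4 * (K\<^sup>2 * x)" .
      moreover have "0 \<le> K\<^sup>2 * x" using that by auto
      moreover have "\<bar>\<rho> / h\<bar> \<le> h * S / h" using that h_pos by (intro abs_divide_le) auto
      moreover have "h * S / h = S" using h_neq by simp
      moreover have "1 * S \<le> K\<^sup>2 * S" using K_powers(4)[of 2] S by (intro mult_right_mono) auto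
      ultimately show ?thesis unfolding distrib_left y_def[symmetric] by linarith
    qed
    show "\<bar>s0\<bar> \<le> K\<^sup>2 * (\<bar>bdiff h \<alpha> 1\<bar> + \<bar>bdiff h \<beta> 1\<bar> + S)"
      unfolding s0_def using boundary_perturbation(1) velocity(2)[of 0] res_bd(1)
      by (intro *) (auto simp: speed_sq_simps)
    have "\<bar>(d J - D J) / 4 * ((b' J - b J) / \<tau>) + - (bdiff h b' J + h / 4 * d J * ((b' J - b J) / \<tau>)) / h\<bar>
        \<le> K\<^sup>2 * ((\<bar>bdiff h \<alpha> J\<bar> + \<bar>bdiff h \<beta> J\<bar>) + S)"
      using boundary_perturbation(2) velocity(2)[of J] res_bd(2)
      by (intro *) (auto simp: speed_sq_simps)
    then show "\<bar>sJ\<bar> \<le> K\<^sup>2 * (\<bar>bdiff h \<alpha> J\<bar> + \<bar>bdiff h \<beta> J\<bar> + S)"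
      unfolding sJ_def minus_divide_left[symmetric] by simp
  qed
  moreover have "3 * K ^ 4 * (S1 \<alpha> + S1 \<beta> + S\<^sup>2) \<le> 400 * K ^ 10 * (S1 \<alpha> + S1 \<beta> + S\<^sup>2)"
  proof (rule mult_right_mono)
    show "3 * K ^ 4 \<le> 400 * K ^ 10" using K_powers(1)[of 4 10] K_powers(3)[of 10] by linarith
  qed (use S1_nonneg in auto)
  ultimately show ?thesis unfolding F_def by argo
qed

definition Y where "Y = S2 \<alpha>' + S2 \<beta>' + Z \<beta>' + G \<beta>'"

text \<open>The value of \<mu> comes from \<open>D j \<le> 3 * K^2\<close>, those of
  \<open>L\<close> and \<eta> from \<open>coefficient_bounds\<close>. The factor
  \<open>4 / \<mu> + 8 * L\<close>, at most \<open>44 * K ^ 3\<close>, times the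
  \<open>14000 * K ^ 10\<close> of \<open>F_bound\<close> gives \<open>616000 * K ^ 13\<close>,
  rounded up.\<close>

theorem step_energy_estimate:
  "(S1 \<alpha>' + S1 \<beta>') - (S1 \<alpha> + S1 \<beta>) + \<tau> / (18 * K\<^sup>2) * Y
    \<le> \<tau> * (10 ^ 6 * K ^ 13) * (S1 \<alpha>' + S1 \<beta>' + (S1 \<alpha> + S1 \<beta>) + S\<^sup>2)"
proof -
  define \<mu> L \<eta> where "\<mu> = 1 / (3 * K\<^sup>2)" and "L = 4 * K ^ 3" and "\<eta> = 24 * K ^ 5 * \<epsilon>"
  define P where "P = S1 \<alpha> + S1 \<beta> + S\<^sup>2"
  have P: "0 \<le> P" using S1_nonneg by (simp add: P_def)
  \<comment> \<open>Origin of the threshold for \<epsilon>: \<eta> \<le> \<mu> / 12 means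
    \<open>24 * 36 * \<epsilon> * K ^ 7 \<le> 1\<close>, and 24 * 36 = 864.\<close>
  have "\<eta> * K\<^sup>2 \<le> 24 / 1000"
    using \<epsilon>_small[of 7] by (simp add: \<eta>_def eval_nat_numeral algebra_simps)
  then have \<eta>: "\<eta> \<le> \<mu> / 12" using K by (simp add: \<mu>_def field_simps)
  have "1 \<le> K\<^sup>2" using K_powers(4) .
  then have \<mu>K: "\<mu> \<le> 1 / K" using K K_powers(1)[of 1 2] by (simp add: \<mu>_def field_simps)
  have LK: "2 * K \<le> L" using K_powers(1)[of 1 3] K_powers(3)[of 3] unfolding L_def by simp
  have "(S1 \<alpha>' + S1 \<beta>') - (S1 \<alpha> + S1 \<beta>) + \<tau> * (\<mu> / 6) * (S2 \<alpha>' + S2 \<beta>' + Z \<beta>' + G \<beta>')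
    \<le> \<tau> * (8 * L\<^sup>2 / \<mu> * S1 \<beta>' + (4 / \<mu> + 8 * L) * F r1 r2 s0 sJ)"
  proof (rule linear_energy_estimate[where D="\<lambda>j. 1 / D j" and \<eta>=\<eta> and ?l0.0=l0 and ?l1.0=l1,
        OF _ _ _ _ _ error_equation1 error_equation2 error_boundary])
    show "\<mu> \<le> 1 / D j" "1 / D j \<le> L" if "j \<le> J" for j
      using inverse_D[OF that] LK by (auto simp: \<mu>_def)
    show "\<bar>- (cdiff h B j / A j / D j)\<bar> \<le> L + \<eta> / om j"
      "\<bar>cdiff h A j / A j / D j - (l0 / q j - l1 / (1 - q j))\<bar> \<le> L + \<eta> / om j" if "j \<in> {1..J-1}" for j
      using coefficient_bounds[OF that] by (simp_all add: L_def \<eta>_def)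
    show "\<mu> \<le> l0" "\<mu> \<le> l1" using \<mu>K l by auto
  qed (use \<tau> K \<epsilon> \<eta> l_le dirichlet AB0 A'0 in \<open>auto simp: \<mu>_def L_def \<eta>_def \<alpha>_def \<alpha>'_def\<close>)
  also have "\<dots> \<le> \<tau> * (10 ^ 6 * K ^ 13 * S1 \<beta>' + 10 ^ 6 * K ^ 13 * P)"
  proof (intro mult_left_mono add_mono)
    have "8 * L\<^sup>2 / \<mu> * S1 \<beta>' = 384 * K ^ 8 * S1 \<beta>'"
      by (simp add: L_def \<mu>_def power_mult_distrib flip: power_mult power_add)
    also have "\<dots> \<le> 10 ^ 6 * K ^ 13 * S1 \<beta>'"
      using K_powers(1)[of 8 13] K_powers(3)[of 8] S1_nonneg by (intro mult_right_mono mult_mono) auto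
    finally show "8 * L\<^sup>2 / \<mu> * S1 \<beta>' \<le> 10 ^ 6 * K ^ 13 * S1 \<beta>'" .
    have "(4 / \<mu> + 8 * L) * F r1 r2 s0 sJ \<le> (44 * K ^ 3) * (14000 * K ^ 10 * P)"
    proof (intro mult_mono)
      show "4 / \<mu> + 8 * L \<le> 44 * K ^ 3" using K_powers(1)[of 2 3] by (simp add: \<mu>_def L_def)
      show "0 \<le> F r1 r2 s0 sJ" using h_pos by (auto simp: F_def intro!: add_nonneg_nonneg mult_nonneg_nonneg sum_nonneg)
    qed (use F_bound K in \<open>auto simp: P_def\<close>)
    also have "\<dots> = 616000 * K ^ 13 * P" by (simp flip: power_add)
    also have "\<dots> \<le> 10 ^ 6 * K ^ 13 * P" using P K_powers(3)[of 13] by (intro mult_right_mono) auto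
    finally show "(4 / \<mu> + 8 * L) * F r1 r2 s0 sJ \<le> 10 ^ 6 * K ^ 13 * P" .
  qed (use \<tau> in auto)
  also have "\<dots> \<le> \<tau> * (10 ^ 6 * K ^ 13 * (S1 \<alpha>' + S1 \<beta>') + 10 ^ 6 * K ^ 13 * P)"
    using \<tau> K S1_nonneg[of \<alpha>'] by (intro mult_left_mono add_right_mono) auto
  finally show ?thesis by (simp add: P_def Y_def \<mu>_def distrib_left mult.assoc)
qed

theorem step_velocity_estimate:
  "h * (\<Sum>j=1..J-1. ((\<alpha>' j - \<alpha> j) / \<tau>)\<^sup>2 + ((\<beta>' j - \<beta> j) / \<tau>)\<^sup>2)
      + h * ((\<beta>' 0 - \<beta> 0) / \<tau>)\<^sup>2 + h * ((\<beta>' J - \<beta> J) / \<tau>)\<^sup>2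
    \<le> 10 ^ 8 * K ^ 16 * (Y + (S1 \<alpha> + S1 \<beta>) + S\<^sup>2)"
proof -
  define L \<eta> where "L = 4 * K ^ 3" and "\<eta> = 24 * K ^ 5 * \<epsilon>"
  define P where "P = S1 \<alpha> + S1 \<beta> + S\<^sup>2"
  have P: "0 \<le> P" using S1_nonneg by (simp add: P_def)
  have Y: "0 \<le> Y" using S2_nonneg Z_nonneg G_nonneg by (simp add: Y_def)
  have \<eta>: "\<eta> \<le> L" using \<epsilon>_small[of 5] K_powers(4)[of 3] unfolding \<eta>_def L_def by (simp add: mult.commute)
  have LK: "2 * K \<le> L" using K_powers(1)[of 1 3] K_powers(3)[of 3] unfolding L_def by simp
  have "h * (\<Sum>j=1..J-1. ((\<alpha>' j - \<alpha> j) / \<tau>)\<^sup>2 + ((\<beta>' j - \<beta> j) / \<tau>)\<^sup>2)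
      + h * ((\<beta>' 0 - \<beta> 0) / \<tau>)\<^sup>2 + h * ((\<beta>' J - \<beta> J) / \<tau>)\<^sup>2
    \<le> (3 + 96 * L\<^sup>2) * (S2 \<alpha>' + S2 \<beta>' + Z \<beta>' + G \<beta>' + F r1 r2 s0 sJ)"
  proof (rule velocity_estimate[where D="\<lambda>j. 1 / D j" and \<eta>=\<eta> and ?l0.0=l0 and ?l1.0=l1,
        OF _ _ _ _ error_equation1 error_equation2 error_boundary])
    show "0 < 1 / D j" "1 / D j \<le> L" if "j \<le> J" for j
      using inverse_D[OF that] LK D_pos[OF that] by auto
    show "\<bar>- (cdiff h B j / A j / D j)\<bar> \<le> L + \<eta> / om j"
      "\<bar>cdiff h A j / A j / D j - (l0 / q j - l1 / (1 - q j))\<bar> \<le> L + \<eta> / om j" if "j \<in> {1..J-1}" for j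
      using coefficient_bounds[OF that] by (simp_all add: L_def \<eta>_def)
    have "0 \<le> 1 / K" using K by simp
    then show "0 \<le> l0" "0 \<le> l1" using l by linarith+
  qed (use \<tau> K \<epsilon> \<eta> l_le dirichlet AB0 A'0 in \<open>auto simp: L_def \<eta>_def \<alpha>_def \<alpha>'_def\<close>)
  also have "\<dots> \<le> (1600 * K ^ 6) * (14000 * K ^ 10 * (Y + P))"
  proof (intro mult_mono)
    show "3 + 96 * L\<^sup>2 \<le> 1600 * K ^ 6" using K_powers(4)[of 6]
      by (simp add: L_def power_mult_distrib flip: power_mult)
    have "1 * Y \<le> 14000 * K ^ 10 * Y" using Y K_powers(4)[of 10] by (intro mult_right_mono) auto
    then show "S2 \<alpha>' + S2 \<beta>' + Z \<beta>' + G \<beta>' + F r1 r2 s0 sJ \<le> 14000 * K ^ 10 * (Y + P)"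
      using F_bound unfolding P_def[symmetric] Y_def[symmetric] by (simp add: distrib_left)
    show "0 \<le> S2 \<alpha>' + S2 \<beta>' + Z \<beta>' + G \<beta>' + F r1 r2 s0 sJ"
      using h_pos Y unfolding Y_def by (auto simp: F_def intro!: add_nonneg_nonneg mult_nonneg_nonneg sum_nonneg)
  qed (use K in auto)
  also have "\<dots> = 22400000 * K ^ 16 * (Y + P)" by (simp flip: power_add)
  also have "\<dots> \<le> 10 ^ 8 * K ^ 16 * (Y + P)" using P Y K_powers(3)[of 16] by (intro mult_right_mono) auto
  finally show ?thesis by (simp add: P_def add.assoc)
qed

end

section \<open>Regularity of the curve at the axis\<close>

text \<open>Difference quotients pass to the limit. This turns spatial estimates of time increments
  into estimates of \<open>g\<close>, for which no spatial derivative is assumed.\<close>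

lemma derivative_bound_of_lipschitz:
  fixes f :: "real \<Rightarrow> real"
  assumes f: "(f has_real_derivative D) (at t within {0..T})" and t: "t \<in> {0..T}" "0 < T"
    and lip: "\<And>s. s \<in> {0..T} \<Longrightarrow> \<bar>f s - f t\<bar> \<le> L * \<bar>s - t\<bar>"
  shows "\<bar>D\<bar> \<le> L"
proof (rule tendsto_upperbound)
  show "((\<lambda>s. \<bar>(f s - f t) / (s - t)\<bar>) \<longlongrightarrow> \<bar>D\<bar>) (at t within {0..T})"
    using f by (intro tendsto_rabs) (simp add: has_field_derivative_iff)
  show "\<forall>\<^sub>F s in at t within {0..T}. \<bar>(f s - f t) / (s - t)\<bar> \<le> L"
    unfolding eventually_at_filter
    by (rule always_eventually) (use lip in \<open>auto simp: abs_divide divide_simps\<close>)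
  show "at t within {0..T} \<noteq> bot"
    using t by (simp add: trivial_limit_within islimpt_Icc)
qed

text \<open>\<open>f i\<close> is the \<open>i\<close>-th derivative in the first variable, \<open>g i\<close> the time derivative of \<open>f i\<close>, and
  \<open>k\<close> the second time derivative of \<open>f 0\<close>.\<close>

locale smooth_fun =
  fixes T K :: real and f g :: "nat \<Rightarrow> real \<Rightarrow> real \<Rightarrow> real" and k :: "real \<Rightarrow> real \<Rightarrow> real"
  assumes T: "0 < T" and K1: "1 \<le> K"
    and df: "\<And>i \<rho> t. i < 4 \<Longrightarrow> \<rho> \<in> {0..1} \<Longrightarrow> t \<in> {0..T} \<Longrightarrow>
      ((\<lambda>r. f i r t) has_real_derivative f (Suc i) \<rho> t) (at \<rho> within {0..1})"
    and dg: "\<And>i \<rho> t. i \<le> 2 \<Longrightarrow> \<rho> \<in> {0..1} \<Longrightarrow> t \<in> {0..T} \<Longrightarrow>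
      ((\<lambda>s. f i \<rho> s) has_real_derivative g i \<rho> t) (at t within {0..T})"
    and dk: "\<And>\<rho> t. \<rho> \<in> {0..1} \<Longrightarrow> t \<in> {0..T} \<Longrightarrow>
      ((\<lambda>s. g 0 \<rho> s) has_real_derivative k \<rho> t) (at t within {0..T})"
    and bf: "\<And>i \<rho> t. i \<le> 4 \<Longrightarrow> \<rho> \<in> {0..1} \<Longrightarrow> t \<in> {0..T} \<Longrightarrow> \<bar>f i \<rho> t\<bar> \<le> K"
    and bg: "\<And>i \<rho> t. i \<le> 2 \<Longrightarrow> \<rho> \<in> {0..1} \<Longrightarrow> t \<in> {0..T} \<Longrightarrow> \<bar>g i \<rho> t\<bar> \<le> K"
    and bk: "\<And>\<rho> t. \<rho> \<in> {0..1} \<Longrightarrow> t \<in> {0..T} \<Longrightarrow> \<bar>k \<rho> t\<bar> \<le> K"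
begin

lemma taylor:
  assumes "i + n < 4" "\<rho> \<in> {0..1}" "r \<in> {0..1}" "t \<in> {0..T}"
  shows "\<bar>f i r t - (\<Sum>m\<le>n. f (i + m) \<rho> t * (r - \<rho>) ^ m / fact m)\<bar> \<le> K * \<bar>r - \<rho>\<bar> ^ Suc n / fact n"
  using field_Taylor[of "{0..1}" n "\<lambda>m r. f (i + m) r t" K \<rho> r] assms df bf by auto

lemma taylor0: "i < 4 \<Longrightarrow> \<rho> \<in> {0..1} \<Longrightarrow> r \<in> {0..1} \<Longrightarrow> t \<in> {0..T} \<Longrightarrow>
    \<bar>f i r t - f i \<rho> t\<bar> \<le> K * \<bar>r - \<rho>\<bar>"
  using taylor[of i 0 \<rho> r t] by simp

lemma taylor1: "i < 3 \<Longrightarrow> \<rho> \<in> {0..1} \<Longrightarrow> r \<in> {0..1} \<Longrightarrow> t \<in> {0..T} \<Longrightarrow>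
    \<bar>f i r t - (f i \<rho> t + f (i + 1) \<rho> t * (r - \<rho>))\<bar> \<le> K * (r - \<rho>)\<^sup>2"
  using taylor[of i 1 \<rho> r t] by (simp add: power2_eq_square abs_mult[symmetric])

lemma taylor2: "i < 2 \<Longrightarrow> \<rho> \<in> {0..1} \<Longrightarrow> r \<in> {0..1} \<Longrightarrow> t \<in> {0..T} \<Longrightarrow>
    \<bar>f i r t - (f i \<rho> t + f (i + 1) \<rho> t * (r - \<rho>) + f (i + 2) \<rho> t * (r - \<rho>)\<^sup>2 / 2)\<bar> \<le> K * \<bar>r - \<rho>\<bar> ^ 3 / 2"
  using taylor[of i 2 \<rho> r t] by (simp add: eval_nat_numeral)

lemma taylor3: "\<rho> \<in> {0..1} \<Longrightarrow> r \<in> {0..1} \<Longrightarrow> t \<in> {0..T} \<Longrightarrow>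
    \<bar>f 0 r t - (f 0 \<rho> t + f 1 \<rho> t * (r - \<rho>) + f 2 \<rho> t * (r - \<rho>)\<^sup>2 / 2 + f 3 \<rho> t * (r - \<rho>) ^ 3 / 6)\<bar>
      \<le> K * \<bar>r - \<rho>\<bar> ^ 4 / 6"
  using taylor[of 0 3 \<rho> r t] by (simp add: eval_nat_numeral)

lemma time_lipschitz: "i \<le> 2 \<Longrightarrow> \<rho> \<in> {0..1} \<Longrightarrow> s \<in> {0..T} \<Longrightarrow> t \<in> {0..T} \<Longrightarrow> \<bar>f i \<rho> s - f i \<rho> t\<bar> \<le> K * \<bar>s - t\<bar>"
  using field_differentiable_bound[of "{0..T}" "\<lambda>s. f i \<rho> s" "\<lambda>s. g i \<rho> s" K s t] dg bg by auto

text \<open>The expansion is about the later time, where the implicit scheme takes the second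
  differences.\<close>

lemma time_taylor:
  assumes "\<rho> \<in> {0..1}" "s \<in> {0..T}" "t \<in> {0..T}" "t < s"
  shows "\<bar>(f 0 \<rho> s - f 0 \<rho> t) / (s - t) - g 0 \<rho> s\<bar> \<le> K * (s - t)"
proof -
  define F where "F i = (if i = 0 then f 0 \<rho> else if i = 1 then g 0 \<rho> else k \<rho>)" for i :: nat
  have "norm (F 0 t - (\<Sum>i\<le>1. F i s * (t - s) ^ i / fact i)) \<le> K * norm (t - s) ^ Suc 1 / fact 1"
  proof (rule field_Taylor[of "{0..T}"])
    fix i :: nat and x assume x: "x \<in> {0..T}" and "i \<le> 1"
    then consider "i = 0" | "i = 1" by linarith
    then show "(F i has_real_derivative F (Suc i) x) (at x within {0..T})"
      using dg[of 0 \<rho> x] dk[of \<rho> x] x assms(1) by cases (simp_all add: F_def)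
  next
    show "norm (F (Suc 1) x) \<le> K" if "x \<in> {0..T}" for x
      using bk[OF assms(1) that] by (simp add: F_def)
  qed (use assms in auto)
  then have "\<bar>f 0 \<rho> t - (f 0 \<rho> s + g 0 \<rho> s * (t - s))\<bar> \<le> K * (s - t) * (s - t)"
    using assms by (simp add: F_def)
  moreover have "f 0 \<rho> t - (f 0 \<rho> s + g 0 \<rho> s * (t - s)) = - ((f 0 \<rho> s - f 0 \<rho> t) / (s - t) - g 0 \<rho> s) * (s - t)"
    using assms by (simp add: field_simps)
  ultimately have "\<bar>(f 0 \<rho> s - f 0 \<rho> t) / (s - t) - g 0 \<rho> s\<bar> * (s - t) \<le> K * (s - t) * (s - t)"
    using assms by (simp add: abs_mult)
  then show ?thesis using assms by (simp add: mult_le_cancel_right)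
qed

text \<open>Mean value inequality in space for the time increment between fixed \<open>s\<close> and
  \<open>t\<close>, in place of a mixed derivative. The bound \<open>M\<close> is required only
  between \<open>e\<close> and \<rho>, so it may depend on their distance; this allows the lemma to
  be iterated.\<close>

lemma mixed_lipschitz:
  assumes i: "i < 2" and M: "0 \<le> M"
    and "\<And>r. r \<in> {0..1} \<Longrightarrow> \<bar>r - e\<bar> \<le> \<bar>\<rho> - e\<bar> \<Longrightarrow> \<bar>f (Suc i) r s - f (Suc i) r t\<bar> \<le> M"
    and "\<rho> \<in> {0..1}" "e \<in> {0..1}" "s \<in> {0..T}" "t \<in> {0..T}"
  shows "\<bar>(f i \<rho> s - f i \<rho> t) - (f i e s - f i e t)\<bar> \<le> M * \<bar>\<rho> - e\<bar>"
proof -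
  define I where "I = closed_segment e \<rho>"
  have I: "r \<in> {0..1}" "\<bar>r - e\<bar> \<le> \<bar>\<rho> - e\<bar>" if "r \<in> I" for r
    using that assms by (auto simp: I_def closed_segment_eq_real_ivl split: if_splits)
  have "norm ((f i \<rho> s - f i \<rho> t) - (f i e s - f i e t)) \<le> M * norm (\<rho> - e)"
  proof (rule field_differentiable_bound[of I "\<lambda>r. f i r s - f i r t" "\<lambda>r. f (Suc i) r s - f (Suc i) r t"])
    fix r assume r: "r \<in> I"
    have "I \<subseteq> {0..1}" using I by auto
    then show "((\<lambda>r. f i r s - f i r t) has_real_derivative f (Suc i) r s - f (Suc i) r t) (at r within I)"
      using df[of i r s] df[of i r t] i assms I(1)[OF r]
      by (intro DERIV_diff) (auto intro: DERIV_subset)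
    show "norm (f (Suc i) r s - f (Suc i) r t) \<le> M" using assms(3)[OF I[OF r]] by simp
  qed (auto simp: I_def)
  then show ?thesis by simp
qed

end

text \<open>The equation is multiplied by \<open>a\<close> and the squared speed. In this form it
  has no denominators and extends to the end points, where the boundary conditions make every term
  vanish.\<close>

locale regular_curve = A: smooth_fun T K fa ga ka + B: smooth_fun T K fb gb kb
  for T K fa ga ka fb gb kb +
  assumes pde_a: "\<And>\<rho> t. \<rho> \<in> {0..1} \<Longrightarrow> t \<in> {0<..T} \<Longrightarrow>
      fa 0 \<rho> t * (((fa 1 \<rho> t)\<^sup>2 + (fb 1 \<rho> t)\<^sup>2) * ga 0 \<rho> t - fa 2 \<rho> t) + (fb 1 \<rho> t)\<^sup>2 = 0"
    and pde_b: "\<And>\<rho> t. \<rho> \<in> {0..1} \<Longrightarrow> t \<in> {0<..T} \<Longrightarrow>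
      fa 0 \<rho> t * (((fa 1 \<rho> t)\<^sup>2 + (fb 1 \<rho> t)\<^sup>2) * gb 0 \<rho> t - fb 2 \<rho> t) - fa 1 \<rho> t * fb 1 \<rho> t = 0"
    and bc_a: "\<And>e t. e \<in> {0, 1} \<Longrightarrow> t \<in> {0..T} \<Longrightarrow> fa 0 e t = 0"
    and bc_b: "\<And>e t. e \<in> {0, 1} \<Longrightarrow> t \<in> {0..T} \<Longrightarrow> fb 1 e t = 0"
    and regular: "\<And>\<rho> t. \<rho> \<in> {0..1} \<Longrightarrow> t \<in> {0..T} \<Longrightarrow> 1 / K \<le> (fa 1 \<rho> t)\<^sup>2 + (fb 1 \<rho> t)\<^sup>2"
    and a_ge: "\<And>\<rho> t. \<rho> \<in> {0..1} \<Longrightarrow> t \<in> {0..T} \<Longrightarrow> \<rho> * (1 - \<rho>) / K \<le> fa 0 \<rho> t"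
begin

section \<open>Orders of vanishing at the axis\<close>

lemma end_mem: "e \<in> {0, 1} \<Longrightarrow> e \<in> {0..1::real}" by auto

lemma K0: "0 < K" using A.K1 by simp

lemma squares_le:
  assumes "\<rho> \<in> {0..1}" "t \<in> {0..T}"
  shows "(fa 1 \<rho> t)\<^sup>2 + (fb 1 \<rho> t)\<^sup>2 \<le> K\<^sup>2 + K\<^sup>2"
  using A.bf[of 1 \<rho> t] B.bf[of 1 \<rho> t] assms
  by (intro add_mono abs_le_square_iff[THEN iffD1]) auto

text \<open>At an end \<open>a\<close> is zero for all times, and the time increment of its slope is
  at most \<open>K * \<bar>s - t\<bar>\<close>; the mean value inequality from the end gives the
  factor \<open>\<bar>\<rho> - e\<bar>\<close>.\<close>

lemma velocity_a_end:
  assumes e: "e \<in> {0, 1}" and \<rho>: "\<rho> \<in> {0..1}" and t: "t \<in> {0..T}"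
  shows "s \<in> {0..T} \<Longrightarrow> \<bar>fa 0 \<rho> s - fa 0 \<rho> t\<bar> \<le> K * \<bar>\<rho> - e\<bar> * \<bar>s - t\<bar>"
    and "\<bar>ga 0 \<rho> t\<bar> \<le> K * \<bar>\<rho> - e\<bar>"
proof -
  show *: "\<bar>fa 0 \<rho> s - fa 0 \<rho> t\<bar> \<le> K * \<bar>\<rho> - e\<bar> * \<bar>s - t\<bar>" if s: "s \<in> {0..T}" for s
  proof -
    have "\<bar>(fa 0 \<rho> s - fa 0 \<rho> t) - (fa 0 e s - fa 0 e t)\<bar> \<le> (K * \<bar>s - t\<bar>) * \<bar>\<rho> - e\<bar>"
    proof (rule A.mixed_lipschitz)
      show "\<bar>fa (Suc 0) r s - fa (Suc 0) r t\<bar> \<le> K * \<bar>s - t\<bar>" if "r \<in> {0..1}" for r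
        using A.time_lipschitz[of "Suc 0" r s t] that s t by simp
    qed (use K0 \<rho> end_mem[OF e] s t in simp_all)
    then show ?thesis unfolding bc_a[OF e s] bc_a[OF e t] by (simp only: diff_zero diff_self mult.assoc mult.commute mult.left_commute)
  qed
  show "\<bar>ga 0 \<rho> t\<bar> \<le> K * \<bar>\<rho> - e\<bar>"
  proof (rule derivative_bound_of_lipschitz[where f="fa 0 \<rho>"])
    show "(fa 0 \<rho> has_real_derivative ga 0 \<rho> t) (at t within {0..T})" using A.dg[of 0 \<rho> t] \<rho> t by simp
  qed (use * t A.T in auto)
qed

text \<open>Two applications of \<open>mixed_lipschitz\<close>: since \<open>fb 1\<close> vanishes
  at the end, its time increment is linear in the distance, and one more integration makes that of
  \<open>fb 0\<close> quadratic apart from its end value.\<close>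

lemma velocity_b_end:
  assumes e: "e \<in> {0, 1}" and \<rho>: "\<rho> \<in> {0..1}" and t: "t \<in> {0..T}"
  shows "\<bar>gb 0 \<rho> t - gb 0 e t\<bar> \<le> K * (\<rho> - e)\<^sup>2"
proof (rule derivative_bound_of_lipschitz[where f="\<lambda>t. fb 0 \<rho> t - fb 0 e t"])
  show "((\<lambda>t. fb 0 \<rho> t - fb 0 e t) has_real_derivative gb 0 \<rho> t - gb 0 e t) (at t within {0..T})"
    using end_mem[OF e] \<rho> t by (intro DERIV_diff B.dg) auto
  fix s assume s: "s \<in> {0..T}"
  have 1: "\<bar>fb 1 r s - fb 1 r t\<bar> \<le> K * \<bar>s - t\<bar> * \<bar>r - e\<bar>" if r: "r \<in> {0..1}" for r
  proof -
    have "\<bar>(fb 1 r s - fb 1 r t) - (fb 1 e s - fb 1 e t)\<bar> \<le> (K * \<bar>s - t\<bar>) * \<bar>r - e\<bar>"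
    proof (rule B.mixed_lipschitz)
      show "\<bar>fb (Suc 1) r s - fb (Suc 1) r t\<bar> \<le> K * \<bar>s - t\<bar>" if "r \<in> {0..1}" for r
        using B.time_lipschitz[of "Suc 1" r s t] that s t by simp
    qed (use K0 r end_mem[OF e] s t in simp_all)
    then show ?thesis using bc_b[OF e s] bc_b[OF e t] by simp
  qed
  have "\<bar>(fb 0 \<rho> s - fb 0 \<rho> t) - (fb 0 e s - fb 0 e t)\<bar> \<le> (K * \<bar>s - t\<bar> * \<bar>\<rho> - e\<bar>) * \<bar>\<rho> - e\<bar>"
  proof (rule B.mixed_lipschitz)
    fix r :: real assume r: "r \<in> {0..1}" "\<bar>r - e\<bar> \<le> \<bar>\<rho> - e\<bar>"
    have "\<bar>fb 1 r s - fb 1 r t\<bar> \<le> K * \<bar>s - t\<bar> * \<bar>\<rho> - e\<bar>"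
      using 1[OF r(1)] by (rule order_trans) (use r(2) K0 in \<open>simp add: mult_left_mono\<close>)
    then show "\<bar>fb (Suc 0) r s - fb (Suc 0) r t\<bar> \<le> K * \<bar>s - t\<bar> * \<bar>\<rho> - e\<bar>" by simp
  qed (use end_mem[OF e] \<rho> t s K0 in auto)
  moreover have "K * \<bar>s - t\<bar> * \<bar>\<rho> - e\<bar> * \<bar>\<rho> - e\<bar> = K * (\<rho> - e)\<^sup>2 * \<bar>s - t\<bar>"
    by (simp add: power2_eq_square mult.assoc)
  moreover have "(fb 0 \<rho> s - fb 0 \<rho> t) - (fb 0 e s - fb 0 e t) = fb 0 \<rho> s - fb 0 e s - (fb 0 \<rho> t - fb 0 e t)"
    by simp
  ultimately show "\<bar>fb 0 \<rho> s - fb 0 e s - (fb 0 \<rho> t - fb 0 e t)\<bar> \<le> K * (\<rho> - e)\<^sup>2 * \<bar>s - t\<bar>" by (simp only:)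
qed (use t A.T in auto)

lemma fb1_end: "e \<in> {0, 1} \<Longrightarrow> \<rho> \<in> {0..1} \<Longrightarrow> t \<in> {0..T} \<Longrightarrow> \<bar>fb 1 \<rho> t\<bar> \<le> K * \<bar>\<rho> - e\<bar>"
  using B.taylor0[of 1 e \<rho> t] bc_b end_mem by auto

lemma fa0_end_ge:
  assumes "e \<in> {0, 1}" "\<rho> \<in> {0..1}" "t \<in> {0..T}" "\<bar>\<rho> - e\<bar> \<le> 1/2"
  shows "\<bar>\<rho> - e\<bar> / (2 * K) \<le> fa 0 \<rho> t"
proof -
  have "\<bar>\<rho> - e\<bar> * (1/2) \<le> \<bar>\<rho> - e\<bar> * (1 - \<bar>\<rho> - e\<bar>)" using assms by (intro mult_left_mono) auto
  also have "\<dots> = \<rho> * (1 - \<rho>)" using assms by auto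
  finally have "\<bar>\<rho> - e\<bar> * (1/2) / K \<le> \<rho> * (1 - \<rho>) / K" using K0 by (intro divide_right_mono) auto
  then show ?thesis using a_ge[of \<rho> t] assms by simp
qed

text \<open>The factor \<open>1 - 2 * e\<close> is the inward direction, 1 at \<open>e = 0\<close>
  and -1 at \<open>e = 1\<close>; with it both ends share one proof.\<close>

lemma inner_points:
  assumes "e \<in> {0, 1}" "0 < s" "s \<le> 1 / 2"
  obtains \<rho> :: real where "\<rho> \<in> {0..1}" "\<bar>\<rho> - e\<bar> = s" "(\<rho> - e)\<^sup>2 = s\<^sup>2" "\<rho> - e = (1 - 2 * e) * s"
  using assms that[of "e + (1 - 2 * e) * s"] by auto

lemma zero_if_small:
  assumes "\<And>s. 0 < s \<Longrightarrow> s \<le> 1 / 2 \<Longrightarrow> \<bar>y\<bar> \<le> C * s" and C: "0 < C"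
  shows "y = (0::real)"
proof (rule ccontr)
  assume y: "y \<noteq> 0"
  define s where "s = min (1/2) (\<bar>y\<bar> / (2 * C))"
  have "C * s \<le> C * (\<bar>y\<bar> / (2 * C))" using C by (intro mult_left_mono) (auto simp: s_def)
  then have "C * s \<le> \<bar>y\<bar> / 2" using C by simp
  moreover have "0 < s" "s \<le> 1 / 2" using y C by (auto simp: s_def)
  ultimately show False using assms(1)[of s] y by simp
qed

text \<open>In the first equation \<open>(fb 1)^2\<close> is quadratic in the distance
  \<open>s\<close> to the end, while \<open>fa 0\<close> is at least \<open>s / (2 * K)\<close>; so
  the bracket is \<open>O(s)\<close>. As \<open>ga 0\<close> is \<open>O(s)\<close> too, so is
  \<open>fa 2\<close>.\<close>

lemma fa2_end:
  assumes e: "e \<in> {0, 1}" and t: "t \<in> {0<..T}"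
  shows "fa 2 e t = 0"
proof -
  have t': "t \<in> {0..T}" using t by auto
  have bound: "\<bar>fa 2 e t\<bar> \<le> 10 * K ^ 3 * s" if s: "0 < s" "s \<le> 1 / 2" for s
  proof -
    obtain \<rho> where \<rho>: "\<rho> \<in> {0..1}" "\<bar>\<rho> - e\<bar> = s" using inner_points[OF e s] by metis
    define F where "F = ((fa 1 \<rho> t)\<^sup>2 + (fb 1 \<rho> t)\<^sup>2) * ga 0 \<rho> t - fa 2 \<rho> t"
    have "\<bar>fb 1 \<rho> t\<bar> \<le> K * s" using fb1_end[OF e \<rho>(1) t'] \<rho> by simp
    then have "(fb 1 \<rho> t)\<^sup>2 \<le> (K * s)\<^sup>2" by (metis abs_ge_zero power2_abs power_mono)
    moreover have "s / (2 * K) \<le> fa 0 \<rho> t" using fa0_end_ge[OF e \<rho>(1) t'] \<rho> s by simp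
    then have "s / (2 * K) * \<bar>F\<bar> \<le> fa 0 \<rho> t * \<bar>F\<bar>" by (intro mult_right_mono) auto
    moreover have "0 \<le> fa 0 \<rho> t" by (rule order_trans[OF _ \<open>s / (2 * K) \<le> fa 0 \<rho> t\<close>]) (use s K0 in simp)
    then have "fa 0 \<rho> t * \<bar>F\<bar> = \<bar>fa 0 \<rho> t * F\<bar>" by (simp add: abs_mult)
    moreover have "\<bar>fa 0 \<rho> t * F\<bar> = (fb 1 \<rho> t)\<^sup>2"
    proof -
      have "fa 0 \<rho> t * F = - (fb 1 \<rho> t)\<^sup>2" using pde_a[OF \<rho>(1) t] unfolding F_def[symmetric] by linarith
      then show ?thesis by simp
    qed
    ultimately have "s / (2 * K) * \<bar>F\<bar> \<le> (K * s)\<^sup>2" by linarith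
    then have "\<bar>F\<bar> \<le> 2 * K ^ 3 * s" using s K0 by (simp add: field_simps eval_nat_numeral)
    moreover have "\<bar>((fa 1 \<rho> t)\<^sup>2 + (fb 1 \<rho> t)\<^sup>2) * ga 0 \<rho> t\<bar> \<le> (K\<^sup>2 + K\<^sup>2) * (K * s)"
      unfolding abs_mult
    proof (intro mult_mono)
      show "\<bar>(fa 1 \<rho> t)\<^sup>2 + (fb 1 \<rho> t)\<^sup>2\<bar> \<le> K\<^sup>2 + K\<^sup>2"
        using squares_le[OF \<rho>(1) t'] by simp
      show "\<bar>ga 0 \<rho> t\<bar> \<le> K * s" using velocity_a_end(2)[OF e \<rho>(1) t'] \<rho> by simp
    qed auto
    moreover have "(K\<^sup>2 + K\<^sup>2) * (K * s) = 2 * K ^ 3 * s" by (simp add: eval_nat_numeral)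
    moreover have "\<bar>fa 2 \<rho> t - fa 2 e t\<bar> \<le> K * s" using A.taylor0[of 2 e \<rho> t] end_mem[OF e] \<rho> t' by simp
    moreover have "K * s \<le> K ^ 3 * s" using A.K1 s power_increasing[of 1 3 K] by (intro mult_right_mono) auto
    ultimately show ?thesis unfolding F_def by linarith
  qed
  show ?thesis by (rule zero_if_small[OF bound]) (use K0 in auto)
qed

lemma regular_end:
  assumes "e \<in> {0, 1}" "t \<in> {0..T}"
  shows "1 / K \<le> (fa 1 e t)\<^sup>2" "fa 1 e t \<noteq> 0" "(fa 1 e t)\<^sup>2 \<le> K\<^sup>2"
proof -
  show "1 / K \<le> (fa 1 e t)\<^sup>2" using regular[of e t] bc_b[of e t] end_mem assms by simp
  then show "fa 1 e t \<noteq> 0" using K0 by (auto simp: field_simps)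
  show "(fa 1 e t)\<^sup>2 \<le> K\<^sup>2"
    using A.bf[of 1 e t] end_mem assms by (intro abs_le_square_iff[THEN iffD1]) auto
qed

text \<open>Comparing the expansions of both sides of the second equation at an end point, where it is singular.\<close>

lemma fb_end:
  assumes e: "e \<in> {0, 1}" and t: "t \<in> {0<..T}"
  shows "2 * fb 2 e t = (fa 1 e t)\<^sup>2 * gb 0 e t" and "fb 3 e t = 0"
proof -
  have t': "t \<in> {0..T}" using t by auto
  note em = end_mem[OF e]
  define a1 b2 b3 F0 where "a1 = fa 1 e t" and "b2 = fb 2 e t" and "b3 = fb 3 e t"
    and "F0 = a1\<^sup>2 * gb 0 e t - b2"
  \<comment> \<open>Coefficients of \<open>s\<close> and \<open>s^2\<close> in
    \<open>a F - a_\<rho> b_\<rho>\<close>, from \<open>a = a1 r + O(r^3)\<close>,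
    \<open>F = F0 - b3 r + O(r^2)\<close> and \<open>b_\<rho> = b2 r + b3 r^2 / 2 + O(r^3)\<close>.
    The remainder is cubic, so both must vanish.\<close>
  define u v where "u = a1 * (F0 - b2) * (1 - 2 * e)" and "v = - (3 / 2) * (a1 * b3)"
  have bound: "\<bar>u * s + v * s\<^sup>2\<bar> \<le> 8 * K ^ 4 * s ^ 3" if s: "0 < s" "s \<le> 1 / 2" for s
  proof -
    obtain \<rho> where \<rho>: "\<rho> \<in> {0..1}" "\<bar>\<rho> - e\<bar> = s" "(\<rho> - e)\<^sup>2 = s\<^sup>2" "\<rho> - e = (1 - 2 * e) * s"
      using inner_points[OF e s] by metis
    define r where "r = \<rho> - e"
    have r: "\<bar>r\<bar> = s" "r\<^sup>2 = s\<^sup>2" using \<rho> by (simp_all add: r_def)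
    define e1 where "e1 = fa 0 \<rho> t - a1 * r"
    define e3 where "e3 = fa 1 \<rho> t - a1"
    define e4 where "e4 = fb 1 \<rho> t - (b2 * r + b3 * r\<^sup>2 / 2)"
    define e5 where "e5 = fb 2 \<rho> t - (b2 + b3 * r)"
    define e6 where "e6 = gb 0 \<rho> t - gb 0 e t"
    define Q where "Q = (fa 1 \<rho> t)\<^sup>2 + (fb 1 \<rho> t)\<^sup>2"
    define F where "F = Q * gb 0 \<rho> t - fb 2 \<rho> t"
    define e2 where "e2 = F - (F0 - b3 * r)"
    \<comment> \<open>By \<open>fa2_end\<close> the expansion of \<open>a\<close> has no quadratic
      term; otherwise \<open>e1 * F\<close> would be of order \<open>s^2\<close> and hide the second
      coefficient.\<close>
    have E1: "\<bar>e1\<bar> \<le> K * s ^ 3 / 2"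
      using A.taylor2[of 0 e \<rho> t] em \<rho> t' fa2_end[OF e t] bc_a[OF e t'] by (simp add: e1_def a1_def r_def numeral_2_eq_2)
    have E3: "\<bar>e3\<bar> \<le> K * s\<^sup>2"
      using A.taylor1[of 1 e \<rho> t] em \<rho> t' fa2_end[OF e t, unfolded numeral_2_eq_2] by (simp add: e3_def a1_def)
    have n3: "1 + 2 = (3::nat)" by simp
    have "\<bar>fb 1 \<rho> t - (fb 1 e t + fb 2 e t * (\<rho> - e) + fb 3 e t * (\<rho> - e)\<^sup>2 / 2)\<bar> \<le> K * \<bar>\<rho> - e\<bar> ^ 3 / 2"
      by (rule B.taylor2[of 1 e \<rho> t, unfolded nat_1_add_1 n3, OF _ em \<rho>(1) t']) simp
    then have E4: "\<bar>e4\<bar> \<le> K * s ^ 3 / 2"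
      using bc_b[OF e t'] \<rho>(2) by (simp add: e4_def b2_def b3_def r_def)
    have E5: "\<bar>e5\<bar> \<le> K * s\<^sup>2"
      using B.taylor1[of 2 e \<rho> t] em \<rho> t' by (simp add: e5_def b2_def b3_def r_def)
    have E6: "\<bar>e6\<bar> \<le> K * s\<^sup>2" using velocity_b_end[OF e \<rho>(1) t'] \<rho> by (simp add: e6_def)
    have a1K: "\<bar>a1\<bar> \<le> K" using A.bf[of 1 e t] em t' by (simp add: a1_def)
    have gK: "\<bar>gb 0 \<rho> t\<bar> \<le> K" using B.bg[of 0 \<rho> t] \<rho> t' by simp
    have b1: "\<bar>fb 1 \<rho> t\<bar> \<le> K * s" using fb1_end[OF e \<rho>(1) t'] \<rho> by simp
    have K3: "K \<le> K ^ 3" "K\<^sup>2 = K * K" "K ^ 3 = K * K * K" "K ^ 4 = K * K * K * K"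
      using A.K1 power_increasing[of 1 3 K] by (simp_all add: eval_nat_numeral)
    have QA: "\<bar>Q - a1\<^sup>2\<bar> \<le> 3 * K\<^sup>2 * s\<^sup>2"
    proof -
      define x y where "x = e3 * (fa 1 \<rho> t + a1)" and "y = fb 1 \<rho> t * fb 1 \<rho> t"
      have "Q - a1\<^sup>2 = x + y" by (simp add: x_def y_def Q_def e3_def power2_eq_square algebra_simps)
      moreover have "\<bar>x\<bar> \<le> K * s\<^sup>2 * (2 * K)"
        unfolding x_def using E3 a1K A.bf[of 1 \<rho> t] \<rho> t' by (intro abs_mult_le) auto
      moreover have "\<bar>y\<bar> \<le> K * s * (K * s)" unfolding y_def using b1 by (intro abs_mult_le)
      moreover have "K * s\<^sup>2 * (2 * K) = 2 * (K\<^sup>2 * s\<^sup>2)" "K * s * (K * s) = K\<^sup>2 * s\<^sup>2"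
        by (simp_all add: power2_eq_square)
      ultimately show ?thesis by linarith
    qed
    have E2: "\<bar>e2\<bar> \<le> 5 * K ^ 3 * s\<^sup>2"
    proof -
      have "e2 = (Q - a1\<^sup>2) * gb 0 \<rho> t + a1\<^sup>2 * e6 - e5"
        by (simp add: e2_def F_def F0_def e6_def e5_def algebra_simps)
      moreover have "\<bar>(Q - a1\<^sup>2) * gb 0 \<rho> t\<bar> \<le> 3 * K\<^sup>2 * s\<^sup>2 * K" using QA gK by (intro abs_mult_le)
      moreover have "\<bar>a1\<^sup>2 * e6\<bar> \<le> K\<^sup>2 * (K * s\<^sup>2)"
        using E6 regular_end(3)[OF e t'] by (intro abs_mult_le) (auto simp: a1_def)
      moreover have "K * s\<^sup>2 \<le> K ^ 3 * s\<^sup>2" using K3 by (intro mult_right_mono) auto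
      moreover have "3 * K\<^sup>2 * s\<^sup>2 * K = 3 * (K ^ 3 * s\<^sup>2)" "K\<^sup>2 * (K * s\<^sup>2) = K ^ 3 * s\<^sup>2"
        by (simp_all add: K3)
      ultimately show ?thesis using E5 by linarith
    qed
    have FK: "\<bar>F\<bar> \<le> 3 * K ^ 3"
    proof -
      have "\<bar>Q * gb 0 \<rho> t\<bar> \<le> (K\<^sup>2 + K\<^sup>2) * K"
        using squares_le[OF \<rho>(1) t'] gK by (intro abs_mult_le) (auto simp: Q_def)
      moreover have "(K\<^sup>2 + K\<^sup>2) * K = 2 * K ^ 3" by (simp add: K3)
      ultimately show ?thesis using B.bf[of 2 \<rho> t] \<rho> t' K3(1) by (simp add: F_def)
    qed
    have "(a1 * r + e1) * F = (a1 + e3) * fb 1 \<rho> t"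
      using pde_b[OF \<rho>(1) t] by (simp add: F_def Q_def e1_def e3_def)
    then have "a1 * r * F + e1 * F = a1 * fb 1 \<rho> t + e3 * fb 1 \<rho> t" by (simp add: distrib_right)
    moreover have "a1 * r * F = a1 * r * (F0 - b3 * r + e2)" by (simp add: e2_def)
    moreover have "a1 * fb 1 \<rho> t = a1 * (b2 * r + b3 * r\<^sup>2 / 2 + e4)" by (simp add: e4_def)
    ultimately have "a1 * r * (F0 - b3 * r + e2) + e1 * F
        = a1 * (b2 * r + b3 * r\<^sup>2 / 2 + e4) + e3 * fb 1 \<rho> t" by argo
    then have "a1 * (F0 - b2) * r - 3 / 2 * (a1 * b3) * r\<^sup>2
        = a1 * e4 + e3 * fb 1 \<rho> t - a1 * r * e2 - e1 * F"
      by (simp add: power2_eq_square algebra_simps)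
    moreover have "a1 * (F0 - b2) * r - 3 / 2 * (a1 * b3) * r\<^sup>2 = u * s + v * s\<^sup>2"
      using \<rho>(4) r(2) by (simp add: u_def v_def r_def[symmetric] mult.assoc)
    moreover have "\<bar>a1 * e4\<bar> \<le> K * (K * s ^ 3 / 2)" using a1K E4 by (intro abs_mult_le)
    moreover have "\<bar>e3 * fb 1 \<rho> t\<bar> \<le> K * s\<^sup>2 * (K * s)" using E3 b1 by (intro abs_mult_le)
    moreover have "\<bar>a1 * r * e2\<bar> \<le> K * s * (5 * K ^ 3 * s\<^sup>2)" using a1K E2 r by (intro abs_mult_le) auto
    moreover have "\<bar>e1 * F\<bar> \<le> K * s ^ 3 / 2 * (3 * K ^ 3)" using E1 FK by (intro abs_mult_le)
    moreover have "K * (K * s ^ 3 / 2) = K\<^sup>2 * s ^ 3 / 2" "K * s\<^sup>2 * (K * s) = K\<^sup>2 * s ^ 3"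
      "K * s * (5 * K ^ 3 * s\<^sup>2) = 5 * (K ^ 4 * s ^ 3)" "K * s ^ 3 / 2 * (3 * K ^ 3) = 3 / 2 * (K ^ 4 * s ^ 3)"
      by (simp_all add: eval_nat_numeral)
    moreover have "K\<^sup>2 * s ^ 3 \<le> K ^ 4 * s ^ 3"
      using A.K1 s power_increasing[of 2 4 K] by (intro mult_right_mono) auto
    ultimately show ?thesis by linarith
  qed
  have u: "u = 0"
  proof (rule zero_if_small)
    fix s :: real assume s: "0 < s" "s \<le> 1 / 2"
    have "\<bar>u\<bar> * s = \<bar>(u * s + v * s\<^sup>2) - v * s\<^sup>2\<bar>" using s by (simp add: abs_mult)
    also have "\<dots> \<le> 8 * K ^ 4 * s ^ 3 + \<bar>v\<bar> * s\<^sup>2"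
      using bound[OF s] abs_triangle_ineq4[of "u * s + v * s\<^sup>2" "v * s\<^sup>2"] by (simp add: abs_mult)
    also have "8 * K ^ 4 * s ^ 3 \<le> 8 * K ^ 4 * s\<^sup>2" using s K0 by (intro mult_left_mono power_decreasing) auto
    finally have "\<bar>u\<bar> * s \<le> ((8 * K ^ 4 + \<bar>v\<bar>) * s) * s" by (simp add: power2_eq_square algebra_simps)
    then show "\<bar>u\<bar> \<le> (8 * K ^ 4 + \<bar>v\<bar>) * s" using s by (simp add: mult_le_cancel_right)
  qed (use K0 in \<open>auto intro: add_pos_nonneg\<close>)
  have v: "v = 0"
  proof (rule zero_if_small)
    fix s :: real assume s: "0 < s" "s \<le> 1 / 2"
    have "\<bar>v\<bar> * s\<^sup>2 \<le> (8 * K ^ 4 * s) * s\<^sup>2" using bound[OF s] u by (simp add: abs_mult eval_nat_numeral)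
    then show "\<bar>v\<bar> \<le> (8 * K ^ 4) * s" using s by (simp add: mult_le_cancel_right)
  qed (use K0 in auto)
  have "a1 \<noteq> 0" using regular_end(2)[OF e t'] by (simp add: a1_def)
  moreover have "1 - 2 * e \<noteq> 0" using e by auto
  ultimately show "2 * fb 2 e t = (fa 1 e t)\<^sup>2 * gb 0 e t" "fb 3 e t = 0"
    using u v by (auto simp: u_def v_def F0_def a1_def b2_def b3_def)
qed

end

section \<open>Truncation errors of the difference quotients\<close>

context smooth_fun
begin

context
  fixes \<rho> h t :: real
  assumes h: "0 < h" "0 \<le> \<rho> - h" "\<rho> + h \<le> 1" and t: "t \<in> {0..T}"
begin

lemma stencil_mem: "\<rho> \<in> {0..1}" "\<rho> + h \<in> {0..1}" "\<rho> - h \<in> {0..1}"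
  using h by auto

lemma central_quotient_bound: "\<bar>(f 0 (\<rho> + h) t - f 0 (\<rho> - h) t) / (2 * h)\<bar> \<le> K"
proof -
  have "\<bar>f 0 (\<rho> + h) t - f 0 (\<rho> - h) t\<bar> \<le> K * (2 * h)"
    using taylor0[of 0 "\<rho> - h" "\<rho> + h" t] stencil_mem h t by simp
  then show ?thesis using h by (simp add: abs_divide divide_le_eq)
qed

lemma central_quotient: "\<bar>(f 0 (\<rho> + h) t - f 0 (\<rho> - h) t) / (2 * h) - f 1 \<rho> t\<bar> \<le> K * h\<^sup>2"
proof -
  have "\<bar>f 0 (\<rho> + h) t - (f 0 \<rho> t + f 1 \<rho> t * h + f 2 \<rho> t * h\<^sup>2 / 2)\<bar> \<le> K * h ^ 3 / 2"
    using taylor2[of 0 \<rho> "\<rho> + h" t] stencil_mem h t by (simp add: numeral_2_eq_2)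
  moreover have "\<bar>f 0 (\<rho> - h) t - (f 0 \<rho> t - f 1 \<rho> t * h + f 2 \<rho> t * h\<^sup>2 / 2)\<bar> \<le> K * h ^ 3 / 2"
    using taylor2[of 0 \<rho> "\<rho> - h" t] stencil_mem h t by (simp add: numeral_2_eq_2)
  ultimately have "\<bar>f 0 (\<rho> + h) t - f 0 (\<rho> - h) t - 2 * (f 1 \<rho> t * h)\<bar> \<le> K * h ^ 3" by linarith
  then have "\<bar>(f 0 (\<rho> + h) t - f 0 (\<rho> - h) t - 2 * (f 1 \<rho> t * h)) / (2 * h)\<bar> \<le> K * h ^ 3 / (2 * h)"
    using h by (intro abs_divide_le) auto
  moreover have "(f 0 (\<rho> + h) t - f 0 (\<rho> - h) t) / (2 * h) - f 1 \<rho> t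
      = (f 0 (\<rho> + h) t - f 0 (\<rho> - h) t - 2 * (f 1 \<rho> t * h)) / (2 * h)"
    using h by (simp add: diff_divide_distrib)
  moreover have "K * h ^ 3 / (2 * h) = K * h\<^sup>2 / 2" using h by (simp add: eval_nat_numeral)
  moreover have "K * h\<^sup>2 / 2 \<le> K * h\<^sup>2" using K1 by simp
  ultimately show ?thesis by (metis order_trans)
qed

text \<open>The third derivative is kept instead of being bounded by \<open>K\<close>: for
  \<open>b\<close> it vanishes at the axis, and the error then gains a factor \<open>om j\<close>
  that permits division by \<open>a\<close>.\<close>

lemma central_quotient_third:
  "\<bar>(f 0 (\<rho> + h) t - f 0 (\<rho> - h) t) / (2 * h) - f 1 \<rho> t\<bar> \<le> h\<^sup>2 * (\<bar>f 3 \<rho> t\<bar> + K * h) / 6"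
proof -
  have "\<bar>f 0 (\<rho> + h) t - (f 0 \<rho> t + f 1 \<rho> t * h + f 2 \<rho> t * h\<^sup>2 / 2 + f 3 \<rho> t * h ^ 3 / 6)\<bar> \<le> K * h ^ 4 / 6"
    using taylor3[of \<rho> "\<rho> + h" t] stencil_mem h t by simp
  moreover have "\<bar>f 0 (\<rho> - h) t - (f 0 \<rho> t - f 1 \<rho> t * h + f 2 \<rho> t * h\<^sup>2 / 2 - f 3 \<rho> t * h ^ 3 / 6)\<bar> \<le> K * h ^ 4 / 6"
    using taylor3[of \<rho> "\<rho> - h" t] stencil_mem h t by simp
  ultimately have "\<bar>f 0 (\<rho> + h) t - f 0 (\<rho> - h) t - 2 * (f 1 \<rho> t * h) - f 3 \<rho> t * h ^ 3 / 3\<bar> \<le> K * h ^ 4 / 3"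
    by linarith
  moreover have "\<bar>f 3 \<rho> t * h ^ 3 / 3\<bar> = \<bar>f 3 \<rho> t\<bar> * h ^ 3 / 3" using h by (simp add: abs_mult)
  ultimately have "\<bar>f 0 (\<rho> + h) t - f 0 (\<rho> - h) t - 2 * (f 1 \<rho> t * h)\<bar> \<le> \<bar>f 3 \<rho> t\<bar> * h ^ 3 / 3 + K * h ^ 4 / 3"
    by linarith
  then have "\<bar>(f 0 (\<rho> + h) t - f 0 (\<rho> - h) t - 2 * (f 1 \<rho> t * h)) / (2 * h)\<bar>
      \<le> (\<bar>f 3 \<rho> t\<bar> * h ^ 3 / 3 + K * h ^ 4 / 3) / (2 * h)"
    using h by (intro abs_divide_le) auto
  moreover have "(f 0 (\<rho> + h) t - f 0 (\<rho> - h) t) / (2 * h) - f 1 \<rho> t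
      = (f 0 (\<rho> + h) t - f 0 (\<rho> - h) t - 2 * (f 1 \<rho> t * h)) / (2 * h)"
    using h by (simp add: diff_divide_distrib)
  moreover have "(\<bar>f 3 \<rho> t\<bar> * h ^ 3 / 3 + K * h ^ 4 / 3) / (2 * h) = h\<^sup>2 * (\<bar>f 3 \<rho> t\<bar> + K * h) / 6"
    using h by (simp add: field_simps eval_nat_numeral)
  ultimately show ?thesis by simp
qed

lemma second_quotient: "\<bar>(f 0 (\<rho> + h) t - 2 * f 0 \<rho> t + f 0 (\<rho> - h) t) / h\<^sup>2 - f 2 \<rho> t\<bar> \<le> K * h\<^sup>2"
proof -
  have "\<bar>f 0 (\<rho> + h) t - (f 0 \<rho> t + f 1 \<rho> t * h + f 2 \<rho> t * h\<^sup>2 / 2 + f 3 \<rho> t * h ^ 3 / 6)\<bar> \<le> K * h ^ 4 / 6"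
    using taylor3[of \<rho> "\<rho> + h" t] stencil_mem h t by simp
  moreover have "\<bar>f 0 (\<rho> - h) t - (f 0 \<rho> t - f 1 \<rho> t * h + f 2 \<rho> t * h\<^sup>2 / 2 - f 3 \<rho> t * h ^ 3 / 6)\<bar> \<le> K * h ^ 4 / 6"
    using taylor3[of \<rho> "\<rho> - h" t] stencil_mem h t by simp
  moreover have "0 \<le> K * h ^ 4" using K1 by simp
  ultimately have "\<bar>f 0 (\<rho> + h) t - 2 * f 0 \<rho> t + f 0 (\<rho> - h) t - f 2 \<rho> t * h\<^sup>2\<bar> \<le> K * h ^ 4"
    by linarith
  then have "\<bar>(f 0 (\<rho> + h) t - 2 * f 0 \<rho> t + f 0 (\<rho> - h) t - f 2 \<rho> t * h\<^sup>2) / h\<^sup>2\<bar> \<le> K * h ^ 4 / h\<^sup>2"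
    using h by (intro abs_divide_le) auto
  moreover have "K * h ^ 4 / h\<^sup>2 = K * h\<^sup>2" using h by (simp add: eval_nat_numeral)
  ultimately show ?thesis using h by (simp add: diff_divide_distrib)
qed

end

context
  fixes e \<rho> t :: real
  assumes e: "e \<in> {0..1}" "\<rho> \<in> {0..1}" "\<rho> \<noteq> e" and t: "t \<in> {0..T}"
begin

lemma one_sided_quotient_bound: "\<bar>(f 0 \<rho> t - f 0 e t) / (\<rho> - e)\<bar> \<le> K"
  using taylor0[of 0 e \<rho> t] e t by (simp add: abs_divide divide_le_eq)

lemma one_sided_quotient: "\<bar>(f 0 \<rho> t - f 0 e t) / (\<rho> - e) - f 1 e t\<bar> \<le> K * \<bar>\<rho> - e\<bar>"
proof -
  have *: "\<bar>f 0 \<rho> t - f 0 e t - f 1 e t * (\<rho> - e)\<bar> \<le> K * \<bar>\<rho> - e\<bar> * \<bar>\<rho> - e\<bar>"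
    using taylor1[of 0 e \<rho> t] e t by (simp add: power2_eq_square algebra_simps)
  have "(f 0 \<rho> t - f 0 e t) / (\<rho> - e) - f 1 e t = (f 0 \<rho> t - f 0 e t - f 1 e t * (\<rho> - e)) / (\<rho> - e)"
    using e by (simp add: diff_divide_distrib)
  also have "\<bar>\<dots>\<bar> \<le> K * \<bar>\<rho> - e\<bar>"
    unfolding abs_divide using e * by (simp add: pos_divide_le_eq)
  finally show ?thesis .
qed

lemma one_sided_quotient2:
  "\<bar>(f 0 \<rho> t - f 0 e t) / (\<rho> - e) - (f 1 e t + f 2 e t * (\<rho> - e) / 2)\<bar> \<le> K * (\<rho> - e)\<^sup>2"
proof -
  have *: "\<bar>f 0 \<rho> t - (f 0 e t + f 1 e t * (\<rho> - e) + f 2 e t * (\<rho> - e)\<^sup>2 / 2)\<bar> \<le> K * \<bar>\<rho> - e\<bar> ^ 3"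
  proof -
    have "0 \<le> K * \<bar>\<rho> - e\<bar> ^ 3" using K1 by simp
    then show ?thesis using taylor2[of 0 e \<rho> t] e t by (simp add: numeral_2_eq_2)
  qed
  have "(f 0 \<rho> t - f 0 e t) / (\<rho> - e) - (f 1 e t + f 2 e t * (\<rho> - e) / 2)
     = (f 0 \<rho> t - (f 0 e t + f 1 e t * (\<rho> - e) + f 2 e t * (\<rho> - e)\<^sup>2 / 2)) / (\<rho> - e)"
  proof -
    have "x / r - (p + y * r / 2) = (x - (p * r + y * r\<^sup>2 / 2)) / r" if "r \<noteq> 0" for x p y r :: real
      using that by (simp add: diff_divide_distrib add_divide_distrib power2_eq_square)
    from this[of "\<rho> - e" "f 0 \<rho> t - f 0 e t"] show ?thesis using e by (simp add: diff_diff_eq add.assoc)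
  qed
  also have "\<bar>\<dots>\<bar> \<le> K * \<bar>\<rho> - e\<bar> ^ 3 / \<bar>\<rho> - e\<bar>"
    unfolding abs_divide using e * by (intro divide_right_mono) auto
  also have "\<dots> = K * (\<rho> - e)\<^sup>2" using e by (simp add: eval_nat_numeral)
  finally show ?thesis .
qed

text \<open>For \<open>b\<close> at the axis the first and third derivatives vanish at positive
  times, so that \<open>fb 2\<close> alone determines the one-sided slope up to third order.\<close>

lemma one_sided_quotient3:
  "\<bar>(f 0 \<rho> t - f 0 e t) / (\<rho> - e) - (f 1 e t + f 2 e t * (\<rho> - e) / 2 + f 3 e t * (\<rho> - e)\<^sup>2 / 6)\<bar>
    \<le> K * \<bar>\<rho> - e\<bar> ^ 3 / 6"
proof -
  have *: "\<bar>f 0 \<rho> t - (f 0 e t + f 1 e t * (\<rho> - e) + f 2 e t * (\<rho> - e)\<^sup>2 / 2 + f 3 e t * (\<rho> - e) ^ 3 / 6)\<bar>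
      \<le> K * \<bar>\<rho> - e\<bar> ^ 4 / 6"
    using taylor3[of e \<rho> t] e t by simp
  have "(f 0 \<rho> t - f 0 e t) / (\<rho> - e) - (f 1 e t + f 2 e t * (\<rho> - e) / 2 + f 3 e t * (\<rho> - e)\<^sup>2 / 6)
     = (f 0 \<rho> t - (f 0 e t + f 1 e t * (\<rho> - e) + f 2 e t * (\<rho> - e)\<^sup>2 / 2 + f 3 e t * (\<rho> - e) ^ 3 / 6)) / (\<rho> - e)"
  proof -
    have "x / r - (p + y * r / 2 + z * r\<^sup>2 / 6) = (x - (p * r + y * r\<^sup>2 / 2 + z * r ^ 3 / 6)) / r"
      if "r \<noteq> 0" for x p y z r :: real
      using that by (simp add: diff_divide_distrib add_divide_distrib power2_eq_square power3_eq_cube)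
    from this[of "\<rho> - e" "f 0 \<rho> t - f 0 e t"] show ?thesis using e by (simp add: diff_diff_eq add.assoc)
  qed
  also have "\<bar>\<dots>\<bar> \<le> K * \<bar>\<rho> - e\<bar> ^ 4 / 6 / \<bar>\<rho> - e\<bar>"
    unfolding abs_divide using e * by (intro divide_right_mono) auto
  also have "\<dots> = K * \<bar>\<rho> - e\<bar> ^ 3 / 6" using e by (simp add: eval_nat_numeral)
  finally show ?thesis .
qed

end

end

section \<open>Consistency\<close>

lemma square_diff_le: "\<bar>x - y\<bar> \<le> m \<Longrightarrow> \<bar>x\<bar> \<le> c \<Longrightarrow> \<bar>y\<bar> \<le> c \<Longrightarrow> \<bar>x\<^sup>2 - y\<^sup>2\<bar> \<le> m * (2 * c)" for x y :: real
proof -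
  assume "\<bar>x - y\<bar> \<le> m" "\<bar>x\<bar> \<le> c" "\<bar>y\<bar> \<le> c"
  then have "\<bar>(x - y) * (x + y)\<bar> \<le> m * (2 * c)" by (intro abs_mult_le) auto
  then show ?thesis by (simp add: power2_eq_square algebra_simps)
qed

text \<open>\<open>t\<close> is the old and \<open>s\<close> the new time. Since \<open>s\<close> is
  positive even in the first step, the equation and its consequences at the ends are available at
  \<open>s\<close>. The bound \<open>small\<close> keeps the discrete speeds away from zero.\<close>

locale discretized_curve = regular_curve + grid +
  fixes t s :: real
  assumes t: "0 \<le> t" "t < s" "s \<le> T" and small: "h \<le> 1 / (8 * K ^ 3)"
begin

definition "\<tau> = s - t"
definition "xa j = fa 0 (q j) t"
definition "xb j = fb 0 (q j) t"
definition "xa' j = fa 0 (q j) s"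
definition "xb' j = fb 0 (q j) s"
definition "\<delta> = h\<^sup>2 + \<tau>"

lemma ts: "t \<in> {0..T}" "s \<in> {0..T}" "s \<in> {0<..T}" "0 < \<tau>" "\<bar>s - t\<bar> = \<tau>" "\<bar>t - s\<bar> = \<tau>"
  using t by (auto simp: \<tau>_def)

lemma \<delta>: "0 < \<delta>" "h\<^sup>2 \<le> \<delta>" "\<tau> \<le> \<delta>"
proof -
  have "0 < h\<^sup>2" using h_pos by simp
  then show "0 < \<delta>" "h\<^sup>2 \<le> \<delta>" "\<tau> \<le> \<delta>" using ts(4) unfolding \<delta>_def by linarith+
qed

lemma K_pow: "m \<le> n \<Longrightarrow> K ^ m \<le> K ^ n" "0 < K ^ n" "1 \<le> K ^ n"
  using A.K1 by (auto intro: power_increasing)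

lemma h_sq: "h\<^sup>2 \<le> h"
  using h_pos h_le by (simp add: power2_eq_square mult_left_le)

lemma small': "K ^ 3 * h \<le> 1 / 8"
proof -
  have "K ^ 3 * h \<le> K ^ 3 * (1 / (8 * K ^ 3))" using small K_pow(2)[of 3] by (intro mult_left_mono) auto
  then show ?thesis using K0 by simp
qed

lemma q_mem: "j \<le> J \<Longrightarrow> q j \<in> {0..1}"
proof -
  assume "j \<le> J"
  then have "real j * h \<le> real J * h" using h_pos by (intro mult_right_mono) auto
  then show ?thesis unfolding Jh using h_pos by (simp add: q_def)
qed

lemma stencil:
  assumes "j \<in> {1..J-1}"
  shows "0 \<le> q j - h" "q j + h \<le> 1" "q (j + 1) = q j + h" "q (j - 1) = q j - h" "q j \<in> {0..1}"
proof -
  show "0 \<le> q j - h" "q j + h \<le> 1" using q_bounds[OF assms] by linarith+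
  show "q (j + 1) = q j + h" by (simp add: q_def distrib_right)
  have "real (j - 1) = real j - 1" using assms by (subst of_nat_diff) auto
  then show "q (j - 1) = q j - h" by (simp add: q_def left_diff_distrib)
  show "q j \<in> {0..1}" using assms by (intro q_mem) auto
qed

lemma nearest_end:
  assumes "j \<in> {1..J-1}"
  obtains e where "e \<in> {0, 1}" "\<bar>q j - e\<bar> \<le> 1 / 2" "\<bar>q j - e\<bar> \<le> 2 * om j" "h \<le> \<bar>q j - e\<bar>"
proof (cases "q j \<le> 1 / 2")
  case True
  then have "q j * (1/2) \<le> q j * (1 - q j)" using q_pos[OF assms] by (intro mult_left_mono) auto
  then show ?thesis using that[of 0] q_bounds[OF assms] q_pos[OF assms] True by (auto simp: om_def)
next
  case False
  then have "(1/2) * (1 - q j) \<le> q j * (1 - q j)" using q_pos[OF assms] by (intro mult_right_mono) auto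
  then show ?thesis using that[of 1] q_bounds[OF assms] q_pos[OF assms] False by (auto simp: om_def)
qed

lemma cdiff_eqs:
  assumes "j \<in> {1..J-1}"
  shows "cdiff h xa j = (fa 0 (q j + h) t - fa 0 (q j - h) t) / (2 * h)"
    "cdiff h xb j = (fb 0 (q j + h) t - fb 0 (q j - h) t) / (2 * h)"
    "cdiff h xa' j = (fa 0 (q j + h) s - fa 0 (q j - h) s) / (2 * h)"
    "cdiff h xb' j = (fb 0 (q j + h) s - fb 0 (q j - h) s) / (2 * h)"
  unfolding cdiff_def xa_def xb_def xa'_def xb'_def stencil(3,4)[OF assms] by simp_all

lemma velocity_le:
  assumes "\<rho> \<in> {0..1}"
  shows "\<bar>(fa 0 \<rho> s - fa 0 \<rho> t) / \<tau>\<bar> \<le> K" "\<bar>(fb 0 \<rho> s - fb 0 \<rho> t) / \<tau>\<bar> \<le> K"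
proof -
  have "\<bar>fa 0 \<rho> s - fa 0 \<rho> t\<bar> \<le> K * \<tau>" "\<bar>fb 0 \<rho> s - fb 0 \<rho> t\<bar> \<le> K * \<tau>"
    using A.time_lipschitz[of 0 \<rho> s t] B.time_lipschitz[of 0 \<rho> s t] assms ts by simp_all
  then show "\<bar>(fa 0 \<rho> s - fa 0 \<rho> t) / \<tau>\<bar> \<le> K" "\<bar>(fb 0 \<rho> s - fb 0 \<rho> t) / \<tau>\<bar> \<le> K"
    using ts(4) by (simp_all add: abs_divide divide_le_eq)
qed

section \<open>Consistency at an interior node\<close>

context
  fixes j assumes j: "j \<in> {1..J-1}"
begin

lemma cdiff_le: "\<bar>cdiff h xa j\<bar> \<le> K" "\<bar>cdiff h xb j\<bar> \<le> K"
  unfolding cdiff_eqs[OF j]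
  by (rule A.central_quotient_bound B.central_quotient_bound; use h_pos stencil[OF j] ts in simp)+

lemma cdiff_near:
  "\<bar>cdiff h xa j - fa 1 (q j) t\<bar> \<le> K * h\<^sup>2" "\<bar>cdiff h xb j - fb 1 (q j) t\<bar> \<le> K * h\<^sup>2"
  "\<bar>cdiff h xb' j - fb 1 (q j) s\<bar> \<le> K * h\<^sup>2"
  unfolding cdiff_eqs[OF j]
  by (rule A.central_quotient B.central_quotient; use h_pos stencil[OF j] ts in simp)+

lemma cdiff_near':
  "\<bar>cdiff h xa j - fa 1 (q j) s\<bar> \<le> K * \<delta>" "\<bar>cdiff h xb j - fb 1 (q j) s\<bar> \<le> K * \<delta>"
proof -
  have "\<bar>fa 1 (q j) t - fa 1 (q j) s\<bar> \<le> K * \<tau>" "\<bar>fb 1 (q j) t - fb 1 (q j) s\<bar> \<le> K * \<tau>"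
    using A.time_lipschitz[of 1 "q j" t s] B.time_lipschitz[of 1 "q j" t s] stencil[OF j] ts by auto
  then show "\<bar>cdiff h xa j - fa 1 (q j) s\<bar> \<le> K * \<delta>" "\<bar>cdiff h xb j - fb 1 (q j) s\<bar> \<le> K * \<delta>"
    using cdiff_near unfolding \<delta>_def distrib_left by linarith+
qed

lemma fb1_om: "u \<in> {0..T} \<Longrightarrow> \<bar>fb 1 (q j) u\<bar> \<le> 2 * K * om j"
proof -
  assume u: "u \<in> {0..T}"
  obtain e where e: "e \<in> {0, 1}" "\<bar>q j - e\<bar> \<le> 2 * om j" using nearest_end[OF j] by metis
  have "\<bar>fb 1 (q j) u\<bar> \<le> K * \<bar>q j - e\<bar>" using fb1_end[OF e(1) stencil(5)[OF j] u] .
  also have "\<dots> \<le> K * (2 * om j)" using e K0 by (intro mult_left_mono) auto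
  finally show ?thesis by simp
qed

lemma cb_om: "\<bar>cdiff h xb j\<bar> \<le> 4 * K * om j" "\<bar>cdiff h xb' j\<bar> \<le> 4 * K * om j"
proof -
  have "K * h\<^sup>2 \<le> K * (2 * om j)" using h_sq h_le_om[OF j] K0 by (intro mult_left_mono) auto
  then show "\<bar>cdiff h xb j\<bar> \<le> 4 * K * om j" "\<bar>cdiff h xb' j\<bar> \<le> 4 * K * om j"
    using cdiff_near fb1_om[OF ts(1)] fb1_om[OF ts(2)] by linarith+
qed

lemma xa_ge: "om j / K \<le> xa j" "om j / K \<le> xa' j"
  using a_ge[of "q j"] stencil[OF j] ts by (auto simp: xa_def xa'_def om_def)

lemma xa_pos: "0 < xa j" "0 < xa' j"
proof -
  have "0 < om j / K" using om_pos[OF j] K0 by simp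
  then show "0 < xa j" "0 < xa' j" using xa_ge by linarith+
qed

lemma speed_near: "\<bar>(cdiff h xa j)\<^sup>2 + (cdiff h xb j)\<^sup>2 - ((fa 1 (q j) t)\<^sup>2 + (fb 1 (q j) t)\<^sup>2)\<bar> \<le> 4 * K\<^sup>2 * h\<^sup>2"
  and speed_near': "\<bar>(cdiff h xa j)\<^sup>2 + (cdiff h xb j)\<^sup>2 - ((fa 1 (q j) s)\<^sup>2 + (fb 1 (q j) s)\<^sup>2)\<bar> \<le> 4 * K\<^sup>2 * \<delta>"
proof -
  have b: "\<bar>fa 1 (q j) u\<bar> \<le> K" "\<bar>fb 1 (q j) u\<bar> \<le> K" if "u \<in> {0..T}" for u
    using A.bf[of 1 "q j" u] B.bf[of 1 "q j" u] that stencil[OF j] by auto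
  have "K * h\<^sup>2 * (2 * K) = 2 * K\<^sup>2 * h\<^sup>2" "K * \<delta> * (2 * K) = 2 * K\<^sup>2 * \<delta>" by (simp_all add: power2_eq_square)
  then show "\<bar>(cdiff h xa j)\<^sup>2 + (cdiff h xb j)\<^sup>2 - ((fa 1 (q j) t)\<^sup>2 + (fb 1 (q j) t)\<^sup>2)\<bar> \<le> 4 * K\<^sup>2 * h\<^sup>2"
    "\<bar>(cdiff h xa j)\<^sup>2 + (cdiff h xb j)\<^sup>2 - ((fa 1 (q j) s)\<^sup>2 + (fb 1 (q j) s)\<^sup>2)\<bar> \<le> 4 * K\<^sup>2 * \<delta>"
    using square_diff_le[OF cdiff_near(1) cdiff_le(1) b(1)] square_diff_le[OF cdiff_near(2) cdiff_le(2) b(2)]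
      square_diff_le[OF cdiff_near'(1) cdiff_le(1) b(1)] square_diff_le[OF cdiff_near'(2) cdiff_le(2) b(2)] ts
    by linarith+
qed

lemma speed_ge: "1 / (2 * K) \<le> (cdiff h xa j)\<^sup>2 + (cdiff h xb j)\<^sup>2"
proof -
  have "4 * K\<^sup>2 * h\<^sup>2 \<le> 4 * K\<^sup>2 * h" using h_sq by (intro mult_left_mono) auto
  also have "\<dots> = 4 * (K ^ 3 * h) / K" using K0 by (simp add: eval_nat_numeral)
  also have "\<dots> \<le> 4 * (1 / 8) / K" using small' K0 by (intro divide_right_mono mult_left_mono) auto
  finally have "4 * K\<^sup>2 * h\<^sup>2 \<le> 1 / (2 * K)" by simp
  moreover have "1 / K = 1 / (2 * K) + 1 / (2 * K)" by simp
  ultimately show ?thesis using speed_near regular[of "q j" t] stencil(5)[OF j] ts(1) by linarith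
qed

text \<open>The quotient \<open>b_\<rho> / a\<close> occurs in both equations, multiplied by either
  slope, hence the general \<open>w\<close>. Its error is of order \<delta> because each difference
  carries a factor \<open>om j\<close> that cancels \<open>1 / a\<close>: the truncation error of
  \<open>b_\<rho>\<close> because \<open>fb 3\<close> vanishes at the axis, the change of
  \<open>a\<close> in time because \<open>a\<close> does.\<close>

lemma singular_consistency:
  assumes w: "\<bar>w\<bar> \<le> K" "\<bar>w - W\<bar> \<le> K * \<delta>"
  shows "\<bar>cdiff h xb' j / xa j * w - fb 1 (q j) s / xa' j * W\<bar> \<le> 6 * K ^ 5 * \<delta>"
proof -
  have om: "0 < om j" using om_pos[OF j] .
  obtain e where e: "e \<in> {0, 1}" "\<bar>q j - e\<bar> \<le> 2 * om j" using nearest_end[OF j] by metis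
  note qm = stencil(5)[OF j]
  define p P where "p = cdiff h xb' j" and "P = fb 1 (q j) s"
  have f3: "\<bar>fb 3 (q j) s\<bar> \<le> 2 * K * om j"
  proof -
    have "\<bar>fb 3 (q j) s\<bar> \<le> K * \<bar>q j - e\<bar>"
      using B.taylor0[of 3 e "q j" s] fb_end(2)[OF e(1) ts(3)] end_mem[OF e(1)] qm ts by simp
    also have "\<dots> \<le> K * (2 * om j)" using e K0 by (intro mult_left_mono) auto
    finally show ?thesis by simp
  qed
  have "\<bar>p - P\<bar> \<le> h\<^sup>2 * (\<bar>fb 3 (q j) s\<bar> + K * h) / 6"
    unfolding p_def P_def cdiff_eqs[OF j]
    using h_pos stencil[OF j] ts by (intro B.central_quotient_third) auto
  also have "\<dots> \<le> h\<^sup>2 * (2 * K * om j + K * (2 * om j)) / 6"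
    using f3 h_le_om[OF j] K0 by (intro divide_right_mono mult_left_mono add_mono) auto
  also have "\<dots> \<le> K * h\<^sup>2 * om j" using K0 om by simp
  finally have pP: "\<bar>p - P\<bar> \<le> K * h\<^sup>2 * om j" .
  have at: "\<bar>xa' j - xa j\<bar> \<le> 2 * K * \<tau> * om j"
  proof -
    have "\<bar>xa' j - xa j\<bar> \<le> K * \<bar>q j - e\<bar> * \<tau>"
      using velocity_a_end(1)[OF e(1) qm ts(1) ts(2)] ts by (simp add: xa_def xa'_def)
    also have "\<dots> \<le> K * (2 * om j) * \<tau>" using e K0 ts by (intro mult_right_mono mult_left_mono) auto
    finally show ?thesis by (simp add: mult.commute mult.left_commute)
  qed
  have "\<bar>(p - P) / xa j\<bar> \<le> K * h\<^sup>2 * om j / (om j / K)" "\<bar>(xa' j - xa j) / xa j\<bar> \<le> 2 * K * \<tau> * om j / (om j / K)"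
    "\<bar>P / xa' j\<bar> \<le> 2 * K * om j / (om j / K)"
    by (rule abs_divide_le; use pP at xa_ge fb1_om[OF ts(2)] om K0 in \<open>simp add: P_def\<close>)+
  moreover have "K * h\<^sup>2 * om j / (om j / K) = K\<^sup>2 * h\<^sup>2" "2 * K * \<tau> * om j / (om j / K) = 2 * K\<^sup>2 * \<tau>"
    "2 * K * om j / (om j / K) = 2 * K\<^sup>2"
    using om by (simp_all add: power2_eq_square)
  ultimately have 1: "\<bar>(p - P) / xa j\<bar> \<le> K\<^sup>2 * h\<^sup>2" "\<bar>(xa' j - xa j) / xa j\<bar> \<le> 2 * K\<^sup>2 * \<tau>"
    and PK: "\<bar>P / xa' j\<bar> \<le> 2 * K\<^sup>2" by simp_all
  have "p / xa j - P / xa' j = (p - P) / xa j + P / xa' j * ((xa' j - xa j) / xa j)"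
    using xa_pos by (simp add: field_simps)
  moreover have "\<bar>P / xa' j * ((xa' j - xa j) / xa j)\<bar> \<le> 2 * K\<^sup>2 * (2 * K\<^sup>2 * \<tau>)"
    using PK 1 by (intro abs_mult_le)
  moreover have "2 * K\<^sup>2 * (2 * K\<^sup>2 * \<tau>) = 4 * K ^ 4 * \<tau>" by (simp add: eval_nat_numeral)
  moreover have "K\<^sup>2 * h\<^sup>2 \<le> 4 * K ^ 4 * h\<^sup>2"
  proof (rule mult_right_mono)
    show "K\<^sup>2 \<le> 4 * K ^ 4" using K_pow(1)[of 2 4] K_pow(2)[of 4] by linarith
  qed simp
  ultimately have 2: "\<bar>p / xa j - P / xa' j\<bar> \<le> 4 * K ^ 4 * \<delta>"
    using 1(1) unfolding \<delta>_def distrib_left by linarith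
  have "p / xa j * w - P / xa' j * W = (p / xa j - P / xa' j) * w + P / xa' j * (w - W)"
    by (simp only: left_diff_distrib right_diff_distrib)
  moreover have "\<bar>(p / xa j - P / xa' j) * w\<bar> \<le> 4 * K ^ 4 * \<delta> * K" using 2 w by (intro abs_mult_le)
  moreover have "\<bar>P / xa' j * (w - W)\<bar> \<le> 2 * K\<^sup>2 * (K * \<delta>)" using PK w by (intro abs_mult_le)
  moreover have "4 * K ^ 4 * \<delta> * K = 4 * (K ^ 5 * \<delta>)" "2 * K\<^sup>2 * (K * \<delta>) = 2 * (K ^ 3 * \<delta>)"
    by (simp_all add: eval_nat_numeral)
  moreover have "K ^ 3 * \<delta> \<le> K ^ 5 * \<delta>" using K_pow(1)[of 3 5] \<delta> by (intro mult_right_mono) auto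
  ultimately show ?thesis unfolding p_def P_def by linarith
qed

lemma parabolic_consistency:
  assumes v: "\<bar>v\<bar> \<le> K" "\<bar>v - V\<bar> \<le> K * \<tau>"
  shows "\<bar>((cdiff h xa j)\<^sup>2 + (cdiff h xb j)\<^sup>2) * v - ((fa 1 (q j) s)\<^sup>2 + (fb 1 (q j) s)\<^sup>2) * V\<bar> \<le> 6 * K ^ 5 * \<delta>"
proof -
  define d Q where "d = (cdiff h xa j)\<^sup>2 + (cdiff h xb j)\<^sup>2" and "Q = (fa 1 (q j) s)\<^sup>2 + (fb 1 (q j) s)\<^sup>2"
  have "d * v - Q * V = (d - Q) * v + Q * (v - V)" by (simp add: algebra_simps)
  moreover have "\<bar>(d - Q) * v\<bar> \<le> 4 * K\<^sup>2 * \<delta> * K" using speed_near' v by (intro abs_mult_le) (auto simp: d_def Q_def)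
  moreover have "\<bar>Q * (v - V)\<bar> \<le> (K\<^sup>2 + K\<^sup>2) * (K * \<tau>)"
    using squares_le[OF stencil(5)[OF j] ts(2)] v by (intro abs_mult_le) (auto simp: Q_def)
  moreover have "4 * K\<^sup>2 * \<delta> * K = 4 * (K ^ 3 * \<delta>)" "(K\<^sup>2 + K\<^sup>2) * (K * \<tau>) = 2 * (K ^ 3 * \<tau>)"
    by (simp_all add: eval_nat_numeral)
  moreover have "K ^ 3 * \<tau> \<le> K ^ 3 * \<delta>" using \<delta> K_pow(2)[of 3] by (intro mult_left_mono) auto
  moreover have "K ^ 3 * \<delta> \<le> K ^ 5 * \<delta>" using K_pow(1)[of 3 5] \<delta> by (intro mult_right_mono) auto
  ultimately show ?thesis unfolding d_def Q_def by linarith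
qed

lemma velocity_near:
  "\<bar>(xa' j - xa j) / \<tau> - ga 0 (q j) s\<bar> \<le> K * \<tau>" "\<bar>(xb' j - xb j) / \<tau> - gb 0 (q j) s\<bar> \<le> K * \<tau>"
  using A.time_taylor[of "q j" s t] B.time_taylor[of "q j" s t] stencil(5)[OF j] ts t
  by (auto simp: xa_def xa'_def xb_def xb'_def \<tau>_def)

lemma sdiff_near:
  "\<bar>sdiff h xa' j - fa 2 (q j) s\<bar> \<le> K ^ 5 * \<delta>" "\<bar>sdiff h xb' j - fb 2 (q j) s\<bar> \<le> K ^ 5 * \<delta>"
proof -
  have "K * h\<^sup>2 \<le> K ^ 5 * \<delta>" using \<delta> K_pow(1)[of 1 5] K0 by (intro mult_mono) auto
  moreover have "\<bar>sdiff h xa' j - fa 2 (q j) s\<bar> \<le> K * h\<^sup>2" "\<bar>sdiff h xb' j - fb 2 (q j) s\<bar> \<le> K * h\<^sup>2"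
    unfolding sdiff_def xa'_def xb'_def stencil(3,4)[OF j]
    by (rule A.second_quotient B.second_quotient; use h_pos stencil[OF j] ts in simp)+
  ultimately show "\<bar>sdiff h xa' j - fa 2 (q j) s\<bar> \<le> K ^ 5 * \<delta>" "\<bar>sdiff h xb' j - fb 2 (q j) s\<bar> \<le> K ^ 5 * \<delta>"
    by linarith+
qed

text \<open>13 = 1 + 6 + 6, for the second difference, the singular term and the time
  derivative.\<close>

lemma residual1:
  "\<bar>sdiff h xa' j - cdiff h xb' j / xa j * cdiff h xb j
    - ((cdiff h xa j)\<^sup>2 + (cdiff h xb j)\<^sup>2) * ((xa' j - xa j) / \<tau>)\<bar> \<le> 13 * K ^ 5 * \<delta>"
proof -
  define P Q where "P = fb 1 (q j) s" and "Q = (fa 1 (q j) s)\<^sup>2 + (fb 1 (q j) s)\<^sup>2"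
  have "xa' j * (Q * ga 0 (q j) s - fa 2 (q j) s) + P\<^sup>2 = 0"
    using pde_a[OF stencil(5)[OF j] ts(3)] by (simp add: xa'_def P_def Q_def)
  then have "fa 2 (q j) s = P / xa' j * P + Q * ga 0 (q j) s"
    using xa_pos(2) by (simp add: field_simps power2_eq_square)
  then show ?thesis
    using sdiff_near(1) singular_consistency[OF cdiff_le(2) cdiff_near'(2)]
      parabolic_consistency[OF velocity_le(1)[OF stencil(5)[OF j], folded xa_def xa'_def] velocity_near(1)] unfolding P_def Q_def by linarith
qed

lemma residual2:
  "\<bar>sdiff h xb' j + cdiff h xb' j / xa j * cdiff h xa j
    - ((cdiff h xa j)\<^sup>2 + (cdiff h xb j)\<^sup>2) * ((xb' j - xb j) / \<tau>)\<bar> \<le> 13 * K ^ 5 * \<delta>"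
proof -
  define P Q where "P = fb 1 (q j) s" and "Q = (fa 1 (q j) s)\<^sup>2 + (fb 1 (q j) s)\<^sup>2"
  have "xa' j * (Q * gb 0 (q j) s - fb 2 (q j) s) - fa 1 (q j) s * P = 0"
    using pde_b[OF stencil(5)[OF j] ts(3)] by (simp add: xa'_def P_def Q_def)
  then have "fb 2 (q j) s = - (P / xa' j * fa 1 (q j) s) + Q * gb 0 (q j) s"
    using xa_pos(2) by (simp add: field_simps)
  then show ?thesis
    using sdiff_near(2) singular_consistency[OF cdiff_le(1) cdiff_near'(1)]
      parabolic_consistency[OF velocity_le(2)[OF stencil(5)[OF j], folded xb_def xb'_def] velocity_near(2)] unfolding P_def Q_def by linarith
qed

text \<open>With \<open>r = q j - e\<close> and end slope \<open>a1\<close>, the factor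
  \<open>a\<close> is close to \<open>a1 r\<close> and the squared speed to \<open>a1^2\<close>, so
  the coefficient has the pole \<open>1 / (a1^2 r)\<close>. After cross-multiplication the numerator
  is at most \<open>10 K^3 r^2\<close> and the denominator at least \<open>r^2 / (4 K^3)\<close>.
  The condition \<open>h \<le> \<bar>q j - e\<bar>\<close> turns truncation errors
  \<open>h^2\<close> into \<open>O(r)\<close>.\<close>

lemma singular_coefficient_near_end:
  assumes e: "e \<in> {0, 1}" "\<bar>q j - e\<bar> \<le> 1 / 2" "h \<le> \<bar>q j - e\<bar>"
  shows "\<bar>cdiff h xa j / xa j / ((cdiff h xa j)\<^sup>2 + (cdiff h xb j)\<^sup>2) - 1 / (fa 1 e t)\<^sup>2 / (q j - e)\<bar> \<le> 40 * K ^ 6"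
proof -
  define r a1 d c where "r = q j - e" and "a1 = fa 1 e t"
    and "d = (cdiff h xa j)\<^sup>2 + (cdiff h xb j)\<^sup>2" and "c = cdiff h xa j"
  note qm = stencil(5)[OF j] and em = end_mem[OF e(1)]
  have r: "0 < \<bar>r\<bar>" "h \<le> \<bar>r\<bar>" using e h_pos by (auto simp: r_def)
  have "h\<^sup>2 \<le> \<bar>r\<bar>" using h_sq r by linarith
  then have Kr: "K * h\<^sup>2 \<le> K * \<bar>r\<bar>" using K0 by (intro mult_left_mono) auto
  have c1: "\<bar>c - a1\<bar> \<le> 2 * K * \<bar>r\<bar>"
    using cdiff_near(1) A.taylor0[of 1 e "q j" t] Kr qm em ts by (simp add: c_def a1_def r_def)
  have a0: "\<bar>xa j - a1 * r\<bar> \<le> K * (\<bar>r\<bar> * \<bar>r\<bar>)"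
    using A.taylor1[of 0 e "q j" t] bc_a[OF e(1) ts(1)] qm em ts
    by (simp add: xa_def a1_def r_def power2_eq_square abs_mult[symmetric])
  have cb: "\<bar>cdiff h xb j\<bar> \<le> 2 * K * \<bar>r\<bar>"
    using cdiff_near(2) fb1_end[OF e(1) qm ts(1)] Kr by (simp add: r_def)
  have a1K: "\<bar>a1\<bar> \<le> K" "a1\<^sup>2 \<le> K\<^sup>2" "1 / K \<le> a1\<^sup>2"
    using A.bf[of 1 e t] regular_end[OF e(1) ts(1)] em ts by (auto simp: a1_def)
  have d1: "\<bar>d - a1\<^sup>2\<bar> \<le> 6 * K\<^sup>2 * \<bar>r\<bar>"
  proof -
    have "\<bar>c\<^sup>2 - a1\<^sup>2\<bar> \<le> 2 * K * \<bar>r\<bar> * (2 * K)"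
      using c1 a1K cdiff_le by (intro square_diff_le) (auto simp: c_def)
    moreover have "\<bar>cdiff h xb j * cdiff h xb j\<bar> \<le> 2 * K * \<bar>r\<bar> * K"
      using cb cdiff_le by (intro abs_mult_le)
    moreover have "d - a1\<^sup>2 = (c\<^sup>2 - a1\<^sup>2) + cdiff h xb j * cdiff h xb j"
      by (simp add: d_def c_def power2_eq_square)
    moreover have "2 * K * \<bar>r\<bar> * (2 * K) = 4 * (K\<^sup>2 * \<bar>r\<bar>)" "2 * K * \<bar>r\<bar> * K = 2 * (K\<^sup>2 * \<bar>r\<bar>)"
      by (simp_all add: power2_eq_square)
    ultimately show ?thesis by linarith
  qed
  have "(cdiff h xa j)\<^sup>2 \<le> K\<^sup>2" "(cdiff h xb j)\<^sup>2 \<le> K\<^sup>2"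
    using cdiff_le by (metis abs_ge_zero power2_abs power_mono)+
  then have dK: "\<bar>d\<bar> \<le> 2 * K\<^sup>2" "1 / (2 * K) \<le> d" using speed_ge by (simp_all add: d_def)
  have num: "\<bar>c * r * a1\<^sup>2 - xa j * d\<bar> \<le> 10 * K ^ 3 * (\<bar>r\<bar> * \<bar>r\<bar>)"
  proof -
    define m where "m = K ^ 3 * (\<bar>r\<bar> * \<bar>r\<bar>)"
    have sum3: "\<bar>u - v - w\<bar> \<le> 10 * m" if "\<bar>u\<bar> \<le> 2 * m" "\<bar>v\<bar> \<le> 2 * m" "\<bar>w\<bar> \<le> 6 * m" for u v w
      using that by linarith
    have m: "2 * K * \<bar>r\<bar> * (\<bar>r\<bar> * K\<^sup>2) = 2 * m" "K * (\<bar>r\<bar> * \<bar>r\<bar>) * (2 * K\<^sup>2) = 2 * m"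
      "K * (\<bar>r\<bar> * (6 * K\<^sup>2 * \<bar>r\<bar>)) = 6 * m"
      by (simp_all add: m_def eval_nat_numeral)
    have "\<bar>(c - a1) * (r * a1\<^sup>2)\<bar> \<le> 2 * K * \<bar>r\<bar> * (\<bar>r\<bar> * K\<^sup>2)"
      using c1 a1K by (intro abs_mult_le) auto
    moreover have "\<bar>(xa j - a1 * r) * d\<bar> \<le> K * (\<bar>r\<bar> * \<bar>r\<bar>) * (2 * K\<^sup>2)" using a0 dK by (intro abs_mult_le)
    moreover have "\<bar>a1 * (r * (d - a1\<^sup>2))\<bar> \<le> K * (\<bar>r\<bar> * (6 * K\<^sup>2 * \<bar>r\<bar>))"
      using a1K d1 by (intro abs_mult_le) auto
    ultimately have "\<bar>(c - a1) * (r * a1\<^sup>2) - (xa j - a1 * r) * d - a1 * (r * (d - a1\<^sup>2))\<bar> \<le> 10 * m"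
      unfolding m by (rule sum3)
    moreover have "c * r * a1\<^sup>2 - xa j * d = (c - a1) * (r * a1\<^sup>2) - (xa j - a1 * r) * d - a1 * (r * (d - a1\<^sup>2))"
      by (simp add: algebra_simps)
    ultimately show ?thesis unfolding m_def by simp
  qed
  have den: "\<bar>r\<bar> * \<bar>r\<bar> / (4 * K ^ 3) \<le> \<bar>xa j * d * (r * a1\<^sup>2)\<bar>"
  proof -
    have "\<bar>r\<bar> / (2 * K) \<le> xa j" using fa0_end_ge[OF e(1) qm ts(1)] e by (simp add: xa_def r_def)
    moreover have "0 \<le> \<bar>r\<bar> / (2 * K)" "0 < 1 / (2 * K)" "0 < 1 / K" using K0 by auto
    ultimately have "\<bar>r\<bar> / (2 * K) * (1 / (2 * K)) * (\<bar>r\<bar> * (1 / K)) \<le> xa j * d * (\<bar>r\<bar> * a1\<^sup>2)"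
      using dK a1K r xa_pos order_trans[OF less_imp_le[OF \<open>0 < 1 / (2 * K)\<close>] dK(2)]
      by (intro mult_mono mult_nonneg_nonneg) auto
    moreover have "\<bar>xa j * d * (r * a1\<^sup>2)\<bar> = xa j * d * (\<bar>r\<bar> * a1\<^sup>2)"
      using xa_pos order_trans[OF less_imp_le[OF \<open>0 < 1 / (2 * K)\<close>] dK(2)] by (simp add: abs_mult)
    ultimately show ?thesis by (simp add: eval_nat_numeral)
  qed
  have quot: "x / y / z - 1 / w / v = (x * v * w - y * z) / (y * z * (v * w))"
    if "y \<noteq> 0" "z \<noteq> 0" "w \<noteq> 0" "v \<noteq> 0" for x y z w v :: real
    using that by (simp add: field_simps)
  have "0 < 1 / K" "0 < 1 / (2 * K)" using K0 by auto
  then have "a1\<^sup>2 \<noteq> 0" "0 < d" using a1K(3) dK(2) by linarith+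
  then have "c / xa j / d - 1 / a1\<^sup>2 / r = (c * r * a1\<^sup>2 - xa j * d) / (xa j * d * (r * a1\<^sup>2))"
    using xa_pos r by (intro quot) auto
  also have "\<bar>\<dots>\<bar> \<le> 10 * K ^ 3 * (\<bar>r\<bar> * \<bar>r\<bar>) / (\<bar>r\<bar> * \<bar>r\<bar> / (4 * K ^ 3))"
  proof -
    have "0 < \<bar>r\<bar> * \<bar>r\<bar> / (4 * K ^ 3)"
      by (rule divide_pos_pos[OF mult_pos_pos[OF r(1) r(1)]]) (use K0 in simp)
    moreover have "0 \<le> 10 * K ^ 3 * (\<bar>r\<bar> * \<bar>r\<bar>)" using K0 by simp
    ultimately show ?thesis unfolding abs_divide using num den by (intro frac_le)
  qed
  also have "\<dots> = 40 * K ^ 6" using r by (simp add: eval_nat_numeral)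
  finally show ?thesis by (simp add: c_def a1_def r_def d_def)
qed

text \<open>The nearer end contributes 40 by the preceding estimate; the pole of the other end is at
  distance at least 1/2 and adds at most \<open>2 * K ^ 6\<close>. The sum is rounded up to
  50.\<close>

lemma singular_coefficient:
  "\<bar>cdiff h xa j / xa j / ((cdiff h xa j)\<^sup>2 + (cdiff h xb j)\<^sup>2)
    - (1 / (fa 1 0 t)\<^sup>2 / q j - 1 / (fa 1 1 t)\<^sup>2 / (1 - q j))\<bar> \<le> 50 * K ^ 6"
proof -
  have far: "\<bar>1 / (fa 1 e t)\<^sup>2 / r\<bar> \<le> 2 * K ^ 6" if e: "e \<in> {0, 1}" and r: "1 / 2 \<le> r" for e r
  proof -
    have a1: "1 / K \<le> (fa 1 e t)\<^sup>2" using regular_end(1)[OF e ts(1)] .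
    have "\<bar>1 / (fa 1 e t)\<^sup>2\<bar> \<le> 1 / (1 / K)" by (rule abs_divide_le) (use a1 K0 in auto)
    then have "\<bar>1 / (fa 1 e t)\<^sup>2 / r\<bar> \<le> K / (1 / 2)" using r by (intro abs_divide_le) auto
    then show ?thesis using K_pow(1)[of 1 6] by simp
  qed
  obtain e where e: "e \<in> {0, 1}" "\<bar>q j - e\<bar> \<le> 1 / 2" "h \<le> \<bar>q j - e\<bar>" using nearest_end[OF j] by metis
  have near: "\<bar>x - y\<bar> \<le> 50 * K ^ 6" if "\<bar>x - z\<bar> \<le> 40 * K ^ 6" "\<bar>z - y\<bar> \<le> 2 * K ^ 6" for x y z
    using that K_pow(2)[of 6] by linarith
  from e(1) consider "e = 0" | "e = 1" by auto
  then show ?thesis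
  proof cases
    case 1
    show ?thesis
      using far[of 1 "1 - q j"] e(2) singular_coefficient_near_end[OF e] unfolding 1
      by (intro near[of _ "1 / (fa 1 0 t)\<^sup>2 / q j"]) auto
  next
    case 2
    have "1 / (fa 1 1 t)\<^sup>2 / (q j - 1) = - (1 / (fa 1 1 t)\<^sup>2 / (1 - q j))"
      by (metis minus_diff_eq divide_minus_right)
    then have "1 / (fa 1 1 t)\<^sup>2 / (q j - 1) - (1 / (fa 1 0 t)\<^sup>2 / q j - 1 / (fa 1 1 t)\<^sup>2 / (1 - q j))
        = - (1 / (fa 1 0 t)\<^sup>2 / q j)" by linarith
    moreover have "1 / 2 \<le> q j" using e(2) unfolding 2 by linarith
    ultimately have "\<bar>1 / (fa 1 1 t)\<^sup>2 / (q j - 1) - (1 / (fa 1 0 t)\<^sup>2 / q j - 1 / (fa 1 1 t)\<^sup>2 / (1 - q j))\<bar> \<le> 2 * K ^ 6"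
      using far[of 0 "q j"] by (simp only: abs_minus_cancel) simp
    then show ?thesis using singular_coefficient_near_end[OF e] unfolding 2 by (rule near[rotated])
  qed
qed

end

section \<open>Consistency of the boundary conditions\<close>

definition "rim e = e + (1 - 2 * e) * h"
text \<open>\<open>rim e\<close> is the grid point next to the end \<open>e\<close>. At
  \<open>e = 1\<close> numerator and denominator both change sign, so one formula gives the forward
  quotient at 0 and the backward quotient at 1.\<close>

definition "qa e = (fa 0 (rim e) t - fa 0 e t) / (rim e - e)"
definition "qb e = (fb 0 (rim e) t - fb 0 e t) / (rim e - e)"
definition "qb' e = (fb 0 (rim e) s - fb 0 e s) / (rim e - e)"

context
  fixes e assumes e: "e \<in> {0, 1::real}"
begin

lemma rim: "rim e \<in> {0..1}" "\<bar>rim e - e\<bar> = h" "rim e \<noteq> e" "rim e - e = (1 - 2 * e) * h" "(rim e - e)\<^sup>2 = h\<^sup>2"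
  using e h_pos h_le by (auto simp: rim_def)

lemma q_le: "\<bar>qa e\<bar> \<le> K" "\<bar>qb e\<bar> \<le> K"
  unfolding qa_def qb_def
  by (rule A.one_sided_quotient_bound B.one_sided_quotient_bound; use end_mem[OF e] rim ts in simp)+

lemma qb_small: "(qb e)\<^sup>2 \<le> K\<^sup>2 * h\<^sup>2"
proof -
  have "\<bar>qb e - fb 1 e t\<bar> \<le> K * \<bar>rim e - e\<bar>"
    unfolding qb_def by (rule B.one_sided_quotient[OF end_mem[OF e] rim(1,3) ts(1)])
  then have "\<bar>qb e\<bar> \<le> K * h" unfolding rim(2) bc_b[OF e ts(1)] by simp
  then have "(qb e)\<^sup>2 \<le> (K * h)\<^sup>2" by (metis abs_ge_zero power2_abs power_mono)
  then show ?thesis by (simp add: power_mult_distrib)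
qed

lemma rim_speed: "\<bar>(qa e)\<^sup>2 + (qb e)\<^sup>2 - (fa 1 e t)\<^sup>2\<bar> \<le> 3 * K\<^sup>2 * h"
proof -
  have "\<bar>qa e - fa 1 e t\<bar> \<le> K * h"
    using A.one_sided_quotient[OF end_mem[OF e] rim(1,3) ts(1)] unfolding qa_def rim(2) .
  then have "\<bar>(qa e)\<^sup>2 - (fa 1 e t)\<^sup>2\<bar> \<le> K * h * (2 * K)"
    using q_le A.bf[of 1 e t] end_mem[OF e] ts by (intro square_diff_le) auto
  moreover have "K * h * (2 * K) = 2 * (K\<^sup>2 * h)" by (simp add: power2_eq_square)
  moreover have "K\<^sup>2 * h\<^sup>2 \<le> K\<^sup>2 * h" using h_sq by (intro mult_left_mono) auto
  moreover have "0 \<le> (qb e)\<^sup>2" by simp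
  ultimately show ?thesis using qb_small by linarith
qed

lemma rim_speed': "\<bar>(qa e)\<^sup>2 + (qb e)\<^sup>2 - (fa 1 e s)\<^sup>2\<bar> \<le> 5 * K\<^sup>2 * \<delta>"
proof -
  have "\<bar>qa e - (fa 1 e t + fa 2 e t * (rim e - e) / 2)\<bar> \<le> K * h\<^sup>2"
    using A.one_sided_quotient2[OF end_mem[OF e] rim(1,3) ts(1)] unfolding qa_def rim(5) .
  \<comment> \<open>At the old time, possibly 0, \<open>fa2_end\<close> does not apply; comparison
    with the new time shows that \<open>fa 2\<close> is \<open>O(\<tau>)\<close> there. So the
    one-sided quotient is accurate up to \<delta> and not just up to \<open>h\<close>.\<close>
  moreover have "\<bar>fa 2 e t * ((rim e - e) / 2)\<bar> \<le> K * \<tau> * (1 / 2)"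
  proof (rule abs_mult_le)
    show "\<bar>fa 2 e t\<bar> \<le> K * \<tau>"
      using A.time_lipschitz[of 2 e t s] fa2_end[OF e ts(3)] end_mem[OF e] ts by simp
    show "\<bar>(rim e - e) / 2\<bar> \<le> 1 / 2" using rim(2) h_le by simp
  qed
  moreover have "\<bar>fa 1 e t - fa 1 e s\<bar> \<le> K * \<tau>"
    using A.time_lipschitz[of 1 e t s] end_mem[OF e] ts by simp
  moreover have "0 \<le> K * h\<^sup>2" "0 \<le> K * \<tau>" using K0 ts by simp_all
  moreover have "fa 2 e t * (rim e - e) / 2 = fa 2 e t * ((rim e - e) / 2)" by simp
  moreover have "\<bar>x - z\<bar> \<le> p + p' + p''"
    if "\<bar>x - (y + u)\<bar> \<le> p" "\<bar>u\<bar> \<le> p'" "\<bar>y - z\<bar> \<le> p''" for x y z u p p' p'' :: real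
    using that by linarith
  ultimately have "\<bar>qa e - fa 1 e s\<bar> \<le> K * h\<^sup>2 + K * \<tau> * (1 / 2) + K * \<tau>" by metis
  also have "\<dots> \<le> 2 * K * \<delta>" using \<open>0 \<le> K * h\<^sup>2\<close> \<open>0 \<le> K * \<tau>\<close> unfolding \<delta>_def distrib_left by linarith
  finally have "\<bar>qa e - fa 1 e s\<bar> \<le> 2 * K * \<delta>" .
  then have "\<bar>(qa e)\<^sup>2 - (fa 1 e s)\<^sup>2\<bar> \<le> 2 * K * \<delta> * (2 * K)"
    using q_le A.bf[of 1 e s] end_mem[OF e] ts by (intro square_diff_le) auto
  moreover have "2 * K * \<delta> * (2 * K) = 4 * (K\<^sup>2 * \<delta>)" by (simp add: power2_eq_square)
  moreover have "K\<^sup>2 * h\<^sup>2 \<le> K\<^sup>2 * \<delta>" using \<delta> by (intro mult_left_mono) auto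
  moreover have "0 \<le> (qb e)\<^sup>2" by simp
  ultimately show ?thesis using qb_small by linarith
qed

lemma rim_velocity:
  "\<bar>(fb 0 e s - fb 0 e t) / \<tau> - gb 0 e s\<bar> \<le> K * \<tau>" "\<bar>(fb 0 e s - fb 0 e t) / \<tau>\<bar> \<le> K"
proof -
  show "\<bar>(fb 0 e s - fb 0 e t) / \<tau> - gb 0 e s\<bar> \<le> K * \<tau>"
    unfolding \<tau>_def using B.time_taylor[OF end_mem[OF e] ts(2) ts(1) t(2)] .
  show "\<bar>(fb 0 e s - fb 0 e t) / \<tau>\<bar> \<le> K" by (rule velocity_le[OF end_mem[OF e]])
qed

text \<open>Origin of the 1/4 in the scheme: by \<open>one_sided_quotient3\<close> the slope is
  \<open>(rim e - e) / 2 * fb 2 e s\<close> up to \<open>O(h^3)\<close>, and by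
  \<open>fb_end\<close> the factor \<open>fb 2\<close> is half of
  \<open>(fa 1)^2 * gb 0\<close>.\<close>

lemma rim_residual:
  "\<bar>qb' e - (rim e - e) / 4 * ((qa e)\<^sup>2 + (qb e)\<^sup>2) * ((fb 0 e s - fb 0 e t) / \<tau>)\<bar> \<le> h * (13 * K ^ 5 * \<delta>)"
proof -
  define D v Q V where "D = (qa e)\<^sup>2 + (qb e)\<^sup>2" and "v = (fb 0 e s - fb 0 e t) / \<tau>"
    and "Q = (fa 1 e s)\<^sup>2" and "V = gb 0 e s"
  have "D * v - Q * V = (D - Q) * v + Q * (v - V)" by (simp add: algebra_simps)
  moreover have "\<bar>(D - Q) * v\<bar> \<le> 5 * K\<^sup>2 * \<delta> * K"
    using rim_speed' rim_velocity(2) by (intro abs_mult_le) (auto simp: D_def Q_def v_def)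
  moreover have "\<bar>Q * (v - V)\<bar> \<le> K\<^sup>2 * (K * \<tau>)"
    using regular_end(3)[OF e ts(2)] rim_velocity(1) by (intro abs_mult_le) (auto simp: V_def Q_def v_def)
  moreover have "5 * K\<^sup>2 * \<delta> * K = 5 * (K ^ 3 * \<delta>)" "K\<^sup>2 * (K * \<tau>) = K ^ 3 * \<tau>" by (simp_all add: eval_nat_numeral)
  moreover have "K ^ 3 * \<tau> \<le> K ^ 3 * \<delta>" using \<delta> K_pow(2)[of 3] by (intro mult_left_mono) auto
  moreover have K35: "K ^ 3 * \<delta> \<le> K ^ 5 * \<delta>" using K_pow(1)[of 3 5] \<delta> by (intro mult_right_mono) auto
  ultimately have "\<bar>D * v - Q * V\<bar> \<le> 6 * (K ^ 5 * \<delta>)" by linarith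
  then have "\<bar>(rim e - e) / 4 * (D * v - Q * V)\<bar> \<le> h / 4 * (6 * (K ^ 5 * \<delta>))"
    using rim(2) by (intro abs_mult_le) auto
  moreover have "\<bar>qb' e - (rim e - e) / 4 * (Q * V)\<bar> \<le> h * (K ^ 5 * \<delta>)"
  proof -
    have "2 * fb 2 e s = Q * V" using fb_end(1)[OF e ts(3)] by (simp add: Q_def V_def)
    then have "fb 2 e s = Q * V / 2" by simp
    then have "fb 1 e s + fb 2 e s * (rim e - e) / 2 + fb 3 e s * (rim e - e)\<^sup>2 / 6 = (rim e - e) / 4 * (Q * V)"
      unfolding bc_b[OF e ts(2)] fb_end(2)[OF e ts(3)] by simp
    then have "\<bar>qb' e - (rim e - e) / 4 * (Q * V)\<bar> \<le> K * h ^ 3 / 6"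
      using B.one_sided_quotient3[OF end_mem[OF e] rim(1,3) ts(2)]
      unfolding qb'_def rim(2) by (simp only:)
    also have "\<dots> \<le> K * h ^ 3" using K0 h_pos by simp
    also have "\<dots> = h * (K * h\<^sup>2)" by (simp add: eval_nat_numeral)
    also have "\<dots> \<le> h * (K ^ 5 * \<delta>)"
      using \<delta> K_pow(1)[of 1 5] K0 h_pos by (intro mult_left_mono mult_mono) auto
    finally show ?thesis .
  qed
  moreover have "\<bar>x - (y + z)\<bar> \<le> h * (13 * K ^ 5 * \<delta>)"
    if "\<bar>z\<bar> \<le> h / 4 * (6 * (K ^ 5 * \<delta>))" "\<bar>x - y\<bar> \<le> h * (K ^ 5 * \<delta>)" for x y z
  proof -
    have "0 \<le> h * (K ^ 5 * \<delta>)" using h_pos K_pow(2)[of 5] \<delta> by simp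
    moreover have "h / 4 * (6 * (K ^ 5 * \<delta>)) = 3 / 2 * (h * (K ^ 5 * \<delta>))"
      "h * (13 * K ^ 5 * \<delta>) = 13 * (h * (K ^ 5 * \<delta>))" by simp_all
    ultimately show ?thesis using that by linarith
  qed
  ultimately have "\<bar>qb' e - ((rim e - e) / 4 * (Q * V) + (rim e - e) / 4 * (D * v - Q * V))\<bar> \<le> h * (13 * K ^ 5 * \<delta>)"
    by blast
  moreover have "(rim e - e) / 4 * (Q * V) + (rim e - e) / 4 * (D * v - Q * V) = (rim e - e) / 4 * D * v"
    by (simp only: distrib_left[symmetric] mult.assoc) simp
  ultimately show ?thesis by (simp only: D_def v_def)
qed

lemma rim_bounds:
  "1 / (50 * K ^ 6) \<le> (qa e)\<^sup>2 + (qb e)\<^sup>2" "1 / (fa 1 e t)\<^sup>2 * ((qa e)\<^sup>2 + (qb e)\<^sup>2) \<le> 3 / 2"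
  "1 / (50 * K ^ 6) \<le> 1 / (fa 1 e t)\<^sup>2"
proof -
  define A D where "A = (fa 1 e t)\<^sup>2" and "D = (qa e)\<^sup>2 + (qb e)\<^sup>2"
  have A: "1 / K \<le> A" "A \<le> K\<^sup>2" using regular_end[OF e ts(1)] by (auto simp: A_def)
  have "0 < 1 / K" using K0 by simp
  then have A0: "0 < A" using A(1) by linarith
  have "3 * K\<^sup>2 * h = 3 * (K ^ 3 * h) / K" using K0 by (simp add: eval_nat_numeral)
  also have "\<dots> \<le> 3 * (1 / 8) / K" using small' K0 by (intro divide_right_mono mult_left_mono) auto
  also have "\<dots> = 3 / 8 * (1 / K)" by simp
  finally have D: "\<bar>D - A\<bar> \<le> 3 / 8 * (1 / K)" using rim_speed by (simp add: A_def D_def)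
  have K6: "1 / (50 * K ^ 6) \<le> 1 / (2 * K)" "1 / (50 * K ^ 6) \<le> 1 / K\<^sup>2"
    using K_pow(1)[of 1 6] K_pow(1)[of 2 6] K_pow(2)[of 6] K0 by (auto intro!: divide_left_mono)
  have "1 / (2 * K) = 1 / 2 * (1 / K)" by simp
  then show "1 / (50 * K ^ 6) \<le> (qa e)\<^sup>2 + (qb e)\<^sup>2"
    using D A(1) K6(1) \<open>0 < 1 / K\<close> unfolding D_def[symmetric] by linarith
  have "D \<le> 3 / 2 * A" using D A(1) \<open>0 < 1 / K\<close> by linarith
  then show "1 / (fa 1 e t)\<^sup>2 * ((qa e)\<^sup>2 + (qb e)\<^sup>2) \<le> 3 / 2"
    using A0 unfolding A_def[symmetric] D_def[symmetric] by (simp add: divide_le_eq)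
  have "1 / K\<^sup>2 \<le> 1 / A" using A A0 K0 by (intro divide_left_mono) auto
  then show "1 / (50 * K ^ 6) \<le> 1 / (fa 1 e t)\<^sup>2" using K6(2) unfolding A_def[symmetric] by linarith
qed

end

lemma bdiff_rim:
  "bdiff h xa 1 = qa 0" "bdiff h xb 1 = qb 0" "bdiff h xb' 1 = qb' 0"
  "bdiff h xa J = qa 1" "bdiff h xb J = qb 1" "bdiff h xb' J = qb' 1" "rim 0 = h" "rim 1 - 1 = - h"
proof -
  have qs: "q J = 1" "q 0 = 0" "q 1 = h" "q (J - 1) = 1 - h"
    using Jh J_ge_2 by (simp_all add: q_def of_nat_diff left_diff_distrib)
  have r: "rim 0 = h" "rim 1 = 1 - h" "1 - h - 1 = - h" "h - 0 = h" "(1::nat) - 1 = 0" by (simp_all add: rim_def)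
  have flip: "(y - x) / (- h) = (x - y) / h" for x y by (metis minus_diff_eq minus_divide_divide)
  show "bdiff h xa 1 = qa 0" "bdiff h xb 1 = qb 0" "bdiff h xb' 1 = qb' 0"
    "bdiff h xa J = qa 1" "bdiff h xb J = qb 1" "bdiff h xb' J = qb' 1" "rim 0 = h" "rim 1 - 1 = - h"
    unfolding bdiff_def qa_def qb_def qb'_def xa_def xb_def xb'_def r qs flip by (rule refl)+
qed

text \<open>The pole strengths \<open>1 / a_\<rho>^2\<close> are those found in
  \<open>singular_coefficient\<close>, which also dictates the constant \<open>50 * K ^ 6\<close>;
  the other bounds hold with smaller constants.\<close>

theorem exact_solution_consistent:
  "consistent_step J h (50 * K ^ 6) (13 * K ^ 5 * \<delta>) \<tau> (1 / (fa 1 0 t)\<^sup>2) (1 / (fa 1 1 t)\<^sup>2) xa xb xa' xb'"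
proof unfold_locales
  have K1: "K \<le> 50 * K ^ 6" "4 * K \<le> 50 * K ^ 6" "2 * K \<le> 50 * K ^ 6"
    using K_pow(1)[of 1 6] K0 by auto
  show "1 \<le> 50 * K ^ 6" using K_pow(3)[of 6] by simp
  show "0 \<le> 13 * K ^ 5 * \<delta>" using K_pow(2)[of 5] \<delta> by simp
  show "0 < \<tau>" using ts by simp
  have q01: "q 0 = 0" "q J = 1" using Jh by (simp_all add: q_def)
  show "xa 0 = 0" "xa J = 0" "xa' 0 = 0" "xa' J = 0"
    using bc_a[of 0] bc_a[of 1] ts by (auto simp: xa_def xa'_def q01)
  fix j
  show "\<bar>(xa' j - xa j) / \<tau>\<bar> \<le> 50 * K ^ 6" "\<bar>(xb' j - xb j) / \<tau>\<bar> \<le> 50 * K ^ 6" if "j \<le> J"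
    using velocity_le[OF q_mem[OF that]] K1(1) unfolding xa_def xa'_def xb_def xb'_def by linarith+
  show "\<bar>bdiff h xa j\<bar> \<le> 50 * K ^ 6" "\<bar>bdiff h xb j\<bar> \<le> 50 * K ^ 6"
    "1 / (50 * K ^ 6) \<le> (bdiff h xa j)\<^sup>2 + (bdiff h xb j)\<^sup>2" if "j \<in> {1, J}"
    using that q_le[of 0] q_le[of 1] rim_bounds(1)[of 0] rim_bounds(1)[of 1] K1(1) by (auto simp: bdiff_rim[simplified])
  show "\<bar>cdiff h xa j\<bar> \<le> 50 * K ^ 6"
    "\<bar>cdiff h xb j\<bar> \<le> 50 * K ^ 6 * om j" "\<bar>cdiff h xb' j\<bar> \<le> 50 * K ^ 6 * om j"
    "1 / (50 * K ^ 6) \<le> (cdiff h xa j)\<^sup>2 + (cdiff h xb j)\<^sup>2"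
    "om j / (50 * K ^ 6) \<le> xa j" if j: "j \<in> {1..J-1}"
  proof -
    show "\<bar>cdiff h xa j\<bar> \<le> 50 * K ^ 6" using cdiff_le[OF j] K1 by linarith
    have "4 * K * om j \<le> 50 * K ^ 6 * om j" using K1 om_pos[OF j] by (intro mult_right_mono) auto
    then show "\<bar>cdiff h xb j\<bar> \<le> 50 * K ^ 6 * om j" "\<bar>cdiff h xb' j\<bar> \<le> 50 * K ^ 6 * om j"
      using cb_om[OF j] by linarith+
    have "1 / (50 * K ^ 6) \<le> 1 / (2 * K)" using K1(3) K0 by (intro divide_left_mono) auto
    then show "1 / (50 * K ^ 6) \<le> (cdiff h xa j)\<^sup>2 + (cdiff h xb j)\<^sup>2" using speed_ge[OF j] by linarith
    have "om j / (50 * K ^ 6) \<le> om j / K" using K1(1) K0 om_pos[OF j] by (intro divide_left_mono) auto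
    then show "om j / (50 * K ^ 6) \<le> xa j" using xa_ge[OF j] by linarith
  qed
  show "\<bar>cdiff h xa j / xa j / ((cdiff h xa j)\<^sup>2 + (cdiff h xb j)\<^sup>2)
    - (1 / (fa 1 0 t)\<^sup>2 / q j - 1 / (fa 1 1 t)\<^sup>2 / (1 - q j))\<bar> \<le> 50 * K ^ 6" if "j \<in> {1..J-1}"
    by (rule singular_coefficient[OF that])
  show "1 / (50 * K ^ 6) \<le> 1 / (fa 1 0 t)\<^sup>2" "1 / (50 * K ^ 6) \<le> 1 / (fa 1 1 t)\<^sup>2"
    by (rule rim_bounds; simp)+
  show "1 / (fa 1 0 t)\<^sup>2 * ((bdiff h xa 1)\<^sup>2 + (bdiff h xb 1)\<^sup>2) \<le> 3 / 2"
    "1 / (fa 1 1 t)\<^sup>2 * ((bdiff h xa J)\<^sup>2 + (bdiff h xb J)\<^sup>2) \<le> 3 / 2"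
    unfolding bdiff_rim by (rule rim_bounds; simp)+
  show "\<bar>bdiff h xb' 1 - h / 4 * ((bdiff h xa 1)\<^sup>2 + (bdiff h xb 1)\<^sup>2) * ((xb' 0 - xb 0) / \<tau>)\<bar> \<le> h * (13 * K ^ 5 * \<delta>)"
    using rim_residual[of 0] unfolding bdiff_rim xb_def xb'_def q01 by simp
  have "qb' 1 - - h / 4 * ((qa 1)\<^sup>2 + (qb 1)\<^sup>2) * v = qb' 1 + h / 4 * ((qa 1)\<^sup>2 + (qb 1)\<^sup>2) * v" for v by simp
  then show "\<bar>bdiff h xb' J + h / 4 * ((bdiff h xa J)\<^sup>2 + (bdiff h xb J)\<^sup>2) * ((xb' J - xb J) / \<tau>)\<bar> \<le> h * (13 * K ^ 5 * \<delta>)"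
    using rim_residual[of 1] unfolding bdiff_rim xb_def xb'_def q01 by simp
  show "\<bar>sdiff h xa' j - cdiff h xb' j / xa j * cdiff h xb j
    - ((cdiff h xa j)\<^sup>2 + (cdiff h xb j)\<^sup>2) * ((xa' j - xa j) / \<tau>)\<bar> \<le> 13 * K ^ 5 * \<delta>"
    "\<bar>sdiff h xb' j + cdiff h xb' j / xa j * cdiff h xa j
    - ((cdiff h xa j)\<^sup>2 + (cdiff h xb j)\<^sup>2) * ((xb' j - xb j) / \<tau>)\<bar> \<le> 13 * K ^ 5 * \<delta>" if "j \<in> {1..J-1}"
    by (rule residual1[OF that] residual2[OF that])+
qed

end

section \<open>From the smoothness assumption to scalar bounds\<close>

lemma has_real_derivative_component:
  fixes F :: "real \<Rightarrow> real^2"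
  assumes "F differentiable (at r within I)"
  shows "((\<lambda>r. F r $ c) has_real_derivative vector_derivative F (at r within I) $ c) (at r within I)"
  unfolding has_real_derivative_iff_has_vector_derivative
  by (rule bounded_linear.has_vector_derivative[OF bounded_linear_vec_nth])
    (use assms in \<open>simp add: vector_derivative_works\<close>)

lemma d_mixed_simps:
  "d_mixed T 0 0 x = x" "d_mixed T 0 (Suc j) x = d_rho (d_mixed T 0 j x)"
  "d_mixed T (Suc i) j x = d_t T (d_mixed T i j x)"
  by (simp_all add: d_mixed_def)

lemma parabolic_C4_bounded:
  assumes "parabolic_C4 T x"
  obtains K where "\<And>i j \<rho> t. 2 * i + j \<le> 4 \<Longrightarrow> \<rho> \<in> {0..1} \<Longrightarrow> t \<in> {0..T} \<Longrightarrow> norm (d_mixed T i j x \<rho> t) \<le> K"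
proof -
  define R where "R = {0..1::real} \<times> {0..T}"
  define I where "I = {(i, j). 2 * i + j \<le> (4::nat)}"
  have "I \<subseteq> {..4} \<times> {..4}" by (auto simp: I_def)
  then have fin: "finite I" by (rule finite_subset) auto
  have "bounded (\<Union>p\<in>I. (\<lambda>(\<rho>, t). d_mixed T (fst p) (snd p) x \<rho> t) ` R)"
  proof (intro bounded_UN fin ballI)
    fix p assume "p \<in> I"
    then have "continuous_on R (\<lambda>(\<rho>, t). d_mixed T (fst p) (snd p) x \<rho> t)"
      using assms by (auto simp: parabolic_C4_def R_def I_def)
    then show "bounded ((\<lambda>(\<rho>, t). d_mixed T (fst p) (snd p) x \<rho> t) ` R)"
      by (intro compact_imp_bounded compact_continuous_image) (auto simp: R_def intro: compact_Times)
  qed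
  then obtain K where K: "\<And>y. y \<in> (\<Union>p\<in>I. (\<lambda>(\<rho>, t). d_mixed T (fst p) (snd p) x \<rho> t) ` R) \<Longrightarrow> norm y \<le> K"
    by (auto simp: bounded_iff)
  show ?thesis
  proof (rule that)
    fix i j :: nat and \<rho> t :: real assume "2 * i + j \<le> 4" "\<rho> \<in> {0..1}" "t \<in> {0..T}"
    then show "norm (d_mixed T i j x \<rho> t) \<le> K"
      by (intro K UN_I[of "(i, j)"] image_eqI[of _ _ "(\<rho>, t)"]) (auto simp: I_def R_def)
  qed
qed

lemma parabolic_C4_smooth_fun:
  assumes C4: "parabolic_C4 T x" and T: "0 < T" and K: "1 \<le> K"
    and bound: "\<And>i j \<rho> t. 2 * i + j \<le> 4 \<Longrightarrow> \<rho> \<in> {0..1} \<Longrightarrow> t \<in> {0..T} \<Longrightarrow> norm (d_mixed T i j x \<rho> t) \<le> K"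
  shows "smooth_fun T K (\<lambda>j \<rho> t. d_mixed T 0 j x \<rho> t $ c) (\<lambda>j \<rho> t. d_mixed T 1 j x \<rho> t $ c)
    (\<lambda>\<rho> t. d_mixed T 2 0 x \<rho> t $ c)"
proof
  have two: "d_mixed T 2 0 x = d_t T (d_mixed T 1 0 x)"
    using d_mixed_simps(3)[of T 1 0 x] by (simp add: numeral_2_eq_2)
  have one: "d_mixed T 1 j x = d_t T (d_mixed T 0 j x)" for j
    using d_mixed_simps(3)[of T 0 j x] by simp
  have comp: "\<bar>d_mixed T i j x \<rho> t $ c\<bar> \<le> K" if "2 * i + j \<le> 4" "\<rho> \<in> {0..1}" "t \<in> {0..T}" for i j \<rho> t
    using component_le_norm_cart[of "d_mixed T i j x \<rho> t" c] bound[OF that] by linarith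
  show "0 < T" "1 \<le> K" by fact+
  fix i :: nat and \<rho> t :: real assume \<rho>: "\<rho> \<in> {0..1}" and t: "t \<in> {0..T}"
  show "((\<lambda>r. d_mixed T 0 i x r t $ c) has_real_derivative d_mixed T 0 (Suc i) x \<rho> t $ c) (at \<rho> within {0..1})" if "i < 4"
    unfolding d_mixed_simps(2) d_rho_def using C4 \<rho> t that
    by (intro has_real_derivative_component) (auto simp: parabolic_C4_def)
  show "((\<lambda>s. d_mixed T 0 i x \<rho> s $ c) has_real_derivative d_mixed T 1 i x \<rho> t $ c) (at t within {0..T})" if "i \<le> 2"
    unfolding one d_t_def using C4 \<rho> t that
    by (intro has_real_derivative_component) (auto simp: parabolic_C4_def)
  show "((\<lambda>s. d_mixed T 1 0 x \<rho> s $ c) has_real_derivative d_mixed T 2 0 x \<rho> t $ c) (at t within {0..T})"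
    unfolding two d_t_def[of _ "d_mixed T 1 0 x"] using C4 \<rho> t
    by (intro has_real_derivative_component) (auto simp: parabolic_C4_def)
  show "\<bar>d_mixed T 0 i x \<rho> t $ c\<bar> \<le> K" if "i \<le> 4" using comp[OF _ \<rho> t] that by auto
  show "\<bar>d_mixed T 1 i x \<rho> t $ c\<bar> \<le> K" if "i \<le> 2" using comp[OF _ \<rho> t] that by auto
  show "\<bar>d_mixed T 2 0 x \<rho> t $ c\<bar> \<le> K" using comp[OF _ \<rho> t] by auto
qed

text \<open>At an end point \<open>|\<partial>\<^sub>\<rho> f| \<ge> c\<close> and the sign is that of an inward increasing function since \<open>f \<ge> 0\<close>.\<close>

lemma (in smooth_fun) linear_lower_bound:
  assumes c: "0 < c" "c \<le> K" and t: "t \<in> {0..T}" and e: "e \<in> {0, 1}" and f0: "f 0 e t = 0" and f1: "c \<le> \<bar>f 1 e t\<bar>"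
    and nonneg: "\<And>\<rho>. \<rho> \<in> {0..1} \<Longrightarrow> 0 \<le> f 0 \<rho> t"
    and \<rho>: "\<rho> \<in> {0..1}" "\<bar>\<rho> - e\<bar> \<le> c / (2 * K)"
  shows "c / 2 * \<bar>\<rho> - e\<bar> \<le> f 0 \<rho> t"
proof -
  define \<sigma> where "\<sigma> = 1 - 2 * e"
  have \<sigma>: "\<bar>\<sigma>\<bar> = 1" using e by (auto simp: \<sigma>_def)
  have K0: "0 < K" using K1 by simp
  have em: "e \<in> {0..1}" using e by auto
  have ex: "\<bar>f 0 r t - \<sigma> * f 1 e t * \<bar>r - e\<bar>\<bar> \<le> K * \<bar>r - e\<bar>\<^sup>2" if "r \<in> {0..1}" for r
  proof -
    have "r - e = \<sigma> * \<bar>r - e\<bar>" using e that by (auto simp: \<sigma>_def)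
    then have "f 1 e t * (r - e) = \<sigma> * f 1 e t * \<bar>r - e\<bar>" by (metis mult.assoc mult.commute)
    moreover have "\<bar>f 0 r t - f 1 e t * (r - e)\<bar> \<le> K * \<bar>r - e\<bar>\<^sup>2"
      using taylor1[of 0 e r t] em that t f0 by simp
    ultimately show ?thesis by (simp only:)
  qed
  have "c \<le> \<sigma> * f 1 e t"
  proof (rule ccontr)
    assume "\<not> c \<le> \<sigma> * f 1 e t"
    moreover have "\<bar>\<sigma> * f 1 e t\<bar> = \<bar>f 1 e t\<bar>" by (simp add: abs_mult \<sigma>)
    ultimately have neg: "\<sigma> * f 1 e t \<le> - c" using f1 by linarith
    \<comment> \<open>At this distance an outward slope would contribute at most
      \<open>- c * s\<close>, while the quadratic remainder is only \<open>c / 2 * s\<close>;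
      \<open>f\<close> would become negative.\<close>
    define s where "s = c / (2 * K)"
    have s: "0 < s" "s \<le> 1 / 2" "K * s = c / 2" using c K0 by (auto simp: s_def)
    define r where "r = e + \<sigma> * s"
    have r: "r \<in> {0..1}" "\<bar>r - e\<bar> = s" using e s by (auto simp: r_def \<sigma>_def)
    have "0 \<le> f 0 r t" using nonneg[OF r(1)] .
    moreover have "f 0 r t \<le> \<sigma> * f 1 e t * s + K * s\<^sup>2" using ex[OF r(1)] unfolding r(2) by linarith
    moreover have "\<sigma> * f 1 e t * s \<le> - c * s" using neg s by (intro mult_right_mono) auto
    moreover have "K * s\<^sup>2 = c / 2 * s" using s(3) by (simp add: power2_eq_square mult.assoc[symmetric])
    moreover have "0 < c * s" using c s by simp
    ultimately show False by linarith
  qed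
  then have "c * \<bar>\<rho> - e\<bar> \<le> \<sigma> * f 1 e t * \<bar>\<rho> - e\<bar>" by (intro mult_right_mono) auto
  moreover have "K * \<bar>\<rho> - e\<bar>\<^sup>2 \<le> c / 2 * \<bar>\<rho> - e\<bar>"
  proof -
    have "K * \<bar>\<rho> - e\<bar> \<le> K * (c / (2 * K))" using \<rho>(2) K0 by (intro mult_left_mono) auto
    also have "\<dots> = c / 2" using K0 by simp
    finally have "K * \<bar>\<rho> - e\<bar> * \<bar>\<rho> - e\<bar> \<le> c / 2 * \<bar>\<rho> - e\<bar>" by (intro mult_right_mono) auto
    then show ?thesis by (simp add: power2_eq_square mult.assoc)
  qed
  ultimately show ?thesis using ex[OF \<rho>(1)] by linarith
qed

lemma norm_sq_real2: "(norm v)\<^sup>2 = (v $ 1)\<^sup>2 + (v $ 2)\<^sup>2" for v :: "real^2"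
  unfolding power2_norm_eq_inner by (simp add: inner_vec_def sum_2 power2_eq_square)

lemma inner_e1: "v \<bullet> e1 = v $ 1" and inner_e2: "v \<bullet> e2 = v $ 2" for v :: "real^2"
  by (simp_all add: inner_axis)

lemma perp_components: "perp v $ 1 = v $ 2" "perp v $ 2 = - (v $ 1)"
  by (simp_all add: perp_def)

text \<open>Compactness bounds the speed from below on the whole rectangle and
  \<open>x \<bullet> e1\<close> on a strip away from the ends. Near the ends, where
  \<open>x \<bullet> e1\<close> vanishes, \<open>linear_lower_bound\<close> takes over; its slope
  hypothesis is the speed bound, because \<open>b_\<rho> = 0\<close> there.\<close>

theorem smooth_solution_regular:
  assumes T: "0 < T" and sm: "smoothness_assumption T x"
  obtains K where "regular_curve T K
    (\<lambda>j \<rho> t. d_mixed T 0 j x \<rho> t $ 1) (\<lambda>j \<rho> t. d_mixed T 1 j x \<rho> t $ 1) (\<lambda>\<rho> t. d_mixed T 2 0 x \<rho> t $ 1)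
    (\<lambda>j \<rho> t. d_mixed T 0 j x \<rho> t $ 2) (\<lambda>j \<rho> t. d_mixed T 1 j x \<rho> t $ 2) (\<lambda>\<rho> t. d_mixed T 2 0 x \<rho> t $ 2)"
proof -
  have C4: "parabolic_C4 T x" using sm by (simp add: smoothness_assumption_def)
  have D: "d_mixed T 0 0 x = x" "d_mixed T 0 1 x = d_rho x" "d_mixed T 0 2 x = d_rho (d_rho x)" "d_mixed T 1 0 x = d_t T x"
    by (simp_all add: d_mixed_def numeral_2_eq_2)
  have nonneg: "0 \<le> x \<rho> t $ 1" if "\<rho> \<in> {0..1}" "t \<in> {0..T}" for \<rho> t
    using sm that by (auto simp: smoothness_assumption_def inner_e1)
  have pos: "0 < x \<rho> t $ 1" if "\<rho> \<in> {0<..<1}" "t \<in> {0..T}" for \<rho> t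
    using sm that by (auto simp: smoothness_assumption_def inner_e1)
  have bc: "x e t $ 1 = 0" "d_rho x e t $ 2 = 0" if "e \<in> {0, 1}" "t \<in> {0..T}" for e t
    using sm that by (auto simp: smoothness_assumption_def inner_e1 inner_e2)
  have ne: "d_rho x \<rho> t \<noteq> 0" if "\<rho> \<in> {0..1}" "t \<in> {0..T}" for \<rho> t
    using sm that by (auto simp: smoothness_assumption_def)
  have pde: "d_t T x \<rho> t = (1 / (norm (d_rho x \<rho> t))\<^sup>2) *\<^sub>R d_rho (d_rho x) \<rho> t
          - (1 / (norm (d_rho x \<rho> t))\<^sup>2 * ((d_rho x \<rho> t $ 2) / (x \<rho> t $ 1))) *\<^sub>R perp (d_rho x \<rho> t)"
    if "\<rho> \<in> {0<..<1}" "t \<in> {0<..T}" for \<rho> t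
    using sm that by (auto simp: smoothness_assumption_def inner_e1 inner_e2)
  define R where "R = {0..1::real} \<times> {0..T}"
  have R: "compact R" "R \<noteq> {}" using T by (auto simp: R_def intro: compact_Times)
  have cont: "continuous_on R (\<lambda>(\<rho>, t). d_mixed T i j x \<rho> t)" if "2 * i + j \<le> 4" for i j
    using C4 that by (auto simp: parabolic_C4_def R_def)
  obtain c where c: "0 < c" "\<And>\<rho> t. \<rho> \<in> {0..1} \<Longrightarrow> t \<in> {0..T} \<Longrightarrow> c \<le> norm (d_rho x \<rho> t)"
  proof -
    have "continuous_on R (\<lambda>p. norm ((\<lambda>(\<rho>, t). d_mixed T 0 1 x \<rho> t) p))" by (intro continuous_on_norm cont) auto
    then obtain p where p: "p \<in> R" "\<And>y. y \<in> R \<Longrightarrow> norm ((\<lambda>(\<rho>, t). d_mixed T 0 1 x \<rho> t) p) \<le> norm ((\<lambda>(\<rho>, t). d_mixed T 0 1 x \<rho> t) y)"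
      using continuous_attains_inf[OF R] by metis
    obtain \<rho>0 t0 where p0: "p = (\<rho>0, t0)" by (cases p)
    show ?thesis
    proof (rule that[of "norm (d_rho x \<rho>0 t0)"])
      show "0 < norm (d_rho x \<rho>0 t0)" using ne[of \<rho>0 t0] p(1) by (auto simp: R_def p0)
      show "norm (d_rho x \<rho>0 t0) \<le> norm (d_rho x \<rho> t)" if "\<rho> \<in> {0..1}" "t \<in> {0..T}" for \<rho> t
        using p(2)[of "(\<rho>, t)"] that unfolding D(2) by (auto simp: R_def p0)
    qed
  qed
  obtain K0 where K0: "\<And>i j \<rho> t. 2 * i + j \<le> 4 \<Longrightarrow> \<rho> \<in> {0..1} \<Longrightarrow> t \<in> {0..T} \<Longrightarrow> norm (d_mixed T i j x \<rho> t) \<le> K0"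
    using parabolic_C4_bounded[OF C4] by metis
  define L where "L = max 1 K0"
  have L: "norm (d_mixed T i j x \<rho> t) \<le> L" if "2 * i + j \<le> 4" "\<rho> \<in> {0..1}" "t \<in> {0..T}" for i j \<rho> t
    using K0[OF that] by (simp add: L_def)
  have L1: "1 \<le> L" by (simp add: L_def)
  have smooth: "smooth_fun T L (\<lambda>j \<rho> t. d_mixed T 0 j x \<rho> t $ k) (\<lambda>j \<rho> t. d_mixed T 1 j x \<rho> t $ k)
    (\<lambda>\<rho> t. d_mixed T 2 0 x \<rho> t $ k)" for k :: 2
    by (rule parabolic_C4_smooth_fun[OF C4 T L1 L])
  interpret S: smooth_fun T L "\<lambda>j \<rho> t. d_mixed T 0 j x \<rho> t $ 1" "\<lambda>j \<rho> t. d_mixed T 1 j x \<rho> t $ 1"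
    "\<lambda>\<rho> t. d_mixed T 2 0 x \<rho> t $ 1" by (rule smooth)
  have cL: "c \<le> L"
    using c(2)[of 0 0] L[of 0 1 0 0] T unfolding D(2) by simp
  define \<delta> where "\<delta> = c / (2 * L)"
  have \<delta>: "0 < \<delta>" "\<delta> \<le> 1 / 2" using c(1) cL L1 by (auto simp: \<delta>_def)
  have near: "c / 2 * \<bar>\<rho> - e\<bar> \<le> x \<rho> t $ 1" if "e \<in> {0, 1}" "\<rho> \<in> {0..1}" "t \<in> {0..T}" "\<bar>\<rho> - e\<bar> \<le> \<delta>" for e \<rho> t
  proof -
    have "(d_rho x e t $ 1)\<^sup>2 = (norm (d_rho x e t))\<^sup>2" using bc(2)[of e t] that by (simp add: norm_sq_real2)
    then have "\<bar>d_rho x e t $ 1\<bar> = norm (d_rho x e t)" by (metis abs_norm_cancel power2_eq_iff_nonneg abs_ge_zero power2_abs)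
    moreover have "e \<in> {0..1}" using that by auto
    ultimately have "c \<le> \<bar>d_rho x e t $ 1\<bar>" using c(2)[of e t] that by simp
    then show ?thesis
      using S.linear_lower_bound[of c t e \<rho>] c(1) cL that bc(1)[of e t] nonneg unfolding D \<delta>_def by simp
  qed
  obtain m where m: "0 < m" "\<And>\<rho> t. \<rho> \<in> {\<delta>..1 - \<delta>} \<Longrightarrow> t \<in> {0..T} \<Longrightarrow> m \<le> x \<rho> t $ 1"
  proof -
    define Q where "Q = {\<delta>..1 - \<delta>} \<times> {0..T}"
    have Q: "compact Q" "Q \<noteq> {}" "Q \<subseteq> R" using T \<delta> by (auto simp: Q_def R_def intro: compact_Times)
    have "continuous_on Q (\<lambda>p. (\<lambda>(\<rho>, t). d_mixed T 0 0 x \<rho> t) p $ 1)"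
      by (intro continuous_on_component continuous_on_subset[OF cont Q(3)]) auto
    then obtain p where p: "p \<in> Q" "\<And>y. y \<in> Q \<Longrightarrow> (\<lambda>(\<rho>, t). d_mixed T 0 0 x \<rho> t) p $ 1 \<le> (\<lambda>(\<rho>, t). d_mixed T 0 0 x \<rho> t) y $ 1"
      using continuous_attains_inf[OF Q(1,2)] by metis
    obtain \<rho>0 t0 where p0: "p = (\<rho>0, t0)" by (cases p)
    show ?thesis
    proof (rule that[of "x \<rho>0 t0 $ 1"])
      show "0 < x \<rho>0 t0 $ 1" using p(1) \<delta> by (intro pos) (auto simp: Q_def p0)
      show "x \<rho>0 t0 $ 1 \<le> x \<rho> t $ 1" if "\<rho> \<in> {\<delta>..1 - \<delta>}" "t \<in> {0..T}" for \<rho> t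
        using p(2)[of "(\<rho>, t)"] that unfolding D(1) by (auto simp: Q_def p0)
    qed
  qed
  define k where "k = min (c / 2) m"
  have k: "0 < k" "k \<le> c / 2" "k \<le> m" using c m by (auto simp: k_def)
  have a_ge: "k * (\<rho> * (1 - \<rho>)) \<le> x \<rho> t $ 1" if \<rho>: "\<rho> \<in> {0..1}" and t: "t \<in> {0..T}" for \<rho> t
  proof -
    have w: "0 \<le> \<rho> * (1 - \<rho>)" "\<rho> * (1 - \<rho>) \<le> \<rho>" "\<rho> * (1 - \<rho>) \<le> 1 - \<rho>"
      using \<rho> by (auto intro: mult_right_le_one_le mult_left_le_one_le)
    consider "\<rho> \<le> \<delta>" | "1 - \<delta> \<le> \<rho>" | "\<rho> \<in> {\<delta>..1 - \<delta>}" by fastforce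
    then show ?thesis
    proof cases
      case 1
      have "k * (\<rho> * (1 - \<rho>)) \<le> c / 2 * \<rho>" using k c w by (intro mult_mono) auto
      then show ?thesis using near[of 0 \<rho> t] \<rho> t 1 by simp
    next
      case 2
      have "k * (\<rho> * (1 - \<rho>)) \<le> c / 2 * (1 - \<rho>)" using k c w by (intro mult_mono) auto
      then show ?thesis using near[of 1 \<rho> t] \<rho> t 2 by simp
    next
      case 3
      have "k * (\<rho> * (1 - \<rho>)) \<le> m * 1" using k m w \<rho> by (intro mult_mono) auto
      then show ?thesis using m(2)[OF 3 t] by simp
    qed
  qed
  \<comment> \<open>The sum dominates the bound \<open>L\<close> of the derivatives and the
    reciprocals of both lower bounds.\<close>
  define K where "K = L + 1 / c\<^sup>2 + 1 / k"
  have "0 < 1 / c\<^sup>2" "0 < 1 / k" using c k by auto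
  then have KL: "L \<le> K" "1 / c\<^sup>2 \<le> K" "1 / k \<le> K" "0 < K" using L1 unfolding K_def by linarith+
  have Kc: "1 / K \<le> c\<^sup>2" "1 / K \<le> k" using KL c(1) k(1) by (auto simp: field_simps)
  have interior: "x \<rho> t $ 1 * ((norm (d_rho x \<rho> t))\<^sup>2 * d_t T x \<rho> t $ 1 - d_rho (d_rho x) \<rho> t $ 1) + (d_rho x \<rho> t $ 2)\<^sup>2 = 0"
    "x \<rho> t $ 1 * ((norm (d_rho x \<rho> t))\<^sup>2 * d_t T x \<rho> t $ 2 - d_rho (d_rho x) \<rho> t $ 2) - d_rho x \<rho> t $ 1 * d_rho x \<rho> t $ 2 = 0"
    if "\<rho> \<in> {0<..<1}" "t \<in> {0<..T}" for \<rho> t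
  proof -
    define N where "N = (norm (d_rho x \<rho> t))\<^sup>2"
    have N: "N \<noteq> 0" using ne[of \<rho> t] that by (simp add: N_def)
    have X: "x \<rho> t $ 1 \<noteq> 0" using pos[of \<rho> t] that by simp
    show "x \<rho> t $ 1 * ((norm (d_rho x \<rho> t))\<^sup>2 * d_t T x \<rho> t $ 1 - d_rho (d_rho x) \<rho> t $ 1) + (d_rho x \<rho> t $ 2)\<^sup>2 = 0"
      "x \<rho> t $ 1 * ((norm (d_rho x \<rho> t))\<^sup>2 * d_t T x \<rho> t $ 2 - d_rho (d_rho x) \<rho> t $ 2) - d_rho x \<rho> t $ 1 * d_rho x \<rho> t $ 2 = 0"
      unfolding pde[OF that] N_def[symmetric] using N X
      by (simp_all add: perp_components power2_eq_square algebra_simps)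
  qed
  show ?thesis
  proof (rule that[of K])
    show "regular_curve T K
      (\<lambda>j \<rho> t. d_mixed T 0 j x \<rho> t $ 1) (\<lambda>j \<rho> t. d_mixed T 1 j x \<rho> t $ 1) (\<lambda>\<rho> t. d_mixed T 2 0 x \<rho> t $ 1)
      (\<lambda>j \<rho> t. d_mixed T 0 j x \<rho> t $ 2) (\<lambda>j \<rho> t. d_mixed T 1 j x \<rho> t $ 2) (\<lambda>\<rho> t. d_mixed T 2 0 x \<rho> t $ 2)"
    proof (intro regular_curve.intro parabolic_C4_smooth_fun[OF C4 T] order_trans[OF L KL(1)]
        order_trans[OF L1 KL(1)] regular_curve_axioms.intro)
      fix \<rho> t :: real
      \<comment> \<open>At the ends the multiplied equations reduce to \<open>0 = 0\<close> by the
        boundary conditions; the differential equation is called on at interior points only.\<close>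
      have ends: "\<rho> \<in> {0..1} \<Longrightarrow> \<rho> \<in> {0, 1} \<or> \<rho> \<in> {0<..<1}" by auto
      show "d_mixed T 0 0 x \<rho> t $ 1 * (((d_mixed T 0 1 x \<rho> t $ 1)\<^sup>2 + (d_mixed T 0 1 x \<rho> t $ 2)\<^sup>2) * d_mixed T 1 0 x \<rho> t $ 1
          - d_mixed T 0 2 x \<rho> t $ 1) + (d_mixed T 0 1 x \<rho> t $ 2)\<^sup>2 = 0"
        "d_mixed T 0 0 x \<rho> t $ 1 * (((d_mixed T 0 1 x \<rho> t $ 1)\<^sup>2 + (d_mixed T 0 1 x \<rho> t $ 2)\<^sup>2) * d_mixed T 1 0 x \<rho> t $ 2
          - d_mixed T 0 2 x \<rho> t $ 2) - d_mixed T 0 1 x \<rho> t $ 1 * d_mixed T 0 1 x \<rho> t $ 2 = 0"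
        if "\<rho> \<in> {0..1}" "t \<in> {0<..T}"
        using ends[OF that(1)] interior[of \<rho> t] bc[of \<rho> t] that(2) unfolding D norm_sq_real2[symmetric] by auto
      show "1 / K \<le> (d_mixed T 0 1 x \<rho> t $ 1)\<^sup>2 + (d_mixed T 0 1 x \<rho> t $ 2)\<^sup>2" if "\<rho> \<in> {0..1}" "t \<in> {0..T}"
      proof -
        have "c\<^sup>2 \<le> (norm (d_rho x \<rho> t))\<^sup>2" using c that by (intro power_mono) auto
        then show ?thesis unfolding D norm_sq_real2[symmetric] using Kc(1) by linarith
      qed
      show "\<rho> * (1 - \<rho>) / K \<le> d_mixed T 0 0 x \<rho> t $ 1" if "\<rho> \<in> {0..1}" "t \<in> {0..T}"
      proof -
        have "1 / K * (\<rho> * (1 - \<rho>)) \<le> k * (\<rho> * (1 - \<rho>))" using Kc(2) that by (intro mult_right_mono) auto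
        then show ?thesis unfolding D using a_ge[OF that] by simp
      qed
    next
      fix e t :: real assume "e \<in> {0, 1}" "t \<in> {0..T}"
      then show "d_mixed T 0 0 x e t $ 1 = 0" "d_mixed T 0 1 x e t $ 2 = 0" unfolding D using bc by auto
    qed
  qed
qed

section \<open>Convergence\<close>

lemma scaleR_inverse_component: "(v /\<^sub>R r) $ c = v $ c / r" for v :: "real^2"
  by (simp only: vector_scaleR_component real_scaleR_def divide_inverse_commute)

lemma component_differences:
  "delta1 J v j $ c = cdiff (mesh J) (\<lambda>j. v j $ c) j" "delta2 J v j $ c = sdiff (mesh J) (\<lambda>j. v j $ c) j"
  "delta_minus J v j $ c = bdiff (mesh J) (\<lambda>j. v j $ c) j" "delta_plus J v 0 $ c = bdiff (mesh J) (\<lambda>j. v j $ c) 1"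
  by (simp_all only: delta1_def delta2_def delta_minus_def delta_plus_def cdiff_def sdiff_def bdiff_def
      scaleR_inverse_component) simp_all

lemma quotient_component: "((v - u) /\<^sub>R \<tau>) $ c = (v $ c - u $ c) / \<tau>" for v u :: "real^2"
  by (simp only: scaleR_inverse_component vector_minus_component)

lemma vec2_eq_iff: "v = w \<longleftrightarrow> v $ 1 = w $ 1 \<and> v $ 2 = w $ 2" for v w :: "real^2"
  by (simp add: vec_eq_iff forall_2)

text \<open>A discrete Sobolev inequality. Two values differ by at most the total variation, whose
  square is bounded by the squared seminorm because the interval has length one. Then
  \<open>low\<close> is averaged over all nodes with the trapezoidal weights, which add up to
  1.\<close>

lemma pointwise_norm_bound:
  fixes v :: "nat \<Rightarrow> real^2"
  assumes J: "J \<ge> 1" and j: "j \<le> J"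
  shows "(norm (v j))\<^sup>2 \<le> 2 * norm0_sq J v + 2 * seminorm1_sq J v"
proof -
  define h where "h = mesh J"
  have h: "0 < h" "real J * h = 1" using J by (auto simp: h_def mesh_def)
  define D where "D l = norm (v l - v (l - 1))" for l
  define s where "s = (\<Sum>l=1..J. D l)"
  have s2: "s\<^sup>2 \<le> seminorm1_sq J v"
  proof -
    have "s\<^sup>2 \<le> (\<Sum>l=1..J. (D l)\<^sup>2) * real J"
      unfolding s_def using sum_squared_le_sum_of_squares[of D "{1..J}"] by simp
    also have "\<dots> = h * (\<Sum>l=1..J. (D l)\<^sup>2) / h\<^sup>2"
      using h by (simp add: power2_eq_square field_simps)
    also have "\<dots> = seminorm1_sq J v"
    proof -
      have "(norm (delta_minus J v l))\<^sup>2 = (D l)\<^sup>2 / h\<^sup>2" for l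
      proof -
        have "norm (delta_minus J v l) = D l / h"
          using h(1) by (simp add: delta_minus_def D_def h_def[symmetric] divide_inverse_commute)
        then show ?thesis by (simp add: power_divide)
      qed
      then show ?thesis by (simp only: seminorm1_sq_def h_def[symmetric] sum_divide_distrib[symmetric] times_divide_eq_right)
    qed
    finally show ?thesis .
  qed
  have mono: "norm (v n - v m) \<le> s" if "m \<le> n" "n \<le> J" for m n
  proof -
    have "v n - v m = (\<Sum>l\<in>{Suc m..n}. v l - v (l - 1))" using sum_telescope''[OF that(1), of v] by simp
    then have "norm (v n - v m) \<le> (\<Sum>l\<in>{Suc m..n}. D l)" unfolding D_def by (simp add: norm_sum)
    also have "\<dots> \<le> s" unfolding s_def using that by (intro sum_mono2) (auto simp: D_def)
    finally show ?thesis .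
  qed
  have low: "(norm (v j))\<^sup>2 / 2 - seminorm1_sq J v \<le> (norm (v i))\<^sup>2" if i: "i \<le> J" for i
  proof -
    have "norm (v j - v i) \<le> s"
      using mono[of i j] mono[of j i] i j by (cases "i \<le> j") (auto simp: norm_minus_commute)
    then have "norm (v j) \<le> norm (v i) + s" using norm_triangle_ineq2[of "v j" "v i"] by linarith
    then have "(norm (v j))\<^sup>2 \<le> (norm (v i) + s)\<^sup>2" by (intro power_mono) auto
    also have "\<dots> = 4 * ((norm (v i) + s) / 2)\<^sup>2" by (simp add: power_divide)
    also have "\<dots> \<le> 4 * (((norm (v i))\<^sup>2 + s\<^sup>2) / 2)" by (intro mult_left_mono power2_mean_le) auto
    finally show ?thesis using s2 by simp
  qed
  define \<mu> where "\<mu> = (norm (v j))\<^sup>2 / 2 - seminorm1_sq J v"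
  have "\<mu> = 1 / 2 * h * \<mu> + h * (\<Sum>i=1..J-1. \<mu>) + 1 / 2 * h * \<mu>"
  proof -
    have "1 / 2 * h * \<mu> + h * (\<Sum>i=1..J-1. \<mu>) + 1 / 2 * h * \<mu> = (real (J - 1) + 1) * h * \<mu>"
      by (simp add: algebra_simps)
    also have "\<dots> = (real J * h) * \<mu>" using J by (simp add: of_nat_diff)
    finally show ?thesis by (simp add: h(2))
  qed
  also have "\<dots> \<le> 1 / 2 * h * (norm (v 0))\<^sup>2 + h * (\<Sum>i=1..J-1. (norm (v i))\<^sup>2) + 1 / 2 * h * (norm (v J))\<^sup>2"
    using h unfolding \<mu>_def by (intro add_mono mult_left_mono sum_mono low) auto
  also have "\<dots> = norm0_sq J v" by (simp add: norm0_sq_def h_def)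
  finally show ?thesis by (simp add: \<mu>_def)
qed

text \<open>The second component of the error has no Dirichlet condition and hence no Poincare
  inequality. The zeroth-order norm is obtained from the velocity instead, by summing increments
  from a zero start and Cauchy-Schwarz.\<close>

lemma norm0_sq_time_sum:
  fixes v :: "nat \<Rightarrow> nat \<Rightarrow> real^2"
  assumes \<tau>: "0 < \<tau>" and v0: "\<And>j. j \<le> J \<Longrightarrow> v 0 j = 0"
  shows "norm0_sq J (v m) \<le> real m * \<tau> * (\<tau> * (\<Sum>k=1..m. norm0_sq J (\<lambda>j. (v k j - v (k - 1) j) /\<^sub>R \<tau>)))"
proof -
  define h where "h = mesh J"
  have h: "0 \<le> h" by (simp add: h_def mesh_def)
  define W where "W k j = (norm ((v k j - v (k - 1) j) /\<^sub>R \<tau>))\<^sup>2" for k j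
  define C where "C = real m * \<tau>\<^sup>2"
  have pt: "(norm (v m j))\<^sup>2 \<le> C * (\<Sum>k=1..m. W k j)" if j: "j \<le> J" for j
  proof -
    have "v m j = (\<Sum>k\<in>{Suc 0..m}. v k j - v (k - 1) j)"
      using sum_telescope''[of 0 m "\<lambda>k. v k j"] v0[OF j] by simp
    then have "norm (v m j) \<le> (\<Sum>k\<in>{1..m}. norm (v k j - v (k - 1) j))" by (simp add: norm_sum)
    then have "(norm (v m j))\<^sup>2 \<le> (\<Sum>k\<in>{1..m}. norm (v k j - v (k - 1) j))\<^sup>2" by (intro power_mono) auto
    also have "\<dots> \<le> (\<Sum>k\<in>{1..m}. (norm (v k j - v (k - 1) j))\<^sup>2) * real m"
      using sum_squared_le_sum_of_squares[of "\<lambda>k. norm (v k j - v (k - 1) j)" "{1..m}"] by simp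
    also have "(\<Sum>k\<in>{1..m}. (norm (v k j - v (k - 1) j))\<^sup>2) = \<tau>\<^sup>2 * (\<Sum>k=1..m. W k j)"
      unfolding sum_distrib_left using \<tau> by (intro sum.cong) (auto simp: W_def power_mult_distrib power_inverse)
    finally show ?thesis by (simp add: C_def algebra_simps)
  qed
  have "norm0_sq J (v m) \<le> 1 / 2 * h * (C * (\<Sum>k=1..m. W k 0)) + h * (\<Sum>j=1..J-1. C * (\<Sum>k=1..m. W k j))
      + 1 / 2 * h * (C * (\<Sum>k=1..m. W k J))"
    unfolding norm0_sq_def h_def[symmetric] using h by (intro add_mono mult_left_mono sum_mono pt) auto
  also have "\<dots> = C * (1 / 2 * h * (\<Sum>k=1..m. W k 0) + h * (\<Sum>k=1..m. \<Sum>j=1..J-1. W k j) + 1 / 2 * h * (\<Sum>k=1..m. W k J))"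
  proof -
    have "(\<Sum>j=1..J-1. C * (\<Sum>k=1..m. W k j)) = C * (\<Sum>k=1..m. \<Sum>j=1..J-1. W k j)"
      unfolding sum_distrib_left[symmetric] by (subst sum.swap) (rule refl)
    then show ?thesis by (simp only: distrib_left mult.left_commute[of C])
  qed
  also have "\<dots> = C * (\<Sum>k=1..m. norm0_sq J (\<lambda>j. (v k j - v (k - 1) j) /\<^sub>R \<tau>))"
    unfolding norm0_sq_def h_def[symmetric] W_def[symmetric] by (simp only: sum.distrib sum_distrib_left)
  finally show ?thesis by (simp add: C_def power2_eq_square mult.assoc)
qed

section \<open>The scheme and the norms in components\<close>

context grid
begin

lemma mesh_h: "mesh J = h"
  by (simp add: mesh_def h_def)

lemma node_q: "node J j = q j"
  by (simp add: node_def q_def mesh_h)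

definition scheme where
  "scheme \<tau> A B A' B' \<longleftrightarrow>
    (\<forall>j\<in>{1..J-1}. (A' j - A j) / \<tau>
        = sdiff h A' j / speed_sq A B j - cdiff h B' j / A j * cdiff h B j / speed_sq A B j) \<and>
    (\<forall>j\<in>{1..J-1}. (B' j - B j) / \<tau>
        = sdiff h B' j / speed_sq A B j + cdiff h B' j / A j * cdiff h A j / speed_sq A B j) \<and>
    A' 0 = 0 \<and> A' J = 0 \<and>
    bdiff h B' 1 = h / 4 * speed_sq A B 0 * ((B' 0 - B 0) / \<tau>) \<and>
    bdiff h B' J = - (h / 4 * speed_sq A B J * ((B' J - B J) / \<tau>))"

lemma scheme_step_iff:
  "scheme_step J \<tau> U V \<longleftrightarrow> scheme \<tau> (\<lambda>j. U j $ 1) (\<lambda>j. U j $ 2) (\<lambda>j. V j $ 1) (\<lambda>j. V j $ 2)"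
proof -
  have speed: "(norm (delta1 J U j))\<^sup>2 = speed_sq (\<lambda>j. U j $ 1) (\<lambda>j. U j $ 2) j" if "j \<in> {1..J-1}" for j
    using that by (simp add: norm_sq_real2 component_differences mesh_h speed_sq_simps)
  have speed0: "(norm (delta_plus J U 0))\<^sup>2 = speed_sq (\<lambda>j. U j $ 1) (\<lambda>j. U j $ 2) 0"
    "(norm (delta_minus J U J))\<^sup>2 = speed_sq (\<lambda>j. U j $ 1) (\<lambda>j. U j $ 2) J"
    by (simp_all add: norm_sq_real2 component_differences mesh_h speed_sq_simps)
  have *: "((V j - U j) /\<^sub>R \<tau> = (1 / (norm (delta1 J U j))\<^sup>2) *\<^sub>R delta2 J V j
          - (1 / (norm (delta1 J U j))\<^sup>2 * ((delta1 J V j \<bullet> e2) / (U j \<bullet> e1))) *\<^sub>R perp (delta1 J U j))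
     \<longleftrightarrow> ((V j $ 1 - U j $ 1) / \<tau> = sdiff h (\<lambda>j. V j $ 1) j / speed_sq (\<lambda>j. U j $ 1) (\<lambda>j. U j $ 2) j
        - cdiff h (\<lambda>j. V j $ 2) j / U j $ 1 * cdiff h (\<lambda>j. U j $ 2) j / speed_sq (\<lambda>j. U j $ 1) (\<lambda>j. U j $ 2) j) \<and>
      ((V j $ 2 - U j $ 2) / \<tau> = sdiff h (\<lambda>j. V j $ 2) j / speed_sq (\<lambda>j. U j $ 1) (\<lambda>j. U j $ 2) j
        + cdiff h (\<lambda>j. V j $ 2) j / U j $ 1 * cdiff h (\<lambda>j. U j $ 1) j / speed_sq (\<lambda>j. U j $ 1) (\<lambda>j. U j $ 2) j)"
    if "j \<in> {1..J-1}" for j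
    unfolding vec2_eq_iff quotient_component speed[OF that]
    by (simp add: inner_e1 inner_e2 component_differences mesh_h perp_components mult.commute[of _ "U j $ 1"])
  show ?thesis
    unfolding scheme_step_def scheme_def speed0 inner_e1 inner_e2 component_differences mesh_h quotient_component
    using * by (auto simp: inner_e1 inner_e2 component_differences mesh_h quotient_component)
qed

lemma norms_components:
  fixes v :: "nat \<Rightarrow> real^2"
  shows "seminorm1_sq J v = S1 (\<lambda>j. v j $ 1) + S1 (\<lambda>j. v j $ 2)"
    and "seminorm2_sq J v = S2 (\<lambda>j. v j $ 1) + S2 (\<lambda>j. v j $ 2)"
    and "v 0 $ 1 = 0 \<Longrightarrow> v J $ 1 = 0 \<Longrightarrow> norm0_sq J v
      \<le> h * (\<Sum>j=1..J-1. (v j $ 1)\<^sup>2 + (v j $ 2)\<^sup>2) + h * (v 0 $ 2)\<^sup>2 + h * (v J $ 2)\<^sup>2"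
proof -
  have "0 \<le> h * (v 0 $ 2)\<^sup>2" "0 \<le> h * (v J $ 2)\<^sup>2" using h_pos by auto
  then show "v 0 $ 1 = 0 \<Longrightarrow> v J $ 1 = 0 \<Longrightarrow> norm0_sq J v
      \<le> h * (\<Sum>j=1..J-1. (v j $ 1)\<^sup>2 + (v j $ 2)\<^sup>2) + h * (v 0 $ 2)\<^sup>2 + h * (v J $ 2)\<^sup>2"
    by (simp add: norm0_sq_def norm_sq_real2 mesh_h)
qed (simp_all add: seminorm1_sq_def seminorm2_sq_def S1_def S2_def norm_sq_real2
      component_differences mesh_h sum.distrib distrib_left)

end

text \<open>The new value also occurs on the right; for \<open>y \<le> 1 / 2\<close> it can be moved
  over since \<open>1 + y \<le> (1 - y) * (1 + 4 * y)\<close>, hence the rate 4.\<close>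

lemma gronwall_step:
  fixes \<theta> \<theta>' y :: real
  assumes "\<theta>' - \<theta> \<le> y * (\<theta>' + \<theta>)" "0 \<le> y" "y \<le> 1 / 2" "0 \<le> \<theta>"
  shows "\<theta>' \<le> exp (4 * y) * \<theta>"
proof -
  have "(1 - y) * \<theta>' \<le> (1 + y) * \<theta>" using assms(1) by (simp add: algebra_simps)
  also have "(1 + y) * \<theta> \<le> ((1 - y) * (1 + 4 * y)) * \<theta>"
  proof (rule mult_right_mono)
    have "y * y \<le> y * (1 / 2)" using assms by (intro mult_left_mono) auto
    then show "1 + y \<le> (1 - y) * (1 + 4 * y)" by (simp add: algebra_simps)
  qed fact
  finally have "(1 - y) * \<theta>' \<le> (1 - y) * ((1 + 4 * y) * \<theta>)" by (simp add: mult.assoc)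
  then have "\<theta>' \<le> (1 + 4 * y) * \<theta>" using assms by (simp add: mult_le_cancel_left)
  also have "\<dots> \<le> exp (4 * y) * \<theta>" using assms exp_ge_add_one_self[of "4 * y"] by (intro mult_right_mono) auto
  finally show ?thesis .
qed

text \<open>This and the next two constants are the \<open>K\<close> of
  \<open>consistent_step\<close>, the \<epsilon> of \<open>perturbed_step\<close> and the factor in
  \<open>step_energy_estimate\<close>, taken for the exact curve.\<close>

definition consistency_const :: "real \<Rightarrow> real" where "consistency_const K = 50 * K ^ 6"

definition closeness :: "real \<Rightarrow> real" where "closeness K = 1 / (1000 * consistency_const K ^ 7)"

definition growth_const :: "real \<Rightarrow> real" where "growth_const K = 10 ^ 6 * consistency_const K ^ 13"

text \<open>The thresholds serve in turn the discrete speed of the exact curve, the solvability of a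
  step, the condition \<open>y \<le> 1 / 2\<close> of \<open>gronwall_step\<close>, and the closing
  of the induction in \<open>bound_small\<close>.\<close>

definition max_mesh :: "real \<Rightarrow> real \<Rightarrow> real" where
  "max_mesh T K = Min {1 / (8 * K ^ 3), 1 / (100 * consistency_const K ^ 2), 1 / (2 * growth_const K),
    (closeness K)\<^sup>2 / (338 * K ^ 10 * exp (4 * growth_const K * T))}"

locale scheme_analysis = regular_curve + grid +
  fixes M :: nat and \<tau> :: real
  assumes M: "1 \<le> M" and \<tau>_def: "\<tau> = T / real M" and \<tau>_le: "\<tau> \<le> h" and h_small: "h \<le> max_mesh T K"
begin

definition "K1 = consistency_const K"
definition "S = 13 * K ^ 5 * (h\<^sup>2 + \<tau>)"
definition "tm m = real m * \<tau>" for m :: nat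
definition "ea m j = fa 0 (q j) (tm m)"
definition "eb m j = fb 0 (q j) (tm m)"

lemma \<tau>_pos: "0 < \<tau>" and M\<tau>: "real M * \<tau> = T"
  using M A.T by (auto simp: \<tau>_def)

lemma K_power: "0 < K ^ n" "1 \<le> K ^ n"
  using A.K1 by auto

lemma K1: "1 \<le> K1" "0 < K1 ^ n"
proof -
  show "1 \<le> K1" using K_power(2)[of 6] by (simp add: K1_def consistency_const_def)
  then show "0 < K1 ^ n" by simp
qed

lemma growth_pos: "0 < growth_const K"
  using K1(2)[of 13] by (simp add: growth_const_def K1_def)

lemma h_bounds:
  "h \<le> 1 / (8 * K ^ 3)" "h \<le> 1 / (100 * K1 ^ 2)" "\<tau> * growth_const K \<le> 1 / 2"
  "exp (4 * growth_const K * T) * (338 * K ^ 10 * h) \<le> (closeness K)\<^sup>2"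
proof -
  show "h \<le> 1 / (8 * K ^ 3)" "h \<le> 1 / (100 * K1 ^ 2)" using h_small by (simp_all add: max_mesh_def K1_def)
  have "h \<le> 1 / (2 * growth_const K)" using h_small by (simp add: max_mesh_def)
  then have "\<tau> * growth_const K \<le> 1 / (2 * growth_const K) * growth_const K"
    using \<tau>_le growth_pos by (intro mult_right_mono) auto
  then show "\<tau> * growth_const K \<le> 1 / 2" using growth_pos by simp
  define c where "c = 338 * K ^ 10 * exp (4 * growth_const K * T)"
  have c: "0 < c" unfolding c_def using K_power(1)[of 10] by (intro mult_pos_pos) auto
  have "h \<le> (closeness K)\<^sup>2 / c" using h_small by (simp add: max_mesh_def c_def)
  then have "h * c \<le> (closeness K)\<^sup>2" using c by (simp add: pos_le_divide_eq)
  then show "exp (4 * growth_const K * T) * (338 * K ^ 10 * h) \<le> (closeness K)\<^sup>2"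
    by (simp add: c_def mult.commute mult.left_commute)
qed

lemma discretized:
  assumes "m < M"
  shows "discretized_curve T K fa ga ka fb gb kb J h (tm m) (tm (Suc m))"
proof unfold_locales
  show "0 \<le> tm m" "tm m < tm (Suc m)" using \<tau>_pos by (simp_all add: tm_def)
  have "real (Suc m) * \<tau> \<le> real M * \<tau>" using assms \<tau>_pos by (intro mult_right_mono) auto
  then show "tm (Suc m) \<le> T" unfolding M\<tau> tm_def .
qed (rule h_bounds)

lemma consistent:
  assumes m: "m < M"
  shows "consistent_step J h K1 S \<tau> (1 / (fa 1 0 (tm m))\<^sup>2) (1 / (fa 1 1 (tm m))\<^sup>2)
    (ea m) (eb m) (ea (Suc m)) (eb (Suc m))"
proof -
  interpret D: discretized_curve T K fa ga ka fb gb kb J h "tm m" "tm (Suc m)" by (rule discretized[OF m])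
  have "D.\<tau> = \<tau>" unfolding D.\<tau>_def unfolding tm_def by (simp add: distrib_right)
  moreover from this have "13 * K ^ 5 * D.\<delta> = S" by (simp add: D.\<delta>_def S_def)
  moreover have "D.xa = ea m" "D.xb = eb m" "D.xa' = ea (Suc m)" "D.xb' = eb (Suc m)"
    by (simp_all add: fun_eq_iff D.xa_def D.xb_def D.xa'_def D.xb'_def ea_def eb_def)
  ultimately show ?thesis using D.exact_solution_consistent by (simp add: K1_def consistency_const_def)
qed

lemma sdiff_ea: "m < M \<Longrightarrow> j \<in> {1..J-1} \<Longrightarrow> \<bar>sdiff h (ea m) j\<bar> \<le> K1"
proof -
  assume m: "m < M" and j: "j \<in> {1..J-1}"
  interpret D: discretized_curve T K fa ga ka fb gb kb J h "tm m" "tm (Suc m)" by (rule discretized[OF m])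
  have "\<bar>(fa 0 (q j + h) (tm m) - 2 * fa 0 (q j) (tm m) + fa 0 (q j - h) (tm m)) / h\<^sup>2 - fa 2 (q j) (tm m)\<bar> \<le> K * h\<^sup>2"
    using h_pos D.stencil[OF j] D.ts by (intro A.second_quotient) auto
  then have "\<bar>sdiff h (ea m) j - fa 2 (q j) (tm m)\<bar> \<le> K * h\<^sup>2"
    unfolding sdiff_def ea_def D.stencil(3,4)[OF j] .
  moreover have "\<bar>fa 2 (q j) (tm m)\<bar> \<le> K" using A.bf[of 2 "q j" "tm m"] D.stencil(5)[OF j] D.ts by simp
  moreover have "K * h\<^sup>2 \<le> K * 1" using D.h_sq h_le A.K1 by (intro mult_left_mono) auto
  moreover have "2 * K \<le> K1" using power_increasing[of 1 6 K] A.K1 by (simp add: K1_def consistency_const_def)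
  ultimately show ?thesis by linarith
qed

lemma ea_ends: "m \<le> M \<Longrightarrow> ea m 0 = 0" "m \<le> M \<Longrightarrow> ea m J = 0"
proof -
  assume "m \<le> M"
  then have "real m * \<tau> \<le> real M * \<tau>" using \<tau>_pos by (intro mult_right_mono) auto
  then have "tm m \<in> {0..T}" unfolding M\<tau> using \<tau>_pos by (simp add: tm_def)
  moreover have "q 0 = 0" "q J = 1" using Jh by (simp_all add: q_def)
  ultimately show "ea m 0 = 0" "ea m J = 0" using bc_a by (simp_all add: ea_def)
qed

text \<open>Only the first \<open>n\<close> steps are asked for: the a priori bounds up to level
  \<open>n\<close> are what makes step \<open>n + 1\<close> solvable, so existence and error bounds
  alternate.\<close>

definition numerical :: "nat \<Rightarrow> (nat \<Rightarrow> nat \<Rightarrow> real) \<Rightarrow> (nat \<Rightarrow> nat \<Rightarrow> real) \<Rightarrow> bool" where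
  "numerical n A B \<longleftrightarrow> (\<forall>j\<le>J. A 0 j = ea 0 j \<and> B 0 j = eb 0 j) \<and>
    (\<forall>m<n. scheme \<tau> (A m) (B m) (A (Suc m)) (B (Suc m)))"

definition "\<alpha> A m j = ea m j - A m j" for A :: "nat \<Rightarrow> nat \<Rightarrow> real"
definition "\<beta> B m j = eb m j - B m j" for B :: "nat \<Rightarrow> nat \<Rightarrow> real"
definition "\<Phi> A B m = S1 (\<alpha> A m) + S1 (\<beta> B m)"
definition "Y A B m = S2 (\<alpha> A m) + S2 (\<beta> B m) + Z (\<beta> B m) + G (\<beta> B m)"
text \<open>The energy with the dissipation accumulated so far. The offset \<open>S^2 / 2\<close>
  turns the inhomogeneous step estimate into a homogeneous one, since two neighbouring values of
  \<Theta> contain \<open>S^2\<close> in full.\<close>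

definition "\<Theta> A B m = \<Phi> A B m + \<tau> / (18 * K1\<^sup>2) * (\<Sum>k=1..m. Y A B k) + S\<^sup>2 / 2"
definition "bound = exp (4 * growth_const K * T) * (S\<^sup>2 / 2)"

text \<open>The first form, which rests on \<tau> \<le> \<open>h\<close>, leaves a power of
  \<open>h\<close> to spare when slopes are bounded pointwise; the second is the rate of the final
  estimate.\<close>

lemma S_sq: "S\<^sup>2 \<le> 676 * K ^ 10 * h\<^sup>2" "S\<^sup>2 \<le> 338 * K ^ 10 * (h ^ 4 + \<tau>\<^sup>2)"
proof -
  have "h\<^sup>2 \<le> h" using h_pos h_le by (simp add: power2_eq_square mult_left_le)
  then have "(h\<^sup>2 + \<tau>)\<^sup>2 \<le> (2 * h)\<^sup>2" using \<tau>_le \<tau>_pos by (intro power_mono) auto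
  then have "169 * K ^ 10 * (h\<^sup>2 + \<tau>)\<^sup>2 \<le> 169 * K ^ 10 * (2 * h)\<^sup>2"
    using K_power(1)[of 10] by (intro mult_left_mono) auto
  moreover have S2: "S\<^sup>2 = 169 * K ^ 10 * (h\<^sup>2 + \<tau>)\<^sup>2" by (simp add: S_def power_mult_distrib flip: power_mult)
  ultimately show "S\<^sup>2 \<le> 676 * K ^ 10 * h\<^sup>2" by (simp add: power_mult_distrib)
  have "(h\<^sup>2 + \<tau>)\<^sup>2 \<le> 2 * (h ^ 4 + \<tau>\<^sup>2)"
    using power2_mean_le[of "h\<^sup>2" \<tau>] by (simp add: power_divide flip: power_mult)
  then have "169 * K ^ 10 * (h\<^sup>2 + \<tau>)\<^sup>2 \<le> 169 * K ^ 10 * (2 * (h ^ 4 + \<tau>\<^sup>2))"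
    using K_power(1)[of 10] by (intro mult_left_mono) auto
  then show "S\<^sup>2 \<le> 338 * K ^ 10 * (h ^ 4 + \<tau>\<^sup>2)" unfolding S2 by (simp add: distrib_left)
qed

lemma bound_small: "bound \<le> (closeness K)\<^sup>2 * h"
proof -
  have "bound \<le> exp (4 * growth_const K * T) * (676 * K ^ 10 * h\<^sup>2 / 2)"
    unfolding bound_def using S_sq(1) by (intro mult_left_mono divide_right_mono) auto
  also have "\<dots> = exp (4 * growth_const K * T) * (338 * K ^ 10 * h) * h" by (simp add: power2_eq_square)
  also have "\<dots> \<le> (closeness K)\<^sup>2 * h" using h_bounds(4) h_pos by (intro mult_right_mono) auto
  finally show ?thesis .
qed

section \<open>A priori bounds for a numerical solution up to level \<open>n\<close>\<close>

context
  fixes n A B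
  assumes num: "numerical n A B" and n: "n \<le> M"
begin

lemma numerical_ends: "m \<le> n \<Longrightarrow> A m 0 = 0 \<and> A m J = 0"
  using num ea_ends[of 0] by (cases m) (auto simp: numerical_def scheme_def)

lemma \<Phi>_nonneg: "0 \<le> \<Phi> A B m" and Y_nonneg: "0 \<le> Y A B m"
  using S1_nonneg S2_nonneg Z_nonneg G_nonneg by (auto simp: \<Phi>_def Y_def)

lemma perturbed:
  assumes m: "m \<le> n" "m < M" and small: "\<Phi> A B m \<le> (closeness K)\<^sup>2 * h"
  shows "perturbed_step J h K1 S \<tau> (1 / (fa 1 0 (tm m))\<^sup>2) (1 / (fa 1 1 (tm m))\<^sup>2)
    (ea m) (eb m) (ea (Suc m)) (eb (Suc m)) (A m) (B m) (closeness K)"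
proof -
  have eps: "0 \<le> closeness K" using K1(2)[of 7] by (simp add: closeness_def K1_def)
  have b: "\<bar>bdiff h u j\<bar> \<le> closeness K" if "S1 u \<le> (closeness K)\<^sup>2 * h" "j \<in> {1..J}" for u j
  proof -
    have "(bdiff h u j)\<^sup>2 \<le> (\<Sum>j=1..J. (bdiff h u j)\<^sup>2)" using that(2) by (intro member_le_sum) auto
    then have "h * (bdiff h u j)\<^sup>2 \<le> S1 u" using h_pos by (simp add: S1_def)
    also have "\<dots> \<le> h * (closeness K)\<^sup>2" using that(1) by (simp add: mult.commute)
    finally have "(bdiff h u j)\<^sup>2 \<le> (closeness K)\<^sup>2" using h_pos by simp
    then show ?thesis using eps by (simp add: abs_le_square_iff[symmetric])
  qed
  have "S1 (\<alpha> A m) \<le> (closeness K)\<^sup>2 * h" "S1 (\<beta> B m) \<le> (closeness K)\<^sup>2 * h"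
    using small S1_nonneg[of "\<alpha> A m"] S1_nonneg[of "\<beta> B m"] unfolding \<Phi>_def by linarith+
  then have "\<bar>bdiff h (\<alpha> A m) j\<bar> \<le> closeness K" "\<bar>bdiff h (\<beta> B m) j\<bar> \<le> closeness K" if "j \<in> {1..J}" for j
    using that by (auto intro: b)
  then show ?thesis
    unfolding \<alpha>_def \<beta>_def bdiff_diff
    by (intro perturbed_step.intro consistent m perturbed_step_axioms.intro)
      (use numerical_ends[OF m(1)] eps in \<open>auto simp: closeness_def K1_def\<close>)
qed

lemma scheme_error:
  assumes m: "m < n" and small: "\<Phi> A B m \<le> (closeness K)\<^sup>2 * h"
  shows "scheme_step_error J h K1 S \<tau> (1 / (fa 1 0 (tm m))\<^sup>2) (1 / (fa 1 1 (tm m))\<^sup>2)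
    (ea m) (eb m) (ea (Suc m)) (eb (Suc m)) (A m) (B m) (closeness K) (A (Suc m)) (B (Suc m))"
proof -
  have "scheme \<tau> (A m) (B m) (A (Suc m)) (B (Suc m))" using num m by (auto simp: numerical_def)
  then show ?thesis using m n small
    by (intro scheme_step_error.intro perturbed scheme_step_error_axioms.intro) (auto simp: scheme_def)
qed

lemma step_estimates:
  assumes m: "m < n" and small: "\<Phi> A B m \<le> (closeness K)\<^sup>2 * h"
  shows "\<Phi> A B (Suc m) - \<Phi> A B m + \<tau> / (18 * K1\<^sup>2) * Y A B (Suc m)
      \<le> \<tau> * growth_const K * (\<Phi> A B (Suc m) + \<Phi> A B m + S\<^sup>2)"
    and "h * (\<Sum>j=1..J-1. ((\<alpha> A (Suc m) j - \<alpha> A m j) / \<tau>)\<^sup>2 + ((\<beta> B (Suc m) j - \<beta> B m j) / \<tau>)\<^sup>2)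
      + h * ((\<beta> B (Suc m) 0 - \<beta> B m 0) / \<tau>)\<^sup>2 + h * ((\<beta> B (Suc m) J - \<beta> B m J) / \<tau>)\<^sup>2
      \<le> 10 ^ 8 * K1 ^ 16 * (Y A B (Suc m) + \<Phi> A B m + S\<^sup>2)"
proof -
  interpret E: scheme_step_error J h K1 S \<tau> "1 / (fa 1 0 (tm m))\<^sup>2" "1 / (fa 1 1 (tm m))\<^sup>2"
    "ea m" "eb m" "ea (Suc m)" "eb (Suc m)" "A m" "B m" "closeness K" "A (Suc m)" "B (Suc m)"
    by (rule scheme_error[OF m small])
  have e: "E.\<alpha> = \<alpha> A m" "E.\<beta> = \<beta> B m" "E.\<alpha>' = \<alpha> A (Suc m)" "E.\<beta>' = \<beta> B (Suc m)"
    by (simp_all add: fun_eq_iff E.\<alpha>_def E.\<beta>_def E.\<alpha>'_def E.\<beta>'_def \<alpha>_def \<beta>_def)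
  have Y: "E.Y = Y A B (Suc m)" by (simp add: E.Y_def Y_def e)
  show "\<Phi> A B (Suc m) - \<Phi> A B m + \<tau> / (18 * K1\<^sup>2) * Y A B (Suc m)
      \<le> \<tau> * growth_const K * (\<Phi> A B (Suc m) + \<Phi> A B m + S\<^sup>2)"
    using E.step_energy_estimate unfolding e Y \<Phi>_def growth_const_def K1_def .
  show "h * (\<Sum>j=1..J-1. ((\<alpha> A (Suc m) j - \<alpha> A m j) / \<tau>)\<^sup>2 + ((\<beta> B (Suc m) j - \<beta> B m j) / \<tau>)\<^sup>2)
      + h * ((\<beta> B (Suc m) 0 - \<beta> B m 0) / \<tau>)\<^sup>2 + h * ((\<beta> B (Suc m) J - \<beta> B m J) / \<tau>)\<^sup>2
      \<le> 10 ^ 8 * K1 ^ 16 * (Y A B (Suc m) + \<Phi> A B m + S\<^sup>2)"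
    using E.step_velocity_estimate unfolding e Y \<Phi>_def .
qed

lemma \<Phi>_le_\<Theta>: "\<Phi> A B m \<le> \<Theta> A B m - S\<^sup>2 / 2"
  using Y_nonneg \<tau>_pos by (auto simp: \<Theta>_def intro!: mult_nonneg_nonneg sum_nonneg divide_nonneg_nonneg)

text \<open>A bootstrap: the estimate for the step from \<open>m\<close> needs small slopes at level
  \<open>m\<close>, and these follow from the bound just proved at \<open>m\<close> by
  \<open>bound_small\<close>. The smallness is always derived from the final \<open>bound\<close>,
  so it does not deteriorate along the induction.\<close>

lemma \<Theta>_bound: "m \<le> n \<Longrightarrow> \<Theta> A B m \<le> bound"
proof -
  have exp_le: "exp (4 * growth_const K * (real m * \<tau>)) * (S\<^sup>2 / 2) \<le> bound" if "m \<le> n" for m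
  proof -
    have "real m * \<tau> \<le> real M * \<tau>" using that n \<tau>_pos by (intro mult_right_mono) auto
    then have "4 * growth_const K * (real m * \<tau>) \<le> 4 * growth_const K * T"
      unfolding M\<tau> using growth_pos by (intro mult_left_mono) auto
    then show ?thesis unfolding bound_def by (intro mult_right_mono) auto
  qed
  have "\<Theta> A B m \<le> exp (4 * growth_const K * (real m * \<tau>)) * (S\<^sup>2 / 2)" if "m \<le> n" for m
    using that
  proof (induction m)
    case 0
    have "bdiff h (\<alpha> A 0) j = 0" "bdiff h (\<beta> B 0) j = 0" if "j \<in> {1..J}" for j
      using num that by (auto simp: numerical_def \<alpha>_def \<beta>_def bdiff_def)
    then have "\<Phi> A B 0 = 0" by (simp add: \<Phi>_def S1_def)
    then show ?case by (simp add: \<Theta>_def)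
  next
    case (Suc m)
    then have IH: "\<Theta> A B m \<le> exp (4 * growth_const K * (real m * \<tau>)) * (S\<^sup>2 / 2)" and m: "m < n" by auto
    have "\<Theta> A B m \<le> bound" using IH exp_le[of m] m by linarith
    then have "\<Phi> A B m \<le> (closeness K)\<^sup>2 * h"
      using \<Phi>_le_\<Theta>[of m] bound_small zero_le_power2[of S] by linarith
    note est = step_estimates(1)[OF m this]
    have nonneg: "0 \<le> \<Theta> A B m" using \<Phi>_le_\<Theta>[of m] \<Phi>_nonneg[of m] zero_le_power2[of S] by linarith
    have "\<Theta> A B (Suc m) - \<Theta> A B m = \<Phi> A B (Suc m) - \<Phi> A B m + \<tau> / (18 * K1\<^sup>2) * Y A B (Suc m)"
      by (simp add: \<Theta>_def distrib_left)
    also have "\<dots> \<le> \<tau> * growth_const K * (\<Phi> A B (Suc m) + \<Phi> A B m + S\<^sup>2)" by (rule est)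
    also have "\<dots> \<le> \<tau> * growth_const K * (\<Theta> A B (Suc m) + \<Theta> A B m)"
      using \<Phi>_le_\<Theta>[of m] \<Phi>_le_\<Theta>[of "Suc m"] \<tau>_pos growth_pos by (intro mult_left_mono) auto
    finally have "\<Theta> A B (Suc m) \<le> exp (4 * (\<tau> * growth_const K)) * \<Theta> A B m"
      using nonneg \<tau>_pos growth_pos h_bounds(3) by (intro gronwall_step) auto
    also have "\<dots> \<le> exp (4 * (\<tau> * growth_const K)) * (exp (4 * growth_const K * (real m * \<tau>)) * (S\<^sup>2 / 2))"
      using IH by (intro mult_left_mono) auto
    also have "\<dots> = exp (4 * growth_const K * (real (Suc m) * \<tau>)) * (S\<^sup>2 / 2)"
      by (simp add: mult_exp_exp algebra_simps)
    finally show ?case .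
  qed
  then show "m \<le> n \<Longrightarrow> \<Theta> A B m \<le> bound" using exp_le by (meson order_trans)
qed

lemma \<Phi>_bound: "m \<le> n \<Longrightarrow> \<Phi> A B m \<le> bound"
  using \<Phi>_le_\<Theta>[of m] \<Theta>_bound[of m] zero_le_power2[of S] by linarith

lemma \<Phi>_small: "m \<le> n \<Longrightarrow> \<Phi> A B m \<le> (closeness K)\<^sup>2 * h"
  using \<Phi>_bound bound_small by (meson order_trans)

lemma dissipation_bound: "\<tau> * (\<Sum>k=1..n. Y A B k) \<le> 18 * K1\<^sup>2 * bound"
proof -
  have "\<tau> / (18 * K1\<^sup>2) * (\<Sum>k=1..n. Y A B k) \<le> bound"
    using \<Theta>_bound[of n] \<Phi>_nonneg[of n] zero_le_power2[of S] unfolding \<Theta>_def by linarith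
  then have "18 * K1\<^sup>2 * (\<tau> / (18 * K1\<^sup>2) * (\<Sum>k=1..n. Y A B k)) \<le> 18 * K1\<^sup>2 * bound"
    by (intro mult_left_mono) auto
  then show ?thesis using K1(1) by simp
qed

lemma numerical_nonvanishing:
  assumes "m \<le> n" "m < M" "j \<in> {1..J-1}"
  shows "0 < speed_sq (A m) (B m) j" "0 < A m j"
proof -
  interpret P: perturbed_step J h K1 S \<tau> "1 / (fa 1 0 (tm m))\<^sup>2" "1 / (fa 1 1 (tm m))\<^sup>2"
    "ea m" "eb m" "ea (Suc m)" "eb (Suc m)" "A m" "B m" "closeness K"
    using assms by (intro perturbed \<Phi>_small) auto
  show "0 < speed_sq (A m) (B m) j" using assms by (intro P.D_pos) auto
  show "0 < A m j" using P.A_pos(1) assms(3) .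
qed

lemma numerical_extend:
  assumes "n < M"
  obtains A' B' where "scheme \<tau> (A n) (B n) A' B'"
proof -
  interpret P: perturbed_step J h K1 S \<tau> "1 / (fa 1 0 (tm n))\<^sup>2" "1 / (fa 1 1 (tm n))\<^sup>2"
    "ea n" "eb n" "ea (Suc n)" "eb (Suc n)" "A n" "B n" "closeness K"
    using assms by (intro perturbed \<Phi>_small) auto
  show ?thesis
    by (rule P.solvable[OF h_bounds(2) sdiff_ea[OF assms]], assumption)
      (rule that, unfold scheme_def, intro conjI ballI, assumption+)
qed

end

lemma numerical_exists: "n \<le> M \<Longrightarrow> \<exists>A B. numerical n A B"
proof (induction n)
  case 0
  show ?case by (intro exI[of _ ea] exI[of _ eb]) (simp add: numerical_def)
next
  case (Suc n)
  then obtain A B where AB: "numerical n A B" by auto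
  obtain A' B' where s: "scheme \<tau> (A n) (B n) A' B'" using numerical_extend[OF AB] Suc.prems by auto
  have "numerical (Suc n) (A(Suc n := A')) (B(Suc n := B'))"
    using AB s by (auto simp: numerical_def less_Suc_eq)
  then show ?case by blast
qed

text \<open>The summands stem from the accumulated dissipation, the old energy and the consistency
  error, the last two over the total time \<open>T\<close>, each as a multiple of
  \<open>S^2\<close>.\<close>

definition velocity_const :: real where
  "velocity_const = 10 ^ 8 * K1 ^ 16 * (18 * K1\<^sup>2 * (exp (4 * growth_const K * T) / 2)
    + T * (exp (4 * growth_const K * T) / 2) + T)"

lemma velocity_const_nonneg: "0 \<le> velocity_const"
  using K1 A.T by (auto simp: velocity_const_def intro!: mult_nonneg_nonneg add_nonneg_nonneg)

section \<open>Error bounds for an arbitrary discrete solution\<close>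

context
  fixes x :: "real \<Rightarrow> real \<Rightarrow> real^2" and X :: "nat \<Rightarrow> nat \<Rightarrow> real^2"
  assumes x: "\<And>\<rho> t. fa 0 \<rho> t = x \<rho> t $ 1" "\<And>\<rho> t. fb 0 \<rho> t = x \<rho> t $ 2"
    and X: "discrete_solution x T J M X"
begin

definition "A = (\<lambda>m j. X m j $ 1)"
definition "B = (\<lambda>m j. X m j $ 2)"
definition "E = err x T J M X"

lemma solution_numerical: "numerical M A B"
  using X unfolding discrete_solution_def numerical_def scheme_step_iff \<tau>_def[symmetric]
  by (auto simp: A_def B_def ea_def eb_def x tm_def node_q)

lemma E_components: "E m j $ 1 = \<alpha> A m j" "E m j $ 2 = \<beta> B m j"
  by (simp_all add: E_def err_def \<alpha>_def \<beta>_def ea_def eb_def x A_def B_def tm_def node_q \<tau>_def[symmetric])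

lemma E_seminorms: "seminorm1_sq J (E m) = \<Phi> A B m" "seminorm2_sq J (E m) \<le> Y A B m"
  unfolding norms_components E_components \<Phi>_def Y_def using Z_nonneg G_nonneg by simp_all

lemma seminorm1_bound: "m \<le> M \<Longrightarrow> seminorm1_sq J (E m) \<le> exp (4 * growth_const K * T) / 2 * S\<^sup>2"
  using \<Phi>_bound[OF solution_numerical] unfolding E_seminorms bound_def by simp

lemma seminorm2_bound:
  "\<tau> * (\<Sum>m=1..M. seminorm2_sq J (E m)) \<le> 18 * K1\<^sup>2 * (exp (4 * growth_const K * T) / 2) * S\<^sup>2"
proof -
  have "\<tau> * (\<Sum>m=1..M. seminorm2_sq J (E m)) \<le> \<tau> * (\<Sum>m=1..M. Y A B m)"
    using \<tau>_pos by (intro mult_left_mono sum_mono E_seminorms) auto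
  also have "\<dots> \<le> 18 * K1\<^sup>2 * bound" by (rule dissipation_bound[OF solution_numerical]) simp
  finally show ?thesis by (simp add: bound_def mult.commute mult.left_commute)
qed

lemma velocity_bound:
  "\<tau> * (\<Sum>m=1..M. norm0_sq J (\<lambda>j. (E m j - E (m - 1) j) /\<^sub>R \<tau>)) \<le> velocity_const * S\<^sup>2"
proof -
  define c where "c = 10 ^ 8 * K1 ^ 16"
  define e where "e = exp (4 * growth_const K * T) / 2"
  have c: "0 \<le> c" using K1 by (simp add: c_def)
  have v: "norm0_sq J (\<lambda>j. (E m j - E (m - 1) j) /\<^sub>R \<tau>) \<le> c * (Y A B m + e * S\<^sup>2 + S\<^sup>2)" if m: "m \<in> {1..M}" for m
  proof -
    obtain k where k: "m = Suc k" "k < M" using m by (cases m) auto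
    have z: "\<alpha> A i j = 0" if "i \<le> M" "j \<in> {0, J}" for i j
      using numerical_ends[OF solution_numerical, of i] ea_ends[of i] that by (auto simp: \<alpha>_def)
    have "norm0_sq J (\<lambda>j. (E m j - E (m - 1) j) /\<^sub>R \<tau>)
      \<le> h * (\<Sum>j=1..J-1. ((\<alpha> A (Suc k) j - \<alpha> A k j) / \<tau>)\<^sup>2 + ((\<beta> B (Suc k) j - \<beta> B k j) / \<tau>)\<^sup>2)
      + h * ((\<beta> B (Suc k) 0 - \<beta> B k 0) / \<tau>)\<^sup>2 + h * ((\<beta> B (Suc k) J - \<beta> B k J) / \<tau>)\<^sup>2"
    proof (rule order_trans[OF norms_components(3)])
      show "((E m 0 - E (m - 1) 0) /\<^sub>R \<tau>) $ 1 = 0" "((E m J - E (m - 1) J) /\<^sub>R \<tau>) $ 1 = 0"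
        unfolding quotient_component E_components using z k by simp_all
    qed (simp only: quotient_component E_components k diff_Suc_1 order_refl)
    also have "\<dots> \<le> c * (Y A B (Suc k) + \<Phi> A B k + S\<^sup>2)"
      unfolding c_def using k by (intro step_estimates(2)[OF solution_numerical] \<Phi>_small[OF solution_numerical]) auto
    also have "\<dots> \<le> c * (Y A B (Suc k) + e * S\<^sup>2 + S\<^sup>2)"
      using seminorm1_bound[of k] k c unfolding E_seminorms e_def by (intro mult_left_mono add_mono) auto
    finally show ?thesis by (simp add: k)
  qed
  have "\<tau> * (\<Sum>m=1..M. norm0_sq J (\<lambda>j. (E m j - E (m - 1) j) /\<^sub>R \<tau>))
      \<le> \<tau> * (\<Sum>m=1..M. c * (Y A B m + e * S\<^sup>2 + S\<^sup>2))"
    using \<tau>_pos by (intro mult_left_mono sum_mono v) auto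
  also have "\<dots> = c * (\<tau> * (\<Sum>m=1..M. Y A B m) + (real M * \<tau>) * (e * S\<^sup>2 + S\<^sup>2))"
    by (simp add: sum.distrib sum_distrib_left[symmetric] algebra_simps)
  also have "\<dots> \<le> c * (18 * K1\<^sup>2 * bound + T * (e * S\<^sup>2 + S\<^sup>2))"
    unfolding M\<tau> using dissipation_bound[OF solution_numerical] c by (intro mult_left_mono add_right_mono) auto
  also have "\<dots> = velocity_const * S\<^sup>2"
  proof -
    have "velocity_const = c * (18 * K1\<^sup>2 * e + T * e + T)" by (simp only: velocity_const_def c_def e_def)
    moreover have "bound = e * S\<^sup>2" by (simp add: bound_def e_def)
    ultimately show ?thesis by (simp add: algebra_simps)
  qed
  finally show ?thesis .
qed

lemma norm0_bound: "m \<le> M \<Longrightarrow> norm0_sq J (E m) \<le> T * (velocity_const * S\<^sup>2)"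
proof -
  assume m: "m \<le> M"
  have nn: "0 \<le> norm0_sq J v" for v
    unfolding norm0_sq_def mesh_h using h_pos by (intro add_nonneg_nonneg mult_nonneg_nonneg sum_nonneg) auto
  have "E 0 j = 0" if "j \<le> J" for j
    using solution_numerical that unfolding vec2_eq_iff E_components by (simp add: \<alpha>_def \<beta>_def numerical_def)
  then have "norm0_sq J (E m) \<le> real m * \<tau> * (\<tau> * (\<Sum>k=1..m. norm0_sq J (\<lambda>j. (E k j - E (k - 1) j) /\<^sub>R \<tau>)))"
    by (rule norm0_sq_time_sum[OF \<tau>_pos])
  also have "\<dots> \<le> T * (\<tau> * (\<Sum>k=1..M. norm0_sq J (\<lambda>j. (E k j - E (k - 1) j) /\<^sub>R \<tau>)))"
  proof (intro mult_mono mult_left_mono sum_mono2)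
    show "real m * \<tau> \<le> T" unfolding M\<tau>[symmetric] using m \<tau>_pos by (intro mult_right_mono) auto
  qed (use m \<tau>_pos A.T nn in \<open>auto intro!: mult_nonneg_nonneg sum_nonneg\<close>)
  also have "\<dots> \<le> T * (velocity_const * S\<^sup>2)" using velocity_bound A.T by (intro mult_left_mono) auto
  finally show ?thesis .
qed

lemma error_estimates:
  defines "e \<equiv> exp (4 * growth_const K * T) / 2"
  shows "(MAX m\<in>{1..M}. norm1_sq J (E m) + (MAX j\<in>{0..J}. (norm (E m j))\<^sup>2))
      \<le> 338 * K ^ 10 * (3 * T * velocity_const + 3 * e + 18 * K1\<^sup>2 * e + velocity_const) * (h ^ 4 + \<tau>\<^sup>2)"
    and "\<tau> * (\<Sum>m=1..M. seminorm2_sq J (E m) + norm0_sq J (\<lambda>j. (E m j - E (m - 1) j) /\<^sub>R \<tau>))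
      \<le> 338 * K ^ 10 * (3 * T * velocity_const + 3 * e + 18 * K1\<^sup>2 * e + velocity_const) * (h ^ 4 + \<tau>\<^sup>2)"
proof -
  \<comment> \<open>The 3 is 1 from \<open>norm1_sq\<close> plus 2 from
    \<open>pointwise_norm_bound\<close>. Both claims are then stated with the common constant
    \<open>c1 + c2\<close>.\<close>
  define c1 c2 where "c1 = 3 * T * velocity_const + 3 * e" and "c2 = 18 * K1\<^sup>2 * e + velocity_const"
  have c: "0 \<le> c1" "0 \<le> c2"
    using velocity_const_nonneg A.T by (auto simp: c1_def c2_def e_def intro!: add_nonneg_nonneg mult_nonneg_nonneg)
  have final: "y \<le> 338 * K ^ 10 * (c1 + c2) * (h ^ 4 + \<tau>\<^sup>2)" if "y \<le> k * S\<^sup>2" "k \<le> c1 + c2" "0 \<le> k" for y k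
  proof -
    have "k * S\<^sup>2 \<le> (c1 + c2) * (338 * K ^ 10 * (h ^ 4 + \<tau>\<^sup>2))"
      using that S_sq(2) c by (intro mult_mono) auto
    then show ?thesis using that(1) by (simp add: algebra_simps)
  qed
  have cc: "3 * T * velocity_const + 3 * e + 18 * K1\<^sup>2 * e + velocity_const = c1 + c2"
    by (simp add: c1_def c2_def)
  show "(MAX m\<in>{1..M}. norm1_sq J (E m) + (MAX j\<in>{0..J}. (norm (E m j))\<^sup>2))
      \<le> 338 * K ^ 10 * (3 * T * velocity_const + 3 * e + 18 * K1\<^sup>2 * e + velocity_const) * (h ^ 4 + \<tau>\<^sup>2)"
    unfolding cc
  proof (rule final)
    show "(MAX m\<in>{1..M}. norm1_sq J (E m) + (MAX j\<in>{0..J}. (norm (E m j))\<^sup>2)) \<le> c1 * S\<^sup>2"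
    proof (rule Max.boundedI)
      fix y assume "y \<in> (\<lambda>m. norm1_sq J (E m) + (MAX j\<in>{0..J}. (norm (E m j))\<^sup>2)) ` {1..M}"
      then obtain m where m: "m \<le> M" and y: "y = norm1_sq J (E m) + (MAX j\<in>{0..J}. (norm (E m j))\<^sup>2)" by auto
      have "(MAX j\<in>{0..J}. (norm (E m j))\<^sup>2) \<le> 2 * norm0_sq J (E m) + 2 * seminorm1_sq J (E m)"
      proof (rule Max.boundedI)
        fix z assume "z \<in> (\<lambda>j. (norm (E m j))\<^sup>2) ` {0..J}"
        then show "z \<le> 2 * norm0_sq J (E m) + 2 * seminorm1_sq J (E m)"
          using pointwise_norm_bound[of J _ "E m"] J_ge_2 by auto
      qed auto
      then have "y \<le> 3 * norm0_sq J (E m) + 3 * seminorm1_sq J (E m)" unfolding y norm1_sq_def by linarith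
      also have "\<dots> \<le> 3 * (T * (velocity_const * S\<^sup>2)) + 3 * (e * S\<^sup>2)"
        using norm0_bound[OF m] seminorm1_bound[OF m] by (simp add: e_def)
      finally show "y \<le> c1 * S\<^sup>2" by (simp add: c1_def algebra_simps)
    qed (use M in auto)
  qed (use c in auto)
  show "\<tau> * (\<Sum>m=1..M. seminorm2_sq J (E m) + norm0_sq J (\<lambda>j. (E m j - E (m - 1) j) /\<^sub>R \<tau>))
      \<le> 338 * K ^ 10 * (3 * T * velocity_const + 3 * e + 18 * K1\<^sup>2 * e + velocity_const) * (h ^ 4 + \<tau>\<^sup>2)"
    unfolding cc
  proof (rule final)
    show "\<tau> * (\<Sum>m=1..M. seminorm2_sq J (E m) + norm0_sq J (\<lambda>j. (E m j - E (m - 1) j) /\<^sub>R \<tau>)) \<le> c2 * S\<^sup>2"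
      using seminorm2_bound velocity_bound
      by (simp add: sum.distrib distrib_left c2_def e_def distrib_right)
  qed (use c in auto)
qed

end

lemma discrete_solution_exists:
  assumes x: "\<And>\<rho> t. fa 0 \<rho> t = x \<rho> t $ 1" "\<And>\<rho> t. fb 0 \<rho> t = x \<rho> t $ 2"
  shows "\<exists>X. discrete_solution x T J M X"
proof -
  obtain A B where AB: "numerical M A B" using numerical_exists by blast
  define X where "X m j = (vector [A m j, B m j] :: real^2)" for m j
  have X: "X m j $ 1 = A m j" "X m j $ 2 = B m j" for m j by (simp_all add: X_def)
  have "X 0 j = x (node J j) 0" if "j \<le> J" for j
    using AB that unfolding vec2_eq_iff X by (auto simp: numerical_def ea_def eb_def x tm_def node_q)
  moreover have "nonvanishing_denominators J (X m)" if "m < M" for m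
    unfolding nonvanishing_denominators_def
  proof
    fix j assume j: "j \<in> {1..J-1}"
    have "(norm (delta1 J (X m) j))\<^sup>2 = speed_sq (A m) (B m) j"
      using j by (simp add: norm_sq_real2 component_differences mesh_h speed_sq_simps X)
    then show "(norm (delta1 J (X m) j))\<^sup>2 \<noteq> 0 \<and> X m j \<bullet> e1 \<noteq> 0"
      using numerical_nonvanishing[OF AB _ _ that j] that by (auto simp: inner_e1 X)
  qed
  moreover have "scheme_step J \<tau> (X m) (X (m + 1))" if "m < M" for m
    using AB that unfolding scheme_step_iff X by (auto simp: numerical_def)
  ultimately have "discrete_solution x T J M X"
    unfolding discrete_solution_def \<tau>_def[symmetric] by auto
  then show ?thesis by blast
qed

end

theorem theorem2p4:
  fixes T :: real and x :: "real \<Rightarrow> real \<Rightarrow> real^2"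
  assumes "T > 0" and "smoothness_assumption T x"
  shows "\<exists>h0>0. \<exists>\<gamma>>0. \<exists>C>0. \<forall>(J::nat) (M::nat) (h::real) (\<Delta>t::real).
    J \<ge> 2 \<longrightarrow> M \<ge> 1 \<longrightarrow> h = 1 / real J \<longrightarrow> \<Delta>t = T / real M \<longrightarrow> 0 < h \<longrightarrow> h \<le> h0 \<longrightarrow> \<Delta>t \<le> \<gamma> * h \<longrightarrow>
      (\<exists>X. discrete_solution x T J M X) \<and>
      (\<forall>X. discrete_solution x T J M X \<longrightarrow>
         (let E = err x T J M X in
           (MAX m\<in>{1..M}. norm1_sq J (E m) + (MAX j\<in>{0..J}. (norm (E m j))\<^sup>2))
             \<le> C * (h ^ 4 + \<Delta>t\<^sup>2) \<and>
           \<Delta>t * (\<Sum>m=1..M. seminorm2_sq J (E m)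
                     + norm0_sq J (\<lambda>j. (E m j - E (m - 1) j) /\<^sub>R \<Delta>t))
             \<le> C * (h ^ 4 + \<Delta>t\<^sup>2)))"
proof -
  obtain K where R: "regular_curve T K
    (\<lambda>j \<rho> t. d_mixed T 0 j x \<rho> t $ 1) (\<lambda>j \<rho> t. d_mixed T 1 j x \<rho> t $ 1) (\<lambda>\<rho> t. d_mixed T 2 0 x \<rho> t $ 1)
    (\<lambda>j \<rho> t. d_mixed T 0 j x \<rho> t $ 2) (\<lambda>j \<rho> t. d_mixed T 1 j x \<rho> t $ 2) (\<lambda>\<rho> t. d_mixed T 2 0 x \<rho> t $ 2)"
    using smooth_solution_regular[OF assms] .
  interpret R: regular_curve T K
    "\<lambda>j \<rho> t. d_mixed T 0 j x \<rho> t $ 1" "\<lambda>j \<rho> t. d_mixed T 1 j x \<rho> t $ 1" "\<lambda>\<rho> t. d_mixed T 2 0 x \<rho> t $ 1"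
    "\<lambda>j \<rho> t. d_mixed T 0 j x \<rho> t $ 2" "\<lambda>j \<rho> t. d_mixed T 1 j x \<rho> t $ 2" "\<lambda>\<rho> t. d_mixed T 2 0 x \<rho> t $ 2"
    by (rule R)
  \<comment> \<open>\<open>e\<close>, \<open>k\<close> and \<open>v\<close> repeat constants of
    \<open>scheme_analysis\<close> outside that locale, so that \<open>C\<close> is fixed before
    \<open>J\<close> and \<open>M\<close> are chosen.\<close>
  define e where "e = exp (4 * growth_const K * T) / 2"
  define k where "k = consistency_const K"
  define v where "v = 10 ^ 8 * k ^ 16 * (18 * k\<^sup>2 * e + T * e + T)"
  define C where "C = 338 * K ^ 10 * (3 * T * v + 3 * e + 18 * k\<^sup>2 * e + v)"
  have K: "0 < K" "0 < k" using R.K0 by (simp_all add: k_def consistency_const_def)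
  have growth: "0 < growth_const K" using K by (simp add: growth_const_def k_def)
  have "0 < e" by (simp add: e_def)
  moreover have "0 \<le> v" using K \<open>0 < e\<close> assms(1) by (auto simp: v_def intro!: mult_nonneg_nonneg add_nonneg_nonneg)
  moreover have "0 \<le> 3 * T * v" "0 \<le> 18 * k\<^sup>2 * e" using \<open>0 < e\<close> \<open>0 \<le> v\<close> assms(1) by auto
  ultimately have "0 < 3 * T * v + 3 * e + 18 * k\<^sup>2 * e + v" by linarith
  then have C: "0 < C" unfolding C_def using K by (intro mult_pos_pos) auto
  have h0: "0 < max_mesh T K" using K growth by (simp add: max_mesh_def closeness_def k_def)
  have main: "(\<exists>X. discrete_solution x T J M X) \<and>
      (\<forall>X. discrete_solution x T J M X \<longrightarrow>
         (let E = err x T J M X in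
           (MAX m\<in>{1..M}. norm1_sq J (E m) + (MAX j\<in>{0..J}. (norm (E m j))\<^sup>2))
             \<le> C * (h ^ 4 + \<Delta>t\<^sup>2) \<and>
           \<Delta>t * (\<Sum>m=1..M. seminorm2_sq J (E m)
                     + norm0_sq J (\<lambda>j. (E m j - E (m - 1) j) /\<^sub>R \<Delta>t))
             \<le> C * (h ^ 4 + \<Delta>t\<^sup>2)))"
    if "J \<ge> 2" "M \<ge> 1" "h = 1 / real J" "\<Delta>t = T / real M" "h \<le> max_mesh T K" "\<Delta>t \<le> 1 * h"
    for J M :: nat and h \<Delta>t :: real
  proof -
    interpret P: scheme_analysis T K
      "\<lambda>j \<rho> t. d_mixed T 0 j x \<rho> t $ 1" "\<lambda>j \<rho> t. d_mixed T 1 j x \<rho> t $ 1" "\<lambda>\<rho> t. d_mixed T 2 0 x \<rho> t $ 1"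
      "\<lambda>j \<rho> t. d_mixed T 0 j x \<rho> t $ 2" "\<lambda>j \<rho> t. d_mixed T 1 j x \<rho> t $ 2" "\<lambda>\<rho> t. d_mixed T 2 0 x \<rho> t $ 2"
      J h M \<Delta>t
      using that by unfold_locales auto
    have x: "d_mixed T 0 0 x \<rho> t $ c = x \<rho> t $ c" for \<rho> t c by (simp add: d_mixed_simps(1))
    have v: "P.velocity_const = v" unfolding P.velocity_const_def v_def P.K1_def k_def e_def ..
    have est: "(MAX m\<in>{1..M}. norm1_sq J (err x T J M X m) + (MAX j\<in>{0..J}. (norm (err x T J M X m j))\<^sup>2))
        \<le> C * (h ^ 4 + \<Delta>t\<^sup>2)"
      "\<Delta>t * (\<Sum>m=1..M. seminorm2_sq J (err x T J M X m)
          + norm0_sq J (\<lambda>j. (err x T J M X m j - err x T J M X (m - 1) j) /\<^sub>R \<Delta>t)) \<le> C * (h ^ 4 + \<Delta>t\<^sup>2)"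
      if X: "discrete_solution x T J M X" for X
      using P.error_estimates[of x X, OF x x X] unfolding P.E_def[of x X, OF x x X] v P.K1_def
      unfolding C_def k_def e_def by blast+
    show ?thesis using P.discrete_solution_exists[of x, OF x x] est by (simp add: Let_def)
  qed
  \<comment> \<open>The choice \<gamma> = 1 is the hypothesis \<tau> \<le> \<open>h\<close> of
    \<open>scheme_analysis\<close>.\<close>
  show ?thesis
    by (rule exI[of _ "max_mesh T K"], rule conjI[OF h0], rule exI[of _ 1], rule conjI[OF zero_less_one],
        rule exI[of _ C], rule conjI[OF C]) (use main in blast)
qed

end
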